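(* There are absolute constants $C,c>0$ such that the following holds. Let $N\geq 1$ be an integer and let $A\subseteq\{1,\ldots,N\}$ with $\lvert A\rvert=\alpha N$, where $\alpha>0$. Then the sumset $A+A+A=\{a_1+a_2+a_3: a_i\in A\}$ contains an arithmetic progression of length at least \[\exp\left(-C\log(2/\alpha)^2\right)N^{c/\log(2/\alpha)^{9}}.\] *)

theory Defs
  imports Complex_Main "HOL-Library.Set_Algebras"
begin

text \<open>Since \<open>d \<noteq> 0\<close>, the terms are pairwise distinct, so the set has exactly \<open>k\<close> elements.\<close>

definition is_AP_of_length :: "int set \<Rightarrow> nat \<Rightarrow> bool" where
  "is_AP_of_length P k \<longleftrightarrow> (\<exists>a d. d \<noteq> 0 \<and> P = (\<lambda>i. a + int i * d) ` {..<k})"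

text \<open>Sumsets are written with the elementwise addition of sets from
  \<^theory>\<open>HOL-Library.Set_Algebras\<close>, i.e. \<open>A + B = {c. \<exists>a\<in>A. \<exists>b\<in>B. c = a + b}\<close>.\<close>

end

theory Submission imports Defs "HOL-Library.FuncSet" begin

text \<open>A density increment argument after Kelley--Meka and Bloom--Sisask.  Suppose that \<open>A\<close> has
  density \<open>\<alpha>\<close> on a translate of a Bohr set \<open>B\<close> and that \<open>A + A + A\<close> contains no translate of a
  slightly narrower Bohr set.  Then the autocorrelation of \<open>A\<close> has a large moment of order about
  \<open>ln (2 / \<alpha>)\<close>, and sifting gives a fairly dense set \<open>D\<close> on most differences of which this
  autocorrelation exceeds its expected value by a constant factor.  Almost periodicity allows one to
  smooth \<open>D - D\<close> with a large set \<open>X\<close>, and Chang's theorem, relative to \<open>B\<close>, replaces \<open>X\<close> by a Bohr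
  set of rank larger by \<open>O(ln (2 / \<alpha>) ^ 6)\<close>, on a translate of which \<open>A\<close> is denser by a constant
  factor.  This happens \<open>O(ln (2 / \<alpha>))\<close> times at most, and a Bohr set of bounded rank contains a long
  progression.

  In the smoothing step the Fourier transform is applied to the autocorrelation of \<open>A\<close> itself and not
  to its superlevel set.  This loses only a factor \<open>1 / \<alpha>\<close>, so that \<open>O(ln (2 / \<alpha>))\<close> convolutions
  with \<open>X\<close> suffice.\<close>

section \<open>Powers of Gram matrices\<close>

text \<open>Why three summands: a translate missed by \<open>A + A + A\<close> gives a point
  \<open>y\<close> such that, whenever \<open>w - e + d\<close> lies in \<open>A\<close>, no two
  elements of \<open>A\<close> sum to \<open>e - d + y\<close>. The third summand only selects a
  positive proportion of pairs, and the analysis concerns \<open>A + A\<close>. A deficit of sums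
  has the wrong sign for a density increment; positive definiteness of the autocorrelation turns its
  even moments into an excess.

  Where the exponents come from: put r = O(ln (2 / \<alpha>)). Moments of order r suffice, as a
  proportion \<alpha> / 2 of the pairs matters only through its p-th root. Sifting costs density exp
  (- O(r^2)). The k = O(r) convolutions ask for accuracy of order 1/k in the sampling, so for m =
  O(k^2 r^2) = O(r^4) samples, and Chang's theorem gives O(m r^2) = O(r^6) frequencies. After O(r)
  steps the rank is O(r^7), which implies the stated 9. Each step narrows the Bohr set by exp (-
  O(r)), whence the factor exp (- C r^2).

  A lower bound \<open>a\<close> for the density and an upper bound \<open>D\<close> for the rank
  are fixed in advance, so that all steps use the same widths.\<close>

lemma sum_power_PiE:
  fixes g :: "'s \<Rightarrow> 'b::comm_semiring_1"
  assumes "finite R"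
  shows "(\<Sum>s\<in>R. g s) ^ p = (\<Sum>f\<in>{..<p} \<rightarrow>\<^sub>E R. \<Prod>i<p. g (f i))"
  using prod_sum_PiE[of "{..<p}" "\<lambda>_. R" "\<lambda>_. g"] assms by simp

text \<open>Expanding over \<open>p\<close>-tuples of columns shows that an entrywise power of a
  Gram matrix is again a Gram matrix, that of the tensor powers of the rows. The weight
  \<open>w\<close> is general because sifting evaluates both the full sum and the sum over bad
  pairs.\<close>

lemma gram_power:
  fixes \<phi> :: "'e \<Rightarrow> 's \<Rightarrow> real" and \<psi> :: "'d \<Rightarrow> 's \<Rightarrow> real"
  assumes "finite R"
  shows "(\<Sum>e\<in>E. \<Sum>d\<in>D. w e d * (\<Sum>s\<in>R. \<phi> e s * \<psi> d s) ^ p) =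
    (\<Sum>f\<in>{..<p} \<rightarrow>\<^sub>E R. \<Sum>e\<in>E. \<Sum>d\<in>D. w e d * ((\<Prod>i<p. \<phi> e (f i)) * (\<Prod>i<p. \<psi> d (f i))))"
proof -
  have "(\<Sum>e\<in>E. \<Sum>d\<in>D. w e d * (\<Sum>s\<in>R. \<phi> e s * \<psi> d s) ^ p) =
    (\<Sum>e\<in>E. \<Sum>d\<in>D. \<Sum>f\<in>{..<p} \<rightarrow>\<^sub>E R. w e d * ((\<Prod>i<p. \<phi> e (f i)) * (\<Prod>i<p. \<psi> d (f i))))"
    by (simp add: sum_power_PiE[OF assms] prod.distrib sum_distrib_left)
  also have "\<dots> = (\<Sum>e\<in>E. \<Sum>f\<in>{..<p} \<rightarrow>\<^sub>E R. \<Sum>d\<in>D. w e d * ((\<Prod>i<p. \<phi> e (f i)) * (\<Prod>i<p. \<psi> d (f i))))"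
    by (intro sum.cong refl sum.swap)
  also have "\<dots> = (\<Sum>f\<in>{..<p} \<rightarrow>\<^sub>E R. \<Sum>e\<in>E. \<Sum>d\<in>D. w e d * ((\<Prod>i<p. \<phi> e (f i)) * (\<Prod>i<p. \<psi> d (f i))))"
    by (rule sum.swap)
  finally show ?thesis .
qed

lemma gram_power_product:
  fixes \<phi> :: "'e \<Rightarrow> 's \<Rightarrow> real" and \<psi> :: "'d \<Rightarrow> 's \<Rightarrow> real"
  assumes "finite R"
  shows "(\<Sum>e\<in>E. \<Sum>d\<in>D. (\<Sum>s\<in>R. \<phi> e s * \<psi> d s) ^ p) =
    (\<Sum>f\<in>{..<p} \<rightarrow>\<^sub>E R. (\<Sum>e\<in>E. \<Prod>i<p. \<phi> e (f i)) * (\<Sum>d\<in>D. \<Prod>i<p. \<psi> d (f i)))"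
  using gram_power[OF assms, where w="\<lambda>_ _. 1"] by (simp add: sum_product)

text \<open>Schur's product theorem tested on the all-one vector: the tuple expansion is a sum of
  squares, for odd \<open>p\<close> as well. This permits dropping terms of a binomial expansion in
  \<open>high_moment_of_missing_sums\<close>.\<close>

lemma gram_power_nonneg:
  fixes \<phi> :: "'e \<Rightarrow> 's \<Rightarrow> real"
  assumes "finite R"
  shows "0 \<le> (\<Sum>e\<in>E. \<Sum>d\<in>E. (\<Sum>s\<in>R. \<phi> e s * \<phi> d s) ^ p)"
  unfolding gram_power_product[OF assms] by (intro sum_nonneg) simp

text \<open>Over tuples the sum on the left is an inner product of two vectors and the right side is
  the sum of their squared lengths. With suitable rows it passes from moments of a convolution to
  moments of an autocorrelation.\<close>

lemma gram_power_le:
  fixes \<phi> :: "'e \<Rightarrow> 's \<Rightarrow> real" and \<psi> :: "'d \<Rightarrow> 's \<Rightarrow> real"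
  assumes "finite R"
  shows "2 * (\<Sum>e\<in>E. \<Sum>d\<in>D. (\<Sum>s\<in>R. \<phi> e s * \<psi> d s) ^ p) \<le>
    (\<Sum>e\<in>E. \<Sum>d\<in>E. (\<Sum>s\<in>R. \<phi> e s * \<phi> d s) ^ p) + (\<Sum>e\<in>D. \<Sum>d\<in>D. (\<Sum>s\<in>R. \<psi> e s * \<psi> d s) ^ p)"
proof -
  have *: "2 * (\<Sum>f\<in>F. x f * y f) \<le> (\<Sum>f\<in>F. x f * x f) + (\<Sum>f\<in>F. y f * y f)"
    for F :: "(nat \<Rightarrow> 's) set" and x y :: "(nat \<Rightarrow> 's) \<Rightarrow> real"
  proof -
    have "0 \<le> (\<Sum>f\<in>F. (x f - y f)\<^sup>2)" by (intro sum_nonneg) simp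
    then show ?thesis
      by (simp add: power2_eq_square algebra_simps sum.distrib sum_subtractf sum_distrib_left)
  qed
  show ?thesis unfolding gram_power_product[OF assms] by (rule *)
qed

section \<open>Sifting\<close>

lemma of_bool_prod_lessThan: "(\<Prod>i<(q::nat). of_bool (P i) :: real) = of_bool (\<forall>i<q. P i)"
  by (induction q) (auto simp: less_Suc_eq)

text \<open>Kelley and Meka's sifting: \<open>r e d ^ q\<close> counts the \<open>q\<close>-tuples \<open>f\<close> whose common
  neighbourhood \<open>D f\<close> contains both \<open>e\<close> and \<open>d\<close>, so the \<open>q\<close>-th moments of \<open>r\<close> become second
  moments of the sizes of these sets.\<close>

lemma sifting:
  fixes P :: "'e \<Rightarrow> 's \<Rightarrow> bool" and \<tau> K :: real
  defines "r \<equiv> \<lambda>e d R. real (card {s \<in> R. P e s \<and> P d s})"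
  assumes fin: "finite E" "finite R"
    and K: "\<And>e. e \<in> E \<Longrightarrow> real (card {s \<in> R. P e s}) = K"
    and W: "W = (\<Sum>e\<in>E. \<Sum>d\<in>E. r e d R ^ q)" "W > 0"
    and bad: "4000 * (\<Sum>e\<in>E. \<Sum>d\<in>E. of_bool (\<not> S e d) * r e d R ^ q) \<le> W"
    and small: "4 * (\<tau> * real (card E) ^ 2 * K ^ q) \<le> W" "\<tau> \<ge> 0"
  shows "\<exists>D\<subseteq>E. real (card D) \<ge> \<tau> * real (card E) \<and>
    1000 * real (card {(e, d) \<in> D \<times> D. \<not> S e d}) \<le> real (card D) ^ 2"
proof (rule ccontr)
  assume neg: "\<not> ?thesis"
  define D where "D f = {e \<in> E. \<forall>i<q. P e (f i)}" for f
  define F where "F = {..<q} \<rightarrow>\<^sub>E R"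
  have finF: "finite F" unfolding F_def using fin by (intro finite_PiE) auto
  have finD: "finite (D f)" for f unfolding D_def using fin by auto
  have r: "r e d R = (\<Sum>s\<in>R. of_bool (P e s) * of_bool (P d s))" for e d
    unfolding r_def using fin by (simp add: of_bool_conj[symmetric] sum_of_bool_eq Int_def)
  have wsum: "(\<Sum>e\<in>E. \<Sum>d\<in>E. w e d * r e d R ^ q) = (\<Sum>f\<in>F. \<Sum>e\<in>D f. \<Sum>d\<in>D f. w e d)"
    for w :: "'e \<Rightarrow> 'e \<Rightarrow> real"
    unfolding r gram_power[OF fin(2)] F_def[symmetric]
  proof (rule sum.cong[OF refl])
    fix f
    have "(\<Sum>e\<in>E. \<Sum>d\<in>E. w e d * ((\<Prod>i<q. of_bool (P e (f i))) * (\<Prod>i<q. of_bool (P d (f i))))) =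
      (\<Sum>e\<in>E. of_bool (e \<in> D f) * (\<Sum>d\<in>E. of_bool (d \<in> D f) * w e d))"
      unfolding of_bool_prod_lessThan sum_distrib_left
      by (intro sum.cong refl) (auto simp: D_def)
    also have "\<dots> = (\<Sum>e\<in>D f. \<Sum>d\<in>D f. w e d)"
      using fin by (simp add: sum.inter_filter[symmetric] D_def Int_def of_bool_def
         if_distrib[of "\<lambda>x. x * _"] cong: if_cong)
    finally show "(\<Sum>e\<in>E. \<Sum>d\<in>E. w e d * ((\<Prod>i<q. of_bool (P e (f i))) * (\<Prod>i<q. of_bool (P d (f i))))) =
      (\<Sum>e\<in>D f. \<Sum>d\<in>D f. w e d)" .
  qed
  have W2: "W = (\<Sum>f\<in>F. real (card (D f)) ^ 2)"
    using wsum[of "\<lambda>_ _. 1"] W(1) by (simp add: power2_eq_square)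
  have B: "(\<Sum>e\<in>E. \<Sum>d\<in>E. of_bool (\<not> S e d) * r e d R ^ q) = (\<Sum>f\<in>F. real (card {(e, d) \<in> D f \<times> D f. \<not> S e d}))"
    unfolding wsum
  proof (intro sum.cong refl)
    fix f
    have "(\<Sum>e\<in>D f. \<Sum>d\<in>D f. of_bool (\<not> S e d) :: real) = (\<Sum>(e,d)\<in>D f \<times> D f. of_bool (\<not> S e d))"
      by (rule sum.cartesian_product)
    also have "\<dots> = real (card {(e, d) \<in> D f \<times> D f. \<not> S e d})"
      using finD[of f] by (simp add: sum_of_bool_eq Int_def case_prod_unfold mem_Times_iff)
    finally show "(\<Sum>e\<in>D f. \<Sum>d\<in>D f. of_bool (\<not> S e d)) = real (card {(e, d) \<in> D f \<times> D f. \<not> S e d})" .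
  qed
  \<comment> \<open>Each \<open>e\<close> lies in exactly \<open>K ^ q\<close> of the sets
    \<open>D f\<close>, since every entry of \<open>f\<close> must be one of its \<open>K\<close>
    neighbours.\<close>
  have sumD: "(\<Sum>f\<in>F. real (card (D f))) = real (card E) * K ^ q"
  proof -
    have "(\<Sum>f\<in>F. real (card (D f))) = (\<Sum>f\<in>F. \<Sum>e\<in>E. \<Prod>i<q. of_bool (P e (f i)))"
      unfolding of_bool_prod_lessThan using fin by (simp add: D_def sum_of_bool_eq Int_def)
    also have "\<dots> = (\<Sum>e\<in>E. \<Sum>f\<in>F. \<Prod>i<q. of_bool (P e (f i)))" by (rule sum.swap)
    also have "\<dots> = (\<Sum>e\<in>E. (\<Sum>s\<in>R. of_bool (P e s)) ^ q)"
      unfolding F_def by (simp add: sum_power_PiE[OF fin(2)])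
    also have "\<dots> = (\<Sum>e\<in>E. K ^ q)"
      using fin K by (intro sum.cong refl) (simp add: sum_of_bool_eq Int_def)
    finally show ?thesis by simp
  qed
  \<comment> \<open>By the negated claim every \<open>D f\<close> is either small or rich in bad
    pairs, and the two terms bound its squared size in these two cases. By \<open>small\<close> and
    \<open>bad\<close> each term sums to at most \<open>W / 4\<close>.\<close>
  have "W \<le> (\<Sum>f\<in>F. \<tau> * real (card E) * real (card (D f)) + 1000 * real (card {(e, d) \<in> D f \<times> D f. \<not> S e d}))"
    unfolding W2
  proof (rule sum_mono)
    fix f
    have "D f \<subseteq> E" by (auto simp: D_def)
    then have "real (card (D f)) < \<tau> * real (card E) \<or>
       real (card (D f)) ^ 2 < 1000 * real (card {(e, d) \<in> D f \<times> D f. \<not> S e d})"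
      using neg by (meson not_le)
    then show "real (card (D f)) ^ 2 \<le> \<tau> * real (card E) * real (card (D f)) + 1000 * real (card {(e, d) \<in> D f \<times> D f. \<not> S e d})"
    proof
      assume "real (card (D f)) < \<tau> * real (card E)"
      then have "real (card (D f)) * real (card (D f)) \<le> \<tau> * real (card E) * real (card (D f))"
        by (intro mult_right_mono) auto
      then show ?thesis by (simp add: power2_eq_square)
    next
      assume "real (card (D f)) ^ 2 < 1000 * real (card {(e, d) \<in> D f \<times> D f. \<not> S e d})"
      moreover have "0 \<le> \<tau> * real (card E) * real (card (D f))" using small by simp
      ultimately show ?thesis by linarith
    qed
  qed
  also have "\<dots> = \<tau> * real (card E) * (real (card E) * K ^ q) + 1000 * (\<Sum>e\<in>E. \<Sum>d\<in>E. of_bool (\<not> S e d) * r e d R ^ q)"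
    unfolding B sumD[symmetric] by (simp add: sum.distrib sum_distrib_left)
  also have "\<dots> \<le> W / 4 + W / 4"
    using bad small by (simp add: power2_eq_square algebra_simps)
  finally show False using W(2) by simp
qed

section \<open>Almost periodicity\<close>

lemma exp_le_quadratic: "exp x \<le> 1 + x + x\<^sup>2" if "\<bar>x\<bar> \<le> 1" for x :: real
proof (cases "0 \<le> x")
  case True
  then show ?thesis using that exp_bound[of x] by simp
next
  case False
  define u where "u = - x"
  have u: "0 < u" "u \<le> 1" using False that by (auto simp: u_def)
  have "1 + u + u\<^sup>2 / 2 \<le> exp u" using exp_lower_Taylor_quadratic[of u] u by simp
  have "1 \<le> (1 - u + u\<^sup>2) * (1 + u + u\<^sup>2 / 2)"
  proof -
    have "(1 - u + u\<^sup>2) * (1 + u + u\<^sup>2 / 2) = 1 + u^2/2 + u^3/2 + u^4/2"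
      by (simp add: field_simps power2_eq_square power3_eq_cube power4_eq_xxxx)
    then show ?thesis using u by simp
  qed
  also have "\<dots> \<le> (1 - u + u\<^sup>2) * exp u"
    using \<open>1 + u + u\<^sup>2 / 2 \<le> exp u\<close> u by (intro mult_left_mono) (auto intro: add_nonneg_nonneg)
  finally have "exp (-u) \<le> 1 - u + u\<^sup>2"
    by (simp add: exp_minus field_simps)
  then show ?thesis by (simp add: u_def)
qed

lemma hoeffding_count_upper:
  fixes y :: "'b \<Rightarrow> real" and \<epsilon> :: real
  assumes D: "finite D" and y: "\<And>b. b \<in> D \<Longrightarrow> \<bar>y b\<bar> \<le> 1" "(\<Sum>b\<in>D. y b) = 0"
    and \<epsilon>: "0 < \<epsilon>" "\<epsilon> \<le> 1"
  shows "real (card {f \<in> {..<m} \<rightarrow>\<^sub>E D. (\<Sum>i<m. y (f i)) > real m * \<epsilon>}) \<le>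
     exp (- (real m * \<epsilon>\<^sup>2 / 4)) * real (card D) ^ m"
proof -
  define F where "F = {..<m} \<rightarrow>\<^sub>E D"
  define B where "B = {f \<in> F. (\<Sum>i<m. y (f i)) > real m * \<epsilon>}"
  \<comment> \<open>This value minimises the exponent \<open>m * l^2 - l * m * \<epsilon>\<close> of
    the exponential moment bound.\<close>
  define l where "l = \<epsilon> / 2"
  have l: "0 < l" "l \<le> 1" using \<epsilon> by (auto simp: l_def)
  have finF: "finite F" unfolding F_def using D by (intro finite_PiE) auto
  then have finB: "finite B" unfolding B_def by auto
  have "real (card B) * exp (l * (real m * \<epsilon>)) = (\<Sum>f\<in>B. exp (l * (real m * \<epsilon>)))" by simp
  also have "\<dots> \<le> (\<Sum>f\<in>B. exp (l * (\<Sum>i<m. y (f i))))"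
    using l by (intro sum_mono) (auto simp: B_def)
  also have "\<dots> \<le> (\<Sum>f\<in>F. exp (l * (\<Sum>i<m. y (f i))))"
    using finF by (intro sum_mono2) (auto simp: B_def)
  also have "\<dots> = (\<Sum>f\<in>F. \<Prod>i<m. exp (l * y (f i)))"
    by (simp add: exp_sum sum_distrib_left)
  also have "\<dots> = (\<Sum>b\<in>D. exp (l * y b)) ^ m" unfolding F_def sum_power_PiE[OF D] by simp
  also have "\<dots> \<le> (exp (l\<^sup>2) * real (card D)) ^ m"
  proof (rule power_mono)
    have "(\<Sum>b\<in>D. exp (l * y b)) \<le> (\<Sum>b\<in>D. 1 + l\<^sup>2 + l * y b)"
    proof (rule sum_mono)
      fix b assume b: "b \<in> D"
      have "\<bar>l * y b\<bar> \<le> 1" using y(1)[OF b] l by (simp add: abs_mult mult_le_one)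
      then have "exp (l * y b) \<le> 1 + l * y b + (l * y b)\<^sup>2" by (rule exp_le_quadratic)
      moreover have "(l * y b)\<^sup>2 \<le> l\<^sup>2"
        using y(1)[OF b] l by (simp add: power_mult_distrib abs_square_le_1 mult_left_le)
      ultimately show "exp (l * y b) \<le> 1 + l\<^sup>2 + l * y b" by linarith
    qed
    also have "\<dots> = (1 + l\<^sup>2) * real (card D)"
      using y(2) by (simp add: sum.distrib sum_distrib_left[symmetric] algebra_simps)
    also have "\<dots> \<le> exp (l\<^sup>2) * real (card D)"
      by (intro mult_right_mono) auto
    finally show "(\<Sum>b\<in>D. exp (l * y b)) \<le> exp (l\<^sup>2) * real (card D)" .
  qed (auto intro: sum_nonneg)
  also have "\<dots> = exp (real m * l\<^sup>2) * real (card D) ^ m"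
    by (simp add: power_mult_distrib exp_of_nat_mult)
  finally have "real (card B) \<le> exp (real m * l\<^sup>2) * real (card D) ^ m / exp (l * (real m * \<epsilon>))"
    by (simp add: field_simps)
  also have "\<dots> = exp (real m * l\<^sup>2 - l * (real m * \<epsilon>)) * real (card D) ^ m"
    by (simp add: exp_diff)
  also have "real m * l\<^sup>2 - l * (real m * \<epsilon>) = - (real m * \<epsilon>\<^sup>2 / 4)"
    by (simp add: l_def power2_eq_square field_simps)
  finally show ?thesis unfolding B_def F_def .
qed

lemma hoeffding_count:
  fixes y :: "'b \<Rightarrow> real" and \<epsilon> :: real
  assumes D: "finite D" and y: "\<And>b. b \<in> D \<Longrightarrow> \<bar>y b\<bar> \<le> 1" "(\<Sum>b\<in>D. y b) = 0"
    and \<epsilon>: "0 < \<epsilon>" "\<epsilon> \<le> 1"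
  shows "real (card {f \<in> {..<m} \<rightarrow>\<^sub>E D. \<bar>\<Sum>i<m. y (f i)\<bar> > real m * \<epsilon>}) \<le>
     2 * exp (- (real m * \<epsilon>\<^sup>2 / 4)) * real (card D) ^ m"
proof -
  define F where "F = {..<m} \<rightarrow>\<^sub>E D"
  have finF: "finite F" unfolding F_def using D by (intro finite_PiE) auto
  have "{f \<in> F. \<bar>\<Sum>i<m. y (f i)\<bar> > real m * \<epsilon>} \<subseteq>
    {f \<in> F. (\<Sum>i<m. y (f i)) > real m * \<epsilon>} \<union> {f \<in> F. (\<Sum>i<m. - y (f i)) > real m * \<epsilon>}"
    by (auto simp: sum_negf)
  then have "card {f \<in> F. \<bar>\<Sum>i<m. y (f i)\<bar> > real m * \<epsilon>} \<le>
    card {f \<in> F. (\<Sum>i<m. y (f i)) > real m * \<epsilon>} + card {f \<in> F. (\<Sum>i<m. - y (f i)) > real m * \<epsilon>}"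
    using finF by (intro order_trans[OF card_mono card_Un_le]) auto
  moreover have "real (card {f \<in> F. (\<Sum>i<m. y (f i)) > real m * \<epsilon>}) \<le> exp (- (real m * \<epsilon>\<^sup>2 / 4)) * real (card D) ^ m"
    unfolding F_def by (rule hoeffding_count_upper[OF assms])
  moreover have "real (card {f \<in> F. (\<Sum>i<m. - y (f i)) > real m * \<epsilon>}) \<le> exp (- (real m * \<epsilon>\<^sup>2 / 4)) * real (card D) ^ m"
    unfolding F_def by (rule hoeffding_count_upper) (use assms in \<open>auto simp: sum_negf\<close>)
  ultimately show ?thesis unfolding F_def by linarith
qed

section \<open>Almost periods in the manner of Croot and Sisask\<close>

lemma exists_ge_average:
  fixes h :: "'b \<Rightarrow> real"
  assumes "finite V" "V \<noteq> {}" "c \<le> (\<Sum>v\<in>V. h v)"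
  shows "\<exists>v\<in>V. c / real (card V) \<le> h v"
proof (rule ccontr)
  assume "\<not> ?thesis"
  then have "(\<Sum>v\<in>V. h v) < (\<Sum>v\<in>V. c / real (card V))"
    using assms by (intro sum_strict_mono) auto
  then show False using assms by simp
qed

text \<open>The convolution of the indicator function of \<open>S\<close> with the uniform measure
  on \<open>D\<close>.\<close>

definition density_of :: "'a::ab_group_add set \<Rightarrow> 'a set \<Rightarrow> 'a \<Rightarrow> real" where
  "density_of D S x = real (card {b \<in> D. x - b \<in> S}) / real (card D)"

lemma density_of_bounds: "finite D \<Longrightarrow> 0 \<le> density_of D S x \<and> density_of D S x \<le> 1"
  unfolding density_of_def by (auto intro!: divide_le_eq_1[THEN iffD2] card_mono simp: card_gt_0_iff)

text \<open>Sampling and pigeonhole. For most \<open>m\<close>-tuples \<open>b\<close> in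
  \<open>D\<close> the empirical average of the indicator of \<open>S\<close> over \<open>b\<close>
  is close to \<open>density_of D S\<close> at most points of \<open>Y\<close>. A good
  \<open>b\<close> shifted by \<open>- t\<close> is a tuple \<open>v\<close> in \<open>W\<close>,
  and there are only \<open>card W ^ m\<close> of those, so one \<open>v\<close> serves many
  \<open>t\<close>. Its empirical average \<open>g\<close>, shifted by any \<open>t\<close> in
  \<open>X\<close>, approximates the same function; hence differences of elements of
  \<open>X\<close> are almost periods.\<close>

lemma croot_sisask:
  fixes D T Y W S :: "'a::ab_group_add set" and \<epsilon> :: real
  assumes D: "finite D" "D \<noteq> {}" and T: "finite T" "T \<noteq> {}" and Y: "finite Y"
    and W: "finite W" "\<And>b t. b \<in> D \<Longrightarrow> t \<in> T \<Longrightarrow> b - t \<in> W"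
    and \<epsilon>: "0 < \<epsilon>" "\<epsilon> \<le> 1" and m: "m > 0"
  shows "\<exists>X g. X \<subseteq> T \<and> real (card X) \<ge> (real (card D) / real (card W)) ^ m * real (card T) / 2 \<and>
    (\<forall>t\<in>X. real (card {x \<in> Y. \<bar>density_of D S x - g (x - t)\<bar> > \<epsilon>}) \<le>
       4 * exp (- (real m * \<epsilon>\<^sup>2 / 4)) * real (card Y))"
proof -
  define f where "f = density_of D S"
  define F where "F = {..<m} \<rightarrow>\<^sub>E D"
  define E where "E = exp (- (real m * \<epsilon>\<^sup>2 / 4))"
  have finF: "finite F" unfolding F_def using D by (intro finite_PiE) auto
  have cF: "card F = card D ^ m" unfolding F_def by (simp add: card_PiE)
  define y where "y x b = of_bool (x - b \<in> S) - f x" for x b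
  define bad where "bad b = {x \<in> Y. \<bar>\<Sum>i<m. y x (b i)\<bar> > real m * \<epsilon>}" for b :: "nat \<Rightarrow> 'a"
  have finbad: "finite (bad b)" for b using Y by (auto simp: bad_def)
  have "(\<Sum>b\<in>F. real (card (bad b))) = (\<Sum>b\<in>F. \<Sum>x\<in>Y. of_bool (\<bar>\<Sum>i<m. y x (b i)\<bar> > real m * \<epsilon>))"
    unfolding bad_def using Y by (simp add: sum_of_bool_eq Int_def)
  also have "\<dots> = (\<Sum>x\<in>Y. \<Sum>b\<in>F. of_bool (\<bar>\<Sum>i<m. y x (b i)\<bar> > real m * \<epsilon>))"
    by (rule sum.swap)
  also have "\<dots> = (\<Sum>x\<in>Y. real (card {b \<in> F. \<bar>\<Sum>i<m. y x (b i)\<bar> > real m * \<epsilon>}))"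
    using finF by (simp add: sum_of_bool_eq Int_def)
  also have "\<dots> \<le> (\<Sum>x\<in>Y. 2 * E * real (card D) ^ m)"
    unfolding F_def E_def
  proof (intro sum_mono hoeffding_count)
    fix x
    have fx: "0 \<le> f x" "f x \<le> 1" using density_of_bounds[OF D(1), of S x] by (auto simp: f_def)
    show "\<bar>y x b\<bar> \<le> 1" for b using fx by (auto simp: y_def of_bool_def)
    show "(\<Sum>b\<in>D. y x b) = 0"
      using D by (simp add: y_def sum_subtractf f_def density_of_def sum_of_bool_eq Int_def)
  qed (use D \<epsilon> in auto)
  finally have sumbad: "(\<Sum>b\<in>F. real (card (bad b))) \<le> 2 * E * real (card Y) * real (card F)"
    by (simp add: cF algebra_simps)
  \<comment> \<open>The threshold is twice the bound \<open>sumbad\<close> for the mean, so by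
    Markov's inequality at least half of the tuples are good.\<close>
  define G where "G = {b \<in> F. real (card (bad b)) \<le> 4 * E * real (card Y)}"
  have finG: "finite G" using finF by (auto simp: G_def)
  have cG: "real (card F) \<le> 2 * real (card G)"
  proof (cases "Y = {}")
    case True
    then have "G = F" by (auto simp: G_def bad_def)
    then show ?thesis by simp
  next
    case False
    define z where "z = 4 * E * real (card Y)"
    have z: "z > 0" using False Y by (simp add: z_def E_def card_gt_0_iff)
    have "z * real (card (F - G)) = (\<Sum>b\<in>F - G. z)" by simp
    also have "\<dots> \<le> (\<Sum>b\<in>F - G. real (card (bad b)))"
      by (intro sum_mono) (auto simp: G_def z_def)
    also have "\<dots> \<le> (\<Sum>b\<in>F. real (card (bad b)))"
      using finF by (intro sum_mono2) auto
    also have "\<dots> \<le> z * (real (card F) / 2)" using sumbad by (simp add: z_def field_simps)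
    finally have "real (card (F - G)) \<le> real (card F) / 2" using z by simp
    moreover have "real (card (F - G)) = real (card F) - real (card G)"
      using finF finG by (subst card_Diff_subset) (auto simp: G_def intro!: of_nat_diff card_mono)
    ultimately show ?thesis by simp
  qed
  define V where "V = {..<m} \<rightarrow>\<^sub>E W"
  have finV: "finite V" unfolding V_def using W by (intro finite_PiE) auto
  have cV: "card V = card W ^ m" unfolding V_def by (simp add: card_PiE)
  define sh where "sh v t = (\<lambda>i\<in>{..<m}. v i + t)" for v :: "nat \<Rightarrow> 'a" and t
  have "W \<noteq> {}" using D T W by auto
  then have "V \<noteq> {}" by (auto simp: V_def PiE_eq_empty_iff)
  \<comment> \<open>Pairs of a good tuple \<open>b\<close> and a shift \<open>t\<close> are sorted
    by the tuple \<open>v = b - t\<close>, from which \<open>t\<close> recovers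
    \<open>b\<close>.\<close>
  have "card (G \<times> T) \<le> card (SIGMA v:V. {t \<in> T. sh v t \<in> G})"
  proof (rule card_inj_on_le)
    let ?h = "\<lambda>(b, t). (sh b (- t), t)"
    have *: "sh (sh b (- t)) t = b" if "b \<in> G" for b t
      using that by (auto simp: sh_def G_def F_def fun_eq_iff PiE_def extensional_def)
    show "inj_on ?h (G \<times> T)"
    proof (rule inj_onI, clarsimp)
      fix a b t assume "a \<in> G" "b \<in> G" "sh a (- t) = sh b (- t)"
      then show "a = b" using *[of a t] *[of b t] by metis
    qed
    show "?h ` (G \<times> T) \<subseteq> (SIGMA v:V. {t \<in> T. sh v t \<in> G})"
    proof clarsimp
      fix b t assume "b \<in> G" "t \<in> T"
      show "sh b (- t) \<in> V \<and> sh (sh b (- t)) t \<in> G"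
        unfolding *[OF \<open>b \<in> G\<close>]
      proof
        have "b i \<in> D" if "i < m" for i using \<open>b \<in> G\<close> that by (auto simp: G_def F_def)
        then show "sh b (- t) \<in> V" using W(2) \<open>t \<in> T\<close> by (auto simp: V_def sh_def)
      qed fact
    qed
    show "finite (SIGMA v:V. {t \<in> T. sh v t \<in> G})" using finV T by auto
  qed
  also have "\<dots> = (\<Sum>v\<in>V. card {t \<in> T. sh v t \<in> G})" using finV T by simp
  finally have "real (card G * card T) \<le> real (\<Sum>v\<in>V. card {t \<in> T. sh v t \<in> G})"
    unfolding card_cartesian_product by (simp only: of_nat_le_iff)
  then have "real (card G) * real (card T) \<le> (\<Sum>v\<in>V. real (card {t \<in> T. sh v t \<in> G}))"
    by simp
  from exists_ge_average[OF finV \<open>V \<noteq> {}\<close> this]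
  obtain v where v: "v \<in> V" "real (card G) * real (card T) / real (card V) \<le> real (card {t \<in> T. sh v t \<in> G})"
    by blast
  define X where "X = {t \<in> T. sh v t \<in> G}"
  define g where "g x = (\<Sum>i<m. of_bool (x - v i \<in> S)) / real m" for x
  have "(real (card D) / real (card W)) ^ m * real (card T) / 2 = real (card F) * real (card T) / (2 * real (card V))"
    by (simp add: cF cV power_divide)
  also have "\<dots> \<le> 2 * real (card G) * real (card T) / (2 * real (card V))"
    using cG by (intro divide_right_mono mult_right_mono) auto
  also have "\<dots> \<le> real (card X)" using v by (simp add: X_def)
  finally have 1: "(real (card D) / real (card W)) ^ m * real (card T) / 2 \<le> real (card X)" .
  have 2: "real (card {x \<in> Y. \<bar>f x - g (x - t)\<bar> > \<epsilon>}) \<le> 4 * E * real (card Y)" if t: "t \<in> X" for t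
  proof -
    have "\<bar>f x - g (x - t)\<bar> > \<epsilon> \<longleftrightarrow> \<bar>\<Sum>i<m. y x (sh v t i)\<bar> > real m * \<epsilon>" for x
    proof -
      have "(\<Sum>i<m. y x (sh v t i)) = (\<Sum>i<m. of_bool (x - t - v i \<in> S)) - real m * f x"
        by (simp add: y_def sh_def sum_subtractf diff_diff_add add.commute)
      also have "\<dots> = real m * (g (x - t) - f x)" using m by (simp add: g_def field_simps)
      finally have "\<bar>\<Sum>i<m. y x (sh v t i)\<bar> = real m * \<bar>f x - g (x - t)\<bar>"
        by (simp add: abs_mult abs_minus_commute)
      then show ?thesis using m by simp
    qed
    then have "{x \<in> Y. \<bar>f x - g (x - t)\<bar> > \<epsilon>} = bad (sh v t)" by (auto simp: bad_def)
    then show ?thesis using t by (simp add: X_def G_def)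
  qed
  show ?thesis
    using 1 2 unfolding f_def E_def
    by (intro exI[of _ X] exI[of _ g]) (auto simp: X_def)
qed

text \<open>A chain of \<open>k\<close> moves, each passing through \<open>g\<close>: with
  \<open>u\<close> the partial sums, the value at \<open>a + u j\<close> is close to
  \<open>g (a + u j - t' j)\<close>, which equals \<open>g (a + u (Suc j) - t j)\<close>, which is
  close to the value at \<open>a + u (Suc j)\<close>. A move loses \<open>2 * \<epsilon>\<close>
  outside two exceptional sets, each injected by a translation into a set of at most
  \<open>\<beta>\<close> bad points of \<open>Y\<close>.\<close>

lemma almost_period_sum:
  fixes D Y S X :: "'a::ab_group_add set" and \<epsilon> \<beta> :: real
  assumes D: "finite D" and Y: "finite Y" and \<epsilon>: "\<epsilon> \<ge> 0"
    and X: "\<And>t. t \<in> X \<Longrightarrow> real (card {x \<in> Y. \<bar>density_of D S x - g (x - t)\<bar> > \<epsilon>}) \<le> \<beta>"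
    and t: "\<And>i. i < k \<Longrightarrow> t i \<in> X \<and> t' i \<in> X"
    and inY: "\<And>a j. a \<in> D \<Longrightarrow> j \<le> k \<Longrightarrow> a + (\<Sum>i<j. t i - t' i) \<in> Y"
  shows "(\<Sum>a\<in>D. density_of D S (a + (\<Sum>i<k. t i - t' i))) \<ge>
    (\<Sum>a\<in>D. density_of D S a) - 2 * real k * \<epsilon> * real (card D) - 2 * real k * \<beta>"
proof -
  define f where "f = density_of D S"
  define u where "u j = (\<Sum>i<j. t i - t' i)" for j
  define bad where "bad s = {x \<in> Y. \<bar>f x - g (x - s)\<bar> > \<epsilon>}" for s
  have finbad: "finite (bad s)" for s using Y by (auto simp: bad_def)
  have sbad: "real (card {a \<in> D. a + z \<in> bad s}) \<le> \<beta>" if "s \<in> X" for s z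
  proof -
    have "card {a \<in> D. a + z \<in> bad s} \<le> card (bad s)"
      by (rule card_inj_on_le[of "\<lambda>a. a + z"]) (auto intro: inj_onI finbad)
    then show ?thesis using X[OF that] unfolding bad_def f_def by linarith
  qed
  have "real (card {a \<in> D. f (a + u j) < f a - 2 * real j * \<epsilon>}) \<le> 2 * real j * \<beta>" if "j \<le> k" for j
    using that
  proof (induction j)
    case 0
    then show ?case by (simp add: u_def)
  next
    case (Suc j)
    let ?B = "\<lambda>j. {a \<in> D. f (a + u j) < f a - 2 * real j * \<epsilon>}"
    let ?B1 = "{a \<in> D. a + u j \<in> bad (t' j)}" and ?B2 = "{a \<in> D. a + u (Suc j) \<in> bad (t j)}"
    have "?B (Suc j) \<subseteq> ?B j \<union> (?B1 \<union> ?B2)"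
    proof
      fix a assume a: "a \<in> ?B (Suc j)"
      have eq: "a + u (Suc j) - t j = a + u j - t' j" by (simp add: u_def algebra_simps)
      show "a \<in> ?B j \<union> (?B1 \<union> ?B2)"
      proof (rule ccontr)
        assume "a \<notin> ?B j \<union> (?B1 \<union> ?B2)"
        then have "\<bar>f (a + u j) - g (a + u j - t' j)\<bar> \<le> \<epsilon>" "\<bar>f (a + u (Suc j)) - g (a + u j - t' j)\<bar> \<le> \<epsilon>"
          "f (a + u j) \<ge> f a - 2 * real j * \<epsilon>"
          using a inY[of a j] inY[of a "Suc j"] Suc.prems eq unfolding bad_def u_def[symmetric] by auto
        then have "f (a + u (Suc j)) \<ge> f a - 2 * real j * \<epsilon> - 2 * \<epsilon>" by linarith
        then show False using a by (auto simp: algebra_simps)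
      qed
    qed
    then have "card (?B (Suc j)) \<le> card (?B j) + (card ?B1 + card ?B2)"
      using D by (intro order_trans[OF card_mono order_trans[OF card_Un_le add_left_mono[OF card_Un_le]]]) auto
    moreover have "real (card ?B1) \<le> \<beta>" "real (card ?B2) \<le> \<beta>"
      using sbad t[of j] Suc.prems by auto
    ultimately show ?case using Suc by (auto simp: algebra_simps)
  qed
  from this[of k] have b: "real (card {a \<in> D. f (a + u k) < f a - 2 * real k * \<epsilon>}) \<le> 2 * real k * \<beta>" by simp
  have "(\<Sum>a\<in>D. f a) - 2 * real k * \<epsilon> * real (card D) - (\<Sum>a\<in>D. f (a + u k)) =
     (\<Sum>a\<in>D. f a - 2 * real k * \<epsilon> - f (a + u k))"
    by (simp add: sum_subtractf)
  \<comment> \<open>Off the exceptional set the summand is at most 0, and on it at most 1 because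
    densities lie between 0 and 1.\<close>
  also have "\<dots> \<le> (\<Sum>a\<in>D. of_bool (f (a + u k) < f a - 2 * real k * \<epsilon>))"
  proof (rule sum_mono)
    fix a
    have "0 \<le> f (a + u k)" "f a \<le> 1" "0 \<le> 2 * real k * \<epsilon>"
      using density_of_bounds[OF D, of S] \<epsilon> by (auto simp: f_def)
    then show "f a - 2 * real k * \<epsilon> - f (a + u k) \<le> of_bool (f (a + u k) < f a - 2 * real k * \<epsilon>)"
      by (auto simp: of_bool_def algebra_simps)
  qed
  also have "\<dots> = real (card {a \<in> D. f (a + u k) < f a - 2 * real k * \<epsilon>})"
    using D by (simp add: sum_of_bool_eq Int_def)
  finally show ?thesis using b unfolding f_def u_def by linarith
qed

section \<open>Fourier coefficients and Chang's theorem\<close>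

text \<open>The angle is an arbitrary real, so all characters of the integers are covered. A modulus
  enters only through the inversion formula, where it can be taken as large as desired.\<close>

definition ft :: "int set \<Rightarrow> real \<Rightarrow> complex" where
  "ft A \<theta> = (\<Sum>a\<in>A. cis (\<theta> * real_of_int a))"

definition diff_count :: "int set \<Rightarrow> int \<Rightarrow> nat" where
  "diff_count A n = card {a \<in> A. a + n \<in> A}"

lemma norm_ft_le: "norm (ft A \<theta>) \<le> real (card A)"
  unfolding ft_def by (rule order_trans[OF norm_sum]) simp

lemma ft_uminus: "ft A (- \<theta>) = cnj (ft A \<theta>)"
  unfolding ft_def by (simp add: cis_cnj)

lemma sum_cis_roots:
  fixes n :: int
  assumes n: "\<bar>n\<bar> < int M"
  shows "(\<Sum>j<M. cis (2 * pi * real j / real M * of_int n)) = (if n = 0 then of_nat M else 0)"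
proof (cases "n = 0")
  case False
  have M: "M > 0" using n by auto
  define z where "z = cis (2 * pi * real_of_int n / real M)"
  have "(\<Sum>j<M. cis (2 * pi * real j / real M * of_int n)) = (\<Sum>j<M. z ^ j)"
    by (simp add: z_def DeMoivre mult.commute mult.left_commute)
  moreover have "(z - 1) * (\<Sum>j<M. z ^ j) = z ^ M - 1" by (simp add: power_diff_1_eq)
  moreover have "z ^ M = 1"
  proof -
    have "z ^ M = cis (2 * pi * real_of_int n)" using M by (simp add: z_def DeMoivre)
    then show ?thesis by simp
  qed
  moreover have "z \<noteq> 1"
  proof
    assume "z = 1"
    then have "cos (2 * pi * real_of_int n / real M) = 1"
      by (simp add: z_def complex_eq_iff)
    then obtain k :: int where "2 * pi * real_of_int n / real M = real_of_int k * 2 * pi"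
      using cos_one_2pi_int by auto
    then have "real_of_int n = real_of_int k * real M" using M by (simp add: field_simps)
    then have "real_of_int n = real_of_int (k * int M)" by simp
    then have "n = k * int M" by (simp only: of_int_eq_iff)
    then show False using n False by (auto simp: abs_mult)
  qed
  ultimately show ?thesis using False by simp
qed simp

text \<open>Fourier inversion over the \<open>M\<close>-th roots of unity: \<open>M\<close> exceeds
  every \<open>\<bar>n - a + b\<bar>\<close>, so congruence modulo \<open>M\<close> is equality and
  nothing wraps around.\<close>

lemma diff_count_fourier:
  assumes A: "finite A" and n: "\<And>a b. a \<in> A \<Longrightarrow> b \<in> A \<Longrightarrow> \<bar>n - a + b\<bar> < int M"
  shows "of_nat M * of_nat (diff_count A n) =
    (\<Sum>j<M. of_real (norm (ft A (2 * pi * real j / real M)) ^ 2) * cis (2 * pi * real j / real M * of_int n))"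
proof -
  have *: "of_real (norm (ft A \<theta>) ^ 2) * cis (\<theta> * of_int n) = (\<Sum>a\<in>A. \<Sum>b\<in>A. cis (\<theta> * of_int (n - a + b)))" for \<theta>
  proof -
    have "of_real (norm (ft A \<theta>) ^ 2) * cis (\<theta> * of_int n) = ft A (- \<theta>) * ft A \<theta> * cis (\<theta> * of_int n)"
      by (simp only: ft_uminus complex_norm_square mult.commute)
    also have "\<dots> = (\<Sum>a\<in>A. \<Sum>b\<in>A. cis (\<theta> * of_int (n - a + b)))"
      unfolding ft_def sum_product
      unfolding sum_distrib_right
      by (intro sum.cong refl) (simp add: cis_mult algebra_simps)
    finally show ?thesis .
  qed
  have "(\<Sum>j<M. of_real (norm (ft A (2 * pi * real j / real M)) ^ 2) * cis (2 * pi * real j / real M * of_int n))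
    = (\<Sum>a\<in>A. \<Sum>b\<in>A. \<Sum>j<M. cis (2 * pi * real j / real M * of_int (n - a + b)))"
    unfolding * by (subst sum.swap) (intro sum.cong refl sum.swap)
  also have "\<dots> = (\<Sum>a\<in>A. \<Sum>b\<in>A. of_nat M * of_bool (b + n = a))"
    using n by (intro sum.cong refl) (subst sum_cis_roots, auto)
  also have "\<dots> = (\<Sum>b\<in>A. \<Sum>a\<in>A. of_nat M * of_bool (b + n = a))" by (rule sum.swap)
  also have "\<dots> = (\<Sum>b\<in>A. of_nat M * of_bool (b + n \<in> A))"
    using A by (intro sum.cong refl) (auto simp: of_bool_def sum.delta' if_distrib cong: if_cong)
  also have "\<dots> = of_nat M * of_nat (diff_count A n)"
    using A by (simp add: sum_distrib_left[symmetric] diff_count_def sum_of_bool_eq Int_def)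
  finally show ?thesis by simp
qed

text \<open>The Fourier coefficients \<open>norm (ft A \<theta>) ^ 2\<close> of the autocorrelation
  are nonnegative and average to \<open>card A\<close>. A bound \<eta> for the multiplier that is
  uniform in the angle therefore costs only \<open>\<eta> * card A\<close>.\<close>

lemma diff_count_shift:
  fixes u :: "'i \<Rightarrow> int"
  assumes A: "finite A" and I: "finite I"
    and \<eta>: "\<And>\<theta>. norm (\<Sum>i\<in>I. cis (\<theta> * of_int (u i))) * norm (1 - cis (\<theta> * of_int z)) \<le> \<eta>"
  shows "(\<Sum>i\<in>I. real (diff_count A (u i + z))) \<ge> (\<Sum>i\<in>I. real (diff_count A (u i))) - \<eta> * real (card A)"
proof -
  \<comment> \<open>The point 0 is included so that inversion at 0 gives Parseval's identity
    \<open>F0\<close>.\<close>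
  define U where "U = insert 0 (u ` I \<union> (\<lambda>i. u i + z) ` I)"
  define V where "V = (\<lambda>(n, a, b). \<bar>n - a + b\<bar>) ` (U \<times> A \<times> A)"
  have "finite V" using A I by (auto simp: V_def U_def)
  define M where "M = nat (Max (insert 0 V)) + 1"
  have M0: "M > 0" by (simp add: M_def)
  have bound: "\<bar>n - a + b\<bar> < int M" if "n \<in> U" "a \<in> A" "b \<in> A" for n a b
  proof -
    have "\<bar>n - a + b\<bar> \<in> insert 0 V" unfolding V_def using that by force
    then have "\<bar>n - a + b\<bar> \<le> Max (insert 0 V)" using \<open>finite V\<close> by (intro Max_ge) auto
    then show ?thesis by (auto simp: M_def)
  qed
  let ?\<theta> = "\<lambda>j. 2 * pi * real j / real M"
  let ?n = "\<lambda>j. norm (ft A (?\<theta> j)) ^ 2"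
  define S where "S \<theta> = (\<Sum>i\<in>I. cis (\<theta> * of_int (u i)))" for \<theta>
  have F: "of_nat M * of_nat (diff_count A n) = (\<Sum>j<M. of_real (?n j) * cis (?\<theta> j * of_int n))" if "n \<in> U" for n
    by (rule diff_count_fourier[OF A]) (use bound that in auto)
  have F0: "(\<Sum>j<M. ?n j) = real M * real (card A)"
  proof -
    have "of_real (\<Sum>j<M. ?n j) = (of_nat M * of_nat (diff_count A 0) :: complex)"
      by (subst F) (auto simp: U_def)
    also have "\<dots> = of_real (real M * real (card A))" by (simp add: diff_count_def)
    finally show ?thesis by (simp only: of_real_eq_iff)
  qed
  have G: "of_nat M * (\<Sum>i\<in>I. of_nat (diff_count A (u i + y))) = (\<Sum>j<M. of_real (?n j) * (S (?\<theta> j) * cis (?\<theta> j * of_int y)))"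
    if "y \<in> {0, z}" for y
  proof -
    have "of_nat M * (\<Sum>i\<in>I. of_nat (diff_count A (u i + y))) = (\<Sum>i\<in>I. \<Sum>j<M. of_real (?n j) * cis (?\<theta> j * of_int (u i + y)))"
      unfolding sum_distrib_left by (intro sum.cong refl F) (use that in \<open>auto simp: U_def\<close>)
    also have "\<dots> = (\<Sum>j<M. \<Sum>i\<in>I. of_real (?n j) * cis (?\<theta> j * of_int (u i + y)))" by (rule sum.swap)
    also have "\<dots> = (\<Sum>j<M. of_real (?n j) * (S (?\<theta> j) * cis (?\<theta> j * of_int y)))"
    proof (rule sum.cong[OF refl])
      fix j
      have "cis (\<theta> * of_int (n + y)) = cis (\<theta> * of_int n) * cis (\<theta> * of_int y)" for \<theta> n
        by (simp add: cis_mult algebra_simps)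
      then show "(\<Sum>i\<in>I. of_real (?n j) * cis (?\<theta> j * of_int (u i + y))) = of_real (?n j) * (S (?\<theta> j) * cis (?\<theta> j * of_int y))"
        by (simp only: S_def sum_distrib_left sum_distrib_right mult.assoc)
    qed
    finally show ?thesis .
  qed
  define Q where "Q y = (\<Sum>i\<in>I. real (diff_count A (u i + y)))" for y
  have G': "complex_of_real (real M * Q y) = (\<Sum>j<M. of_real (?n j) * (S (?\<theta> j) * cis (?\<theta> j * of_int y)))"
    if "y \<in> {0, z}" for y
    using G[OF that] by (simp add: Q_def)
  have "complex_of_real (real M * (Q 0 - Q z)) = (\<Sum>j<M. of_real (?n j) * (S (?\<theta> j) * (1 - cis (?\<theta> j * of_int z))))"
    using G'[of 0] G'[of z] by (simp add: algebra_simps sum_subtractf)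
  then have "norm (complex_of_real (real M * (Q 0 - Q z))) \<le> (\<Sum>j<M. norm (of_real (?n j) * (S (?\<theta> j) * (1 - cis (?\<theta> j * of_int z)))))"
    by (simp only: norm_sum)
  also have "\<dots> \<le> (\<Sum>j<M. ?n j * \<eta>)"
  proof (rule sum_mono)
    fix j
    show "norm (of_real (?n j) * (S (?\<theta> j) * (1 - cis (?\<theta> j * of_int z)))) \<le> ?n j * \<eta>"
      using \<eta>[of "?\<theta> j"] unfolding norm_mult S_def norm_of_real by (intro mult_mono) auto
  qed
  also have "\<dots> = real M * (\<eta> * real (card A))"
    using F0 by (simp add: sum_distrib_right[symmetric])
  finally have "\<bar>real M * (Q 0 - Q z)\<bar> \<le> real M * (\<eta> * real (card A))" by (simp only: norm_of_real)
  then have "real M * (Q 0 - Q z) \<le> real M * (\<eta> * real (card A))" by linarith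
  then have "Q 0 - Q z \<le> \<eta> * real (card A)" using M0 by (simp add: mult_le_cancel_left_pos)
  then show ?thesis by (simp add: Q_def)
qed

section \<open>Chang's theorem relative to a set\<close>

lemma norm_one_minus_cis_add: "norm (1 - cis (a + b)) \<le> norm (1 - cis a) + norm (1 - cis b)"
proof -
  have "1 - cis (a + b) = (1 - cis a) + cis a * (1 - cis b)" by (simp add: cis_mult algebra_simps)
  then show ?thesis by (metis norm_triangle_ineq norm_mult norm_cis mult_1)
qed

lemma norm_one_minus_cis_uminus: "norm (1 - cis (- a)) = norm (1 - cis a)"
proof -
  have "1 - cis (- a) = cnj (1 - cis a)" by (simp add: cis_cnj)
  then show ?thesis by (simp only: complex_mod_cnj)
qed

lemma norm_one_minus_cis_mult_sign:
  assumes "s \<in> {-1, 0, 1 :: int}"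
  shows "norm (1 - cis (of_int s * a)) \<le> norm (1 - cis a)"
  using assms by (auto simp: norm_one_minus_cis_uminus)

lemma norm_one_minus_cis_sum:
  "norm (1 - cis (\<Sum>i\<in>I. a i)) \<le> (\<Sum>i\<in>I. norm (1 - cis (a i)))"
proof (induction I rule: infinite_finite_induct)
  case (insert x F)
  then show ?case using norm_one_minus_cis_add[of "a x" "sum a F"] by simp
qed auto

text \<open>Dissociativity relative to \<open>H\<close>: a nontrivial combination with coefficients
  -1, 0, 1 has to avoid the half-spectrum of \<open>H\<close>, instead of merely being
  nonzero.\<close>

definition dissociated :: "int set \<Rightarrow> real set \<Rightarrow> bool" where
  "dissociated H \<Lambda> \<longleftrightarrow> (\<forall>s \<in> \<Lambda> \<rightarrow>\<^sub>E {-1, 0, 1 :: int}. (\<exists>l\<in>\<Lambda>. s l \<noteq> 0) \<longrightarrow>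
     norm (ft H (\<Sum>l\<in>\<Lambda>. of_int (s l) * l)) \<le> real (card H) / 2)"

lemma cis_of_int_sum: "cis (\<phi> * of_int (\<Sum>i<m. h i)) = (\<Prod>i<(m::nat). cis (\<phi> * of_int (h i)))"
proof (induction m)
  case (Suc m)
  have "cis (\<phi> * of_int (\<Sum>i<Suc m. h i)) = cis (\<phi> * of_int (\<Sum>i<m. h i)) * cis (\<phi> * of_int (h m))"
    by (simp add: cis_mult algebra_simps)
  then show ?case by (simp only: Suc prod.lessThan_Suc)
qed simp

lemma sum_cis_translates:
  assumes "finite H"
  shows "(\<Sum>g\<in>G. \<Sum>h\<in>{..<m} \<rightarrow>\<^sub>E H. cis (\<phi> * of_int (g + (\<Sum>i<m. h i)))) = ft G \<phi> * ft H \<phi> ^ m"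
proof -
  have "ft H \<phi> ^ m = (\<Sum>h\<in>{..<m} \<rightarrow>\<^sub>E H. \<Prod>i<m. cis (\<phi> * of_int (h i)))"
    unfolding ft_def by (rule sum_power_PiE[OF assms])
  also have "\<dots> = (\<Sum>h\<in>{..<m} \<rightarrow>\<^sub>E H. cis (\<phi> * of_int (\<Sum>i<m. h i)))"
    by (simp only: cis_of_int_sum)
  finally show ?thesis
    unfolding ft_def[of G] by (simp add: sum_product cis_mult algebra_simps)
qed

text \<open>The Riesz-product proof of Chang's theorem, localised to \<open>G\<close>: convolving with \<open>m\<close>
  copies of the uniform measure on \<open>H\<close> damps every frequency at which \<open>H\<close> has a small
  Fourier coefficient by a factor \<open>2 ^ m\<close>, which beats the number of terms of the Riesz product.\<close>

lemma card_dissociated_spectrum: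
  fixes X G H :: "int set" and \<Lambda> :: "real set"
  assumes fin: "finite X" "finite G" "finite H" and ne: "X \<noteq> {}" "H \<noteq> {}"
    and G: "\<And>x h. x \<in> X \<Longrightarrow> h \<in> {..<m} \<rightarrow>\<^sub>E H \<Longrightarrow> x - (\<Sum>i<m. h i) \<in> G"
    and \<Lambda>: "finite \<Lambda>" "card \<Lambda> = m" "dissociated H \<Lambda>"
    and spec: "\<And>l. l \<in> \<Lambda> \<Longrightarrow> norm (ft X l) \<ge> real (card X) / 2"
  shows "real m / 16 \<le> ln (2 * real (card G) / real (card X))"
proof -
  \<comment> \<open>This phase makes the sum of \<open>y l\<close> over \<open>X\<close> equal to
    \<open>norm (ft X l)\<close>.\<close>
  define c where "c l = cnj (sgn (ft X l))" for l
  define y where "y l x = Re (c l * cis (l * of_int x))" for l x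
  have c1: "norm (c l) \<le> 1" for l by (simp add: c_def norm_sgn)
  have y1: "\<bar>y l x\<bar> \<le> 1" for l x
  proof -
    have "\<bar>y l x\<bar> \<le> norm (c l * cis (l * of_int x))" unfolding y_def by (rule abs_Re_le_cmod)
    then show ?thesis using c1[of l] by (simp add: norm_mult)
  qed
  have sumy: "(\<Sum>x\<in>X. y l x) = norm (ft X l)" for l
  proof -
    have "(\<Sum>x\<in>X. y l x) = Re (c l * ft X l)"
      unfolding y_def ft_def sum_distrib_left Re_sum ..
    also have "c l * ft X l = of_real (norm (ft X l))"
    proof (cases "ft X l = 0")
      case False
      then show ?thesis unfolding c_def sgn_div_norm
        by (simp add: scaleR_conv_of_real complex_norm_square[symmetric] power2_eq_square field_simps flip: of_real_mult of_real_power)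
    qed simp
    finally show ?thesis by simp
  qed
  \<comment> \<open>For \<open>\<bar>y\<bar> \<le> 1\<close> one has
    \<open>exp (y / 4) \<le> 1 + y / 4 + 1/16\<close>, so each factor is positive and the Riesz
    product dominates an exponential of the sum of the \<open>y l\<close>.\<close>
  define \<Psi> where "\<Psi> x = (\<Prod>l\<in>\<Lambda>. 17/16 + y l x / 4)" for x
  have \<Psi>0: "\<Psi> x \<ge> 0" for x unfolding \<Psi>_def
  proof (rule prod_nonneg)
    fix l show "0 \<le> 17/16 + y l x / 4" using y1[of l x] by linarith
  qed
  have \<Psi>exp: "exp ((\<Sum>l\<in>\<Lambda>. y l x) / 4) \<le> \<Psi> x" for x
  proof -
    have "exp ((\<Sum>l\<in>\<Lambda>. y l x) / 4) = (\<Prod>l\<in>\<Lambda>. exp (y l x / 4))"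
      using \<Lambda>(1) by (simp add: exp_sum sum_divide_distrib)
    also have "\<dots> \<le> \<Psi> x" unfolding \<Psi>_def
    proof (rule prod_mono)
      fix l
      have "exp (y l x / 4) \<le> 1 + y l x / 4 + (y l x / 4)\<^sup>2" using y1[of l x] by (intro exp_le_quadratic) auto
      also have "(y l x / 4)\<^sup>2 \<le> 1/16" using y1[of l x] by (simp add: power_divide abs_square_le_1)
      finally show "0 \<le> exp (y l x / 4) \<and> exp (y l x / 4) \<le> 17/16 + y l x / 4" by simp
    qed
    finally show ?thesis .
  qed
  define P where "P = \<Lambda> \<rightarrow>\<^sub>E {-1, 0, 1 :: int}"
  define w where "w l s = (if s = 0 then 17/16 else if s = 1 then c l / 8 else cnj (c l) / 8)" for l and s :: int
  define \<phi> where "\<phi> s = (\<Sum>l\<in>\<Lambda>. of_int (s l) * l)" for s :: "real \<Rightarrow> int"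
  have finP: "finite P" unfolding P_def using \<Lambda>(1) by (intro finite_PiE) auto
  have expand: "of_real (\<Psi> x) = (\<Sum>s\<in>P. (\<Prod>l\<in>\<Lambda>. w l (s l)) * cis (\<phi> s * of_int x))" for x
  proof -
    have "of_real (\<Psi> x) = (\<Prod>l\<in>\<Lambda>. \<Sum>s\<in>{-1, 0, 1}. w l s * cis (of_int s * l * of_int x))"
      unfolding \<Psi>_def of_real_prod
    proof (rule prod.cong[OF refl])
      fix l
      have y: "of_real (y l x) = (c l * cis (l * of_int x) + cnj (c l * cis (l * of_int x))) / 2"
        unfolding y_def by (simp add: complex_eq_iff)
      have "complex_of_real (17/16 + y l x / 4) = 17/16 + of_real (y l x) / 4" by simp
      also have "\<dots> = (\<Sum>s\<in>{-1, 0, 1}. w l s * cis (of_int s * l * of_int x))"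
        unfolding y by (simp add: w_def cis_cnj field_simps)
      finally show "complex_of_real (17/16 + y l x / 4) = (\<Sum>s\<in>{-1, 0, 1}. w l s * cis (of_int s * l * of_int x))" .
    qed
    also have "\<dots> = (\<Sum>s\<in>P. \<Prod>l\<in>\<Lambda>. w l (s l) * cis (of_int (s l) * l * of_int x))"
      unfolding P_def using \<Lambda>(1) by (intro prod_sum_PiE) auto
    also have "\<dots> = (\<Sum>s\<in>P. (\<Prod>l\<in>\<Lambda>. w l (s l)) * cis (\<phi> s * of_int x))"
    proof (rule sum.cong[OF refl])
      fix s
      have "(\<Prod>l\<in>L. cis (of_int (s l) * l * of_int x)) = cis ((\<Sum>l\<in>L. of_int (s l) * l) * of_int x)" if "finite L" for L :: "real set"
        using that by (induction L rule: finite_induct) (simp_all add: cis_mult algebra_simps)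
      then show "(\<Prod>l\<in>\<Lambda>. w l (s l) * cis (of_int (s l) * l * of_int x)) = (\<Prod>l\<in>\<Lambda>. w l (s l)) * cis (\<phi> s * of_int x)"
        using \<Lambda>(1) by (simp add: prod.distrib \<phi>_def)
    qed
    finally show ?thesis .
  qed
  define HH where "HH = {..<m} \<rightarrow>\<^sub>E H"
  have finHH: "finite HH" unfolding HH_def using fin by (intro finite_PiE) auto
  have cHH: "card HH = card H ^ m" by (simp add: HH_def card_PiE)
  \<comment> \<open>\<open>Tot\<close> is estimated in two ways. From above it is expanded into
    characters, of which only the zero vector escapes the damping; from below only the points of
    \<open>G\<close> that \<open>h\<close> carries into \<open>X\<close> are kept.\<close>
  define Tot where "Tot = (\<Sum>g\<in>G. \<Sum>h\<in>HH. \<Psi> (g + (\<Sum>i<m. h i)))"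
  have "complex_of_real Tot = (\<Sum>g\<in>G. \<Sum>h\<in>HH. \<Sum>s\<in>P. (\<Prod>l\<in>\<Lambda>. w l (s l)) * cis (\<phi> s * of_int (g + (\<Sum>i<m. h i))))"
    unfolding Tot_def of_real_sum expand ..
  also have "\<dots> = (\<Sum>g\<in>G. \<Sum>s\<in>P. \<Sum>h\<in>HH. (\<Prod>l\<in>\<Lambda>. w l (s l)) * cis (\<phi> s * of_int (g + (\<Sum>i<m. h i))))"
    by (intro sum.cong refl sum.swap)
  also have "\<dots> = (\<Sum>s\<in>P. \<Sum>g\<in>G. \<Sum>h\<in>HH. (\<Prod>l\<in>\<Lambda>. w l (s l)) * cis (\<phi> s * of_int (g + (\<Sum>i<m. h i))))"
    by (rule sum.swap)
  also have "\<dots> = (\<Sum>s\<in>P. (\<Prod>l\<in>\<Lambda>. w l (s l)) * (ft G (\<phi> s) * ft H (\<phi> s) ^ m))"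
    unfolding HH_def sum_cis_translates[OF fin(3), symmetric] sum_distrib_left ..
  finally have Tot: "complex_of_real Tot = (\<Sum>s\<in>P. (\<Prod>l\<in>\<Lambda>. w l (s l)) * (ft G (\<phi> s) * ft H (\<phi> s) ^ m))" .
  define z where "z = (\<lambda>l\<in>\<Lambda>. 0 :: int)"
  have zP: "z \<in> P" by (auto simp: z_def P_def)
  have Tot0: "Tot \<ge> 0" unfolding Tot_def by (intro sum_nonneg \<Psi>0)
  have "Tot = norm (complex_of_real Tot)" using Tot0 by simp
  also have "\<dots> \<le> (\<Sum>s\<in>P. norm ((\<Prod>l\<in>\<Lambda>. w l (s l)) * (ft G (\<phi> s) * ft H (\<phi> s) ^ m)))"
    unfolding Tot by (rule norm_sum)
  also have "\<dots> = norm ((\<Prod>l\<in>\<Lambda>. w l (z l)) * (ft G (\<phi> z) * ft H (\<phi> z) ^ m)) +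
     (\<Sum>s\<in>P - {z}. norm ((\<Prod>l\<in>\<Lambda>. w l (s l)) * (ft G (\<phi> s) * ft H (\<phi> s) ^ m)))"
    using finP zP by (rule sum.remove)
  also have "\<dots> \<le> (17/16) ^ m * (real (card G) * real (card H) ^ m) +
     (\<Sum>s\<in>P - {z}. (\<Prod>l\<in>\<Lambda>. norm (w l (s l))) * (real (card G) * (real (card H) / 2) ^ m))"
  proof (intro add_mono sum_mono)
    have "norm (\<Prod>l\<in>\<Lambda>. w l (z l)) = (17/16) ^ m"
      using \<Lambda>(2) by (simp add: z_def w_def norm_power norm_divide)
    then show "norm ((\<Prod>l\<in>\<Lambda>. w l (z l)) * (ft G (\<phi> z) * ft H (\<phi> z) ^ m)) \<le> (17/16) ^ m * (real (card G) * real (card H) ^ m)"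
      unfolding norm_mult norm_power by (simp add: mult_mono norm_ft_le power_mono)
  next
    fix s assume s: "s \<in> P - {z}"
    have "\<exists>l\<in>\<Lambda>. s l \<noteq> 0"
    proof (rule ccontr)
      assume "\<not> ?thesis"
      then have "s = z" using s by (intro PiE_ext[of s \<Lambda> "\<lambda>_. {-1,0,1}" z]) (auto simp: P_def z_def)
      then show False using s by simp
    qed
    then have "norm (ft H (\<phi> s)) \<le> real (card H) / 2"
      using \<Lambda>(3) s unfolding dissociated_def \<phi>_def P_def by blast
    then have "norm (ft H (\<phi> s)) ^ m \<le> (real (card H) / 2) ^ m" by (intro power_mono) auto
    then show "norm ((\<Prod>l\<in>\<Lambda>. w l (s l)) * (ft G (\<phi> s) * ft H (\<phi> s) ^ m)) \<le> (\<Prod>l\<in>\<Lambda>. norm (w l (s l))) * (real (card G) * (real (card H) / 2) ^ m)"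
      unfolding norm_mult norm_power prod_norm[symmetric]
      by (intro mult_left_mono mult_mono norm_ft_le) (auto intro: prod_nonneg)
  qed
  also have "(\<Sum>s\<in>P - {z}. (\<Prod>l\<in>\<Lambda>. norm (w l (s l))) * (real (card G) * (real (card H) / 2) ^ m)) \<le>
      (\<Sum>s\<in>P. \<Prod>l\<in>\<Lambda>. norm (w l (s l))) * (real (card G) * (real (card H) / 2) ^ m)"
    unfolding sum_distrib_right using finP by (intro sum_mono2) (auto intro!: mult_nonneg_nonneg prod_nonneg)
  also have "(\<Sum>s\<in>P. \<Prod>l\<in>\<Lambda>. norm (w l (s l))) = (\<Prod>l\<in>\<Lambda>. \<Sum>s\<in>{-1,0,1}. norm (w l s))"
    unfolding P_def using \<Lambda>(1) by (intro prod_sum_PiE[symmetric]) auto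
  \<comment> \<open>A factor is at most \<open>17/16 + 1/8 + 1/8\<close>. The resulting
    \<open>2 ^ m\<close> is cancelled exactly by the damping.\<close>
  also have "\<dots> \<le> (\<Prod>l\<in>\<Lambda>. 2)"
  proof (rule prod_mono)
    fix l
    show "0 \<le> (\<Sum>s\<in>{-1,0,1}. norm (w l s)) \<and> (\<Sum>s\<in>{-1,0,1}. norm (w l s)) \<le> 2"
      using c1[of l] by (simp add: w_def norm_divide)
  qed
  also have "(\<Prod>l\<in>\<Lambda>. 2 :: real) = 2 ^ m" using \<Lambda>(2) by simp
  also have "(17/16) ^ m * (real (card G) * real (card H) ^ m) + 2 ^ m * (real (card G) * (real (card H) / 2) ^ m)
     = ((17/16) ^ m + 1) * (real (card G) * real (card H) ^ m)"
    by (simp add: power_divide field_simps)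
  also have "\<dots> \<le> (2 * exp (real m / 16)) * (real (card G) * real (card H) ^ m)"
  proof (rule mult_right_mono)
    have "(17/16 :: real) ^ m \<le> exp (1/16) ^ m" using exp_ge_add_one_self[of "1/16 :: real"] by (intro power_mono) auto
    also have "\<dots> = exp (real m / 16)" by (simp add: exp_of_nat_mult[symmetric])
    finally show "(17/16) ^ m + 1 \<le> 2 * exp (real m / 16)" using one_le_exp_iff[of "real m / 16"] by linarith
  qed simp
  finally have upper: "Tot \<le> (2 * exp (real m / 16)) * (real (card G) * real (card H) ^ m)"
    by (simp add: mult_right_mono)
  have "exp (real m / 8) * real (card X) \<le> (\<Sum>x\<in>X. \<Psi> x)"
  proof -
    \<comment> \<open>Jensen's inequality by means of the tangent of \<open>exp\<close> at
      \<open>?v\<close>, a lower bound for the mean of \<open>?S\<close>: there are \<open>m\<close>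
      frequencies, each with sum at least \<open>card X / 2\<close>, and a division by 4.\<close>
    let ?v = "real m / 8"
    let ?S = "\<lambda>x. (\<Sum>l\<in>\<Lambda>. y l x) / 4"
    have "(\<Sum>x\<in>X. ?S x) = (\<Sum>l\<in>\<Lambda>. \<Sum>x\<in>X. y l x) / 4"
      by (subst sum.swap) (simp add: sum_divide_distrib)
    also have "\<dots> \<ge> (\<Sum>l\<in>\<Lambda>. real (card X) / 2) / 4"
      unfolding sumy using spec by (intro divide_right_mono sum_mono) auto
    finally have S: "(\<Sum>x\<in>X. ?S x) \<ge> ?v * real (card X)" using \<Lambda>(2) by simp
    have "exp ?v * real (card X) \<le> exp ?v * (\<Sum>x\<in>X. 1 + ?S x - ?v)"
      using S by (intro mult_left_mono) (auto simp: sum.distrib sum_subtractf algebra_simps)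
    also have "\<dots> = (\<Sum>x\<in>X. exp ?v * (1 + (?S x - ?v)))" by (simp add: sum_distrib_left add_diff_eq)
    also have "\<dots> \<le> (\<Sum>x\<in>X. \<Psi> x)"
    proof (rule sum_mono)
      fix x
      have "exp ?v * (1 + (?S x - ?v)) \<le> exp ?v * exp (?S x - ?v)"
        using exp_ge_add_one_self[of "?S x - ?v"] by (intro mult_left_mono) auto
      also have "\<dots> = exp (?S x)" by (simp add: exp_add[symmetric])
      also have "\<dots> \<le> \<Psi> x" by (rule \<Psi>exp)
      finally show "exp ?v * (1 + (?S x - ?v)) \<le> \<Psi> x" .
    qed
    finally show ?thesis .
  qed
  then have "exp (real m / 8) * real (card X) * real (card H) ^ m \<le> (\<Sum>h\<in>HH. \<Sum>x\<in>X. \<Psi> x)"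
    by (simp add: cHH mult.commute[of "real (card H) ^ m"] mult_right_mono)
  also have "\<dots> \<le> (\<Sum>h\<in>HH. \<Sum>g\<in>G. \<Psi> (g + (\<Sum>i<m. h i)))"
  proof (rule sum_mono)
    fix h assume h: "h \<in> HH"
    have "(\<Sum>x\<in>X. \<Psi> x) = (\<Sum>g\<in>(\<lambda>x. x - (\<Sum>i<m. h i)) ` X. \<Psi> (g + (\<Sum>i<m. h i)))"
      by (subst sum.reindex) (auto simp: inj_on_def)
    also have "\<dots> \<le> (\<Sum>g\<in>G. \<Psi> (g + (\<Sum>i<m. h i)))"
      using fin G h by (intro sum_mono2 \<Psi>0) (auto simp: HH_def)
    finally show "(\<Sum>x\<in>X. \<Psi> x) \<le> (\<Sum>g\<in>G. \<Psi> (g + (\<Sum>i<m. h i)))" .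
  qed
  also have "\<dots> = Tot" unfolding Tot_def by (rule sum.swap)
  also note upper
  finally have "exp (real m / 8) * real (card X) * real (card H) ^ m \<le> 2 * exp (real m / 16) * real (card G) * real (card H) ^ m"
    by (simp add: mult.assoc)
  moreover have "real (card H) ^ m > 0" using fin ne by (simp add: card_gt_0_iff)
  ultimately have "exp (real m / 8) * real (card X) \<le> 2 * exp (real m / 16) * real (card G)"
    by (rule mult_right_le_imp_le)
  moreover have "exp (real m / 8) = exp (real m / 16) * exp (real m / 16)" by (simp add: exp_add[symmetric])
  ultimately have "exp (real m / 16) * real (card X) \<le> 2 * real (card G)" by (simp add: mult.assoc mult.left_commute)
  moreover have "card X > 0" using fin ne by (simp add: card_gt_0_iff)
  ultimately have "exp (real m / 16) \<le> 2 * real (card G) / real (card X)" by (simp add: field_simps)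
  then have "ln (exp (real m / 16)) \<le> ln (2 * real (card G) / real (card X))"
    by (intro ln_mono) (auto intro: less_le_trans[OF exp_gt_zero])
  then show ?thesis by simp
qed

text \<open>A set \<Lambda> of maximal size among the subsets of the half-spectrum of
  \<open>X\<close> dissociated relative to \<open>H\<close> does it. Adding a further \<theta>
  creates a combination \<phi> in the half-spectrum of \<open>H\<close> in which \<theta> has
  coefficient 1 or -1; solving for \<theta> bounds its character by those of \<phi> and of
  \<Lambda>.\<close>

lemma chang:
  fixes X G H :: "int set"
  assumes fin: "finite X" "finite G" "finite H" and ne: "X \<noteq> {}" "H \<noteq> {}"
    and G: "\<And>x h. x \<in> X \<Longrightarrow> h \<in> {..<m} \<rightarrow>\<^sub>E H \<Longrightarrow> x - (\<Sum>i<m. h i) \<in> G"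
    and m: "16 * ln (2 * real (card G) / real (card X)) < real m"
  shows "\<exists>\<Lambda>. finite \<Lambda> \<and> card \<Lambda> \<le> m \<and>
    (\<forall>\<theta>. norm (ft X \<theta>) \<ge> real (card X) / 2 \<longrightarrow> (\<exists>\<phi>. norm (ft H \<phi>) > real (card H) / 2 \<and>
       (\<forall>x. norm (1 - cis (\<theta> * of_int x)) \<le> norm (1 - cis (\<phi> * of_int x)) + (\<Sum>l\<in>\<Lambda>. norm (1 - cis (l * of_int x))))))"
proof -
  define good where "good \<Lambda> \<longleftrightarrow> finite \<Lambda> \<and> dissociated H \<Lambda> \<and> (\<forall>l\<in>\<Lambda>. norm (ft X l) \<ge> real (card X) / 2)" for \<Lambda>
  have sub: "good \<Lambda>'" if "good \<Lambda>" "\<Lambda>' \<subseteq> \<Lambda>" for \<Lambda> \<Lambda>'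
  proof -
    have fins: "finite \<Lambda>" "finite \<Lambda>'" using that finite_subset by (auto simp: good_def)
    have "dissociated H \<Lambda>'" unfolding dissociated_def
    proof (intro ballI impI)
      fix s assume s: "s \<in> \<Lambda>' \<rightarrow>\<^sub>E {-1, 0, 1 :: int}" "\<exists>l\<in>\<Lambda>'. s l \<noteq> 0"
      define s' where "s' = (\<lambda>l\<in>\<Lambda>. if l \<in> \<Lambda>' then s l else 0)"
      have "s' \<in> \<Lambda> \<rightarrow>\<^sub>E {-1, 0, 1}" using s unfolding s'_def by (auto simp: PiE_def Pi_def)
      moreover have "\<exists>l\<in>\<Lambda>. s' l \<noteq> 0" using s that by (auto simp: s'_def)
      ultimately have "norm (ft H (\<Sum>l\<in>\<Lambda>. of_int (s' l) * l)) \<le> real (card H) / 2"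
        using that unfolding good_def dissociated_def by blast
      also have "(\<Sum>l\<in>\<Lambda>. of_int (s' l) * l) = (\<Sum>l\<in>\<Lambda>'. of_int (s l) * l)"
        using fins that by (intro sum.mono_neutral_cong_right) (auto simp: s'_def)
      finally show "norm (ft H (\<Sum>l\<in>\<Lambda>'. of_int (s l) * l)) \<le> real (card H) / 2" .
    qed
    then show ?thesis using that fins by (auto simp: good_def)
  qed
  \<comment> \<open>\<open>card_dissociated_spectrum\<close> uses as many copies of \<open>H\<close>
    as there are frequencies, so it is applied to a subset of exactly \<open>m\<close> elements,
    which stays good by \<open>sub\<close>.\<close>
  have bound: "card \<Lambda> < m" if "good \<Lambda>" for \<Lambda>
  proof (rule ccontr)
    assume "\<not> card \<Lambda> < m"
    then obtain \<Lambda>' where \<Lambda>': "\<Lambda>' \<subseteq> \<Lambda>" "card \<Lambda>' = m" "finite \<Lambda>'"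
      using obtain_subset_with_card_n[of m \<Lambda>] by auto
    have "good \<Lambda>'" by (rule sub[OF that \<Lambda>'(1)])
    then have "real m / 16 \<le> ln (2 * real (card G) / real (card X))"
      using \<Lambda>' by (intro card_dissociated_spectrum[OF fin ne G, of \<Lambda>']) (auto simp: good_def)
    then show False using m by simp
  qed
  have "good {}" by (auto simp: good_def dissociated_def)
  then have "\<exists>\<Lambda>. good \<Lambda> \<and> (\<forall>\<Lambda>'. good \<Lambda>' \<longrightarrow> card \<Lambda>' \<le> card \<Lambda>)"
    using ex_has_greatest_nat[of good "{}" card m] bound by (auto dest!: less_imp_le)
  then obtain \<Lambda> where \<Lambda>: "good \<Lambda>" "\<And>\<Lambda>'. good \<Lambda>' \<Longrightarrow> card \<Lambda>' \<le> card \<Lambda>" by blast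
  have fin\<Lambda>: "finite \<Lambda>" using \<Lambda> by (simp add: good_def)
  have "\<exists>\<phi>. norm (ft H \<phi>) > real (card H) / 2 \<and>
       (\<forall>x. norm (1 - cis (\<theta> * of_int x)) \<le> norm (1 - cis (\<phi> * of_int x)) + (\<Sum>l\<in>\<Lambda>. norm (1 - cis (l * of_int x))))"
    if \<theta>: "norm (ft X \<theta>) \<ge> real (card X) / 2" for \<theta>
  proof (cases "\<theta> \<in> \<Lambda>")
    case True
    have "norm (1 - cis (\<theta> * of_int x)) \<le> (\<Sum>l\<in>\<Lambda>. norm (1 - cis (l * of_int x)))" for x :: int
      using True fin\<Lambda> by (intro member_le_sum[where f="\<lambda>l. norm (1 - cis (l * of_int x))"]) auto
    moreover have "norm (ft H 0) > real (card H) / 2"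
      using fin ne by (simp add: ft_def card_gt_0_iff)
    ultimately show ?thesis by (intro exI[of _ 0]) auto
  next
    case False
    have "\<not> good (insert \<theta> \<Lambda>)"
      using \<Lambda>(2)[of "insert \<theta> \<Lambda>"] False fin\<Lambda> by auto
    then have "\<not> dissociated H (insert \<theta> \<Lambda>)" using \<theta> \<Lambda>(1) by (auto simp: good_def)
    then obtain s where s: "s \<in> insert \<theta> \<Lambda> \<rightarrow>\<^sub>E {-1, 0, 1 :: int}" "\<exists>l\<in>insert \<theta> \<Lambda>. s l \<noteq> 0"
      "norm (ft H (\<Sum>l\<in>insert \<theta> \<Lambda>. of_int (s l) * l)) > real (card H) / 2"
      unfolding dissociated_def by (auto simp: not_le)
    define \<phi> where "\<phi> = (\<Sum>l\<in>insert \<theta> \<Lambda>. of_int (s l) * l)"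
    have \<phi>: "\<phi> = of_int (s \<theta>) * \<theta> + (\<Sum>l\<in>\<Lambda>. of_int (s l) * l)"
      unfolding \<phi>_def using False fin\<Lambda> by simp
    \<comment> \<open>With coefficient 0 the combination would involve \<Lambda> alone and
      contradict its dissociativity.\<close>
    have s\<theta>: "s \<theta> \<in> {-1, 1}"
    proof (rule ccontr)
      assume "\<not> ?thesis"
      then have s0: "s \<theta> = 0" using s(1) by (auto simp: PiE_def Pi_def)
      then have "\<exists>l\<in>\<Lambda>. restrict s \<Lambda> l \<noteq> 0" "restrict s \<Lambda> \<in> \<Lambda> \<rightarrow>\<^sub>E {-1, 0, 1}"
        using s by (auto simp: PiE_def Pi_def)
      then have "norm (ft H (\<Sum>l\<in>\<Lambda>. of_int (restrict s \<Lambda> l) * l)) \<le> real (card H) / 2"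
        using \<Lambda>(1) unfolding good_def dissociated_def by blast
      then show False using s(3) \<phi> s0 unfolding \<phi>_def[symmetric] by (simp cong: sum.cong)
    qed
    have "norm (1 - cis (\<theta> * of_int x)) \<le> norm (1 - cis (\<phi> * of_int x)) + (\<Sum>l\<in>\<Lambda>. norm (1 - cis (l * of_int x)))" for x :: int
    proof -
      have "norm (1 - cis (\<theta> * of_int x)) = norm (1 - cis (of_int (s \<theta>) * \<theta> * of_int x))"
        using s\<theta> by (auto simp: norm_one_minus_cis_uminus)
      also have "of_int (s \<theta>) * \<theta> * of_int x = \<phi> * of_int x + - (\<Sum>l\<in>\<Lambda>. of_int (s l) * (l * of_int x))"
        unfolding \<phi> by (simp add: algebra_simps sum_distrib_left)
      also have "norm (1 - cis \<dots>) \<le> norm (1 - cis (\<phi> * of_int x)) + norm (1 - cis (\<Sum>l\<in>\<Lambda>. of_int (s l) * (l * of_int x)))"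
        using norm_one_minus_cis_add norm_one_minus_cis_uminus by metis
      also have "norm (1 - cis (\<Sum>l\<in>\<Lambda>. of_int (s l) * (l * of_int x))) \<le> (\<Sum>l\<in>\<Lambda>. norm (1 - cis (of_int (s l) * (l * of_int x))))"
        by (rule norm_one_minus_cis_sum)
      also have "\<dots> \<le> (\<Sum>l\<in>\<Lambda>. norm (1 - cis (l * of_int x)))"
        using s(1) by (intro sum_mono norm_one_minus_cis_mult_sign) (auto simp: PiE_def Pi_def)
      finally show ?thesis by simp
    qed
    then show ?thesis using s(3) unfolding \<phi>_def by blast
  qed
  then show ?thesis using fin\<Lambda> bound[OF \<Lambda>(1)] by (intro exI[of _ \<Lambda>]) auto
qed

section \<open>The Kelley--Meka density increment\<close>

lemma sum_reflect:
  fixes F g :: "int \<Rightarrow> real"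
  assumes "finite R" "(\<lambda>b. c - b) ` B \<subseteq> R" "\<And>x. x \<notin> B \<Longrightarrow> F x = 0"
  shows "(\<Sum>s\<in>R. F (c - s) * g s) = (\<Sum>b\<in>B. F b * g (c - b))"
proof -
  have "(\<Sum>s\<in>R. F (c - s) * g s) = (\<Sum>s\<in>(\<lambda>b. c - b) ` B. F (c - s) * g s)"
  proof (rule sum.mono_neutral_right)
    show "\<forall>i\<in>R - (\<lambda>b. c - b) ` B. F (c - i) * g i = 0"
    proof
      fix i assume "i \<in> R - (\<lambda>b. c - b) ` B"
      then have "c - i \<notin> B" by (auto simp: image_iff algebra_simps)
      then show "F (c - i) * g i = 0" using assms(3) by simp
    qed
  qed (use assms in auto)
  also have "\<dots> = (\<Sum>b\<in>B. F b * g (c - b))" by (subst sum.reindex) (auto simp: inj_on_def)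
  finally show ?thesis .
qed

lemma sum_translate:
  fixes F g :: "int \<Rightarrow> real"
  assumes "finite R" "(\<lambda>b. b - c) ` B \<subseteq> R" "\<And>x. x \<notin> B \<Longrightarrow> F x = 0"
  shows "(\<Sum>s\<in>R. F (s + c) * g s) = (\<Sum>b\<in>B. F b * g (b - c))"
proof -
  have "(\<Sum>s\<in>R. F (s + c) * g s) = (\<Sum>s\<in>(\<lambda>b. b - c) ` B. F (s + c) * g s)"
  proof (rule sum.mono_neutral_right)
    show "\<forall>i\<in>R - (\<lambda>b. b - c) ` B. F (i + c) * g i = 0"
    proof
      fix i assume "i \<in> R - (\<lambda>b. b - c) ` B"
      then have "i + c \<notin> B" by (auto simp: image_iff algebra_simps)
      then show "F (i + c) * g i = 0" using assms(3) by simp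
    qed
  qed (use assms in auto)
  also have "\<dots> = (\<Sum>b\<in>B. F b * g (b - c))" by (subst sum.reindex) (auto simp: inj_on_def)
  finally show ?thesis .
qed

lemma card_translate_stable:
  fixes A B :: "int set"
  assumes "finite B" "A \<subseteq> B" "real (card {b \<in> B. b + x \<notin> B}) \<le> \<kappa> * real (card B)"
  shows "real (card {a \<in> A. a + x \<in> B}) \<ge> real (card A) - \<kappa> * real (card B)"
proof -
  have "finite A" using assms finite_subset by blast
  have "card A = card {a \<in> A. a + x \<in> B} + card {a \<in> A. a + x \<notin> B}"
    using \<open>finite A\<close> by (subst card_Un_disjoint[symmetric]) (auto intro: arg_cong[where f=card])
  moreover have "card {a \<in> A. a + x \<notin> B} \<le> card {b \<in> B. b + x \<notin> B}"
    using assms by (intro card_mono) auto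
  ultimately show ?thesis using assms(3) by linarith
qed

text \<open>With \<open>F\<close> the balanced function of \<open>A\<close> in \<open>B\<close>, missing sums make \<open>F * F\<close> large and negative at
  many \<open>e - d + y\<close>.  The Gram inequality moves its \<open>p\<close>-th moment to the autocorrelation of \<open>F\<close>, all
  of whose moments are nonnegative; so expanding the \<open>8p\<close>-th power of \<open>1 +\<close> autocorrelation and
  keeping only the \<open>p\<close>-th term bounds it from below.\<close>

lemma high_moment_of_missing_sums:
  fixes A B E :: "int set" and \<alpha> :: real
  assumes B: "finite B" "\<And>x. x \<in> B \<Longrightarrow> - x \<in> B" and A: "A \<subseteq> B" "A \<noteq> {}"
    and \<alpha>: "real (card A) = \<alpha> * real (card B)"
    and E: "finite E"
    and stable: "\<And>e d. e \<in> E \<Longrightarrow> d \<in> E \<Longrightarrow> real (card {b \<in> B. b + (e - d) \<notin> B}) \<le> \<alpha> / 1000 * real (card B)"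
       "\<And>e d. e \<in> E \<Longrightarrow> d \<in> E \<Longrightarrow> real (card {b \<in> B. b + - (e - d + y) \<notin> B}) \<le> \<alpha> / 1000 * real (card B)"
    and p: "even p" "p \<ge> 100" "(1/2) ^ p \<le> \<alpha> / 2"
    and pairs: "real (card {(e, d) \<in> E \<times> E. w - e + d \<in> A}) \<ge> \<alpha> / 2 * real (card E) ^ 2"
    and missing: "\<And>e d a b. e \<in> E \<Longrightarrow> d \<in> E \<Longrightarrow> w - e + d \<in> A \<Longrightarrow> a \<in> A \<Longrightarrow> b \<in> A \<Longrightarrow> a + b \<noteq> e - d + y"
  shows "(\<Sum>e\<in>E. \<Sum>d\<in>E. (real (diff_count A (e - d)) / (\<alpha> * real (card A))) ^ (8 * p)) \<ge> (37/20) ^ p * real (card E) ^ 2"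
proof -
  have finA: "finite A" using A B finite_subset by blast
  have cA: "card A > 0" using finA A by (simp add: card_gt_0_iff)
  have cAB: "card A \<le> card B" using A B by (intro card_mono)
  then have cB: "real (card B) > 0" using cA by simp
  have \<alpha>0: "\<alpha> > 0" using \<alpha> cA cB by (metis of_nat_0_less_iff zero_less_mult_pos2)
  have \<alpha>1: "\<alpha> \<le> 1"
  proof -
    have "\<alpha> * real (card B) \<le> 1 * real (card B)" using cAB \<alpha> by simp
    then show ?thesis using cB by (simp only: mult_le_cancel_right_pos)
  qed
  define n where "n = real (card B)"
  define c where "c = \<alpha>\<^sup>2 * n"
  have n0: "n > 0" using cB by (simp add: n_def)
  have c0: "c > 0" using \<alpha>0 cB by (simp add: c_def n_def)
  have ca: "\<alpha> * real (card A) = c" using \<alpha> by (simp add: c_def n_def power2_eq_square)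
  define F where "F x = of_bool (x \<in> A) - \<alpha> * of_bool (x \<in> B)" for x :: int
  have F0: "F x = 0" if "x \<notin> B" for x using that A by (auto simp: F_def)
  \<comment> \<open>\<open>R\<close> contains the supports, as functions of \<open>s\<close>, of all
    \<open>F (e - s)\<close> and all \<open>F (s - d + y)\<close>, so Gram entries over
    \<open>R\<close> are full correlations and convolutions.\<close>
  define R where "R = (\<lambda>(e, b). e - b) ` (E \<times> B) \<union> (\<lambda>(e, b). b + e - y) ` (E \<times> B)"
  have finR: "finite R" using E B by (auto simp: R_def)
  define corr where "corr x = (\<Sum>b\<in>B. F b * F (b - x))" for x
  define cnv where "cnv x = (\<Sum>b\<in>B. F b * F (x - b))" for x
  have corr1: "(\<Sum>s\<in>R. F (e - s) * F (d - s)) = corr (e - d)" if "e \<in> E" "d \<in> E" for e d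
  proof -
    have "(\<Sum>s\<in>R. F (e - s) * F (d - s)) = (\<Sum>b\<in>B. F b * F (d - (e - b)))"
      using that by (intro sum_reflect finR F0) (force simp: R_def)+
    then show ?thesis by (simp add: corr_def algebra_simps)
  qed
  have cnv1: "(\<Sum>s\<in>R. F (e - s) * F (s - d + y)) = cnv (e - d + y)" if "e \<in> E" "d \<in> E" for e d
  proof -
    have "(\<Sum>s\<in>R. F (e - s) * F (s - d + y)) = (\<Sum>b\<in>B. F b * F (e - b - d + y))"
      using that by (intro sum_reflect finR F0) (force simp: R_def)+
    then show ?thesis by (simp add: cnv_def algebra_simps)
  qed
  have corr2: "(\<Sum>s\<in>R. F (s - d + y) * F (s - e + y)) = corr (e - d)" if "e \<in> E" "d \<in> E" for e d
  proof -
    have "(\<Sum>s\<in>R. F (s + (y - d)) * F (s - e + y)) = (\<Sum>b\<in>B. F b * F (b - (y - d) - e + y))"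
      using that by (intro sum_translate finR F0) (force simp: R_def)+
    then show ?thesis by (simp add: corr_def algebra_simps)
  qed
  define U where "U k = (\<Sum>e\<in>E. \<Sum>d\<in>E. corr (e - d) ^ k)" for k
  have U: "U k = (\<Sum>e\<in>E. \<Sum>d\<in>E. (\<Sum>s\<in>R. F (e - s) * F (d - s)) ^ k)" for k
    unfolding U_def by (intro sum.cong refl) (simp add: corr1)
  have U0: "U k \<ge> 0" for k unfolding U by (rule gram_power_nonneg[OF finR])
  have U2: "U p = (\<Sum>d\<in>E. \<Sum>e\<in>E. (\<Sum>s\<in>R. F (s - d + y) * F (s - e + y)) ^ p)"
  proof -
    have "(\<Sum>d\<in>E. \<Sum>e\<in>E. (\<Sum>s\<in>R. F (s - d + y) * F (s - e + y)) ^ p) = (\<Sum>d\<in>E. \<Sum>e\<in>E. corr (e - d) ^ p)"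
      by (intro sum.cong refl) (simp add: corr2)
    also have "\<dots> = U p" unfolding U_def by (rule sum.swap)
    finally show ?thesis by simp
  qed
  have cnvU: "(\<Sum>e\<in>E. \<Sum>d\<in>E. cnv (e - d + y) ^ p) \<le> U p"
  proof -
    have "(\<Sum>e\<in>E. \<Sum>d\<in>E. cnv (e - d + y) ^ p) = (\<Sum>e\<in>E. \<Sum>d\<in>E. (\<Sum>s\<in>R. F (e - s) * F (s - d + y)) ^ p)"
      by (intro sum.cong refl) (simp add: cnv1)
    then show ?thesis
      using gram_power_le[OF finR, of "\<lambda>e s. F (e - s)" "\<lambda>d s. F (s - d + y)" p E E] U2 U[of p] by simp
  qed
  have card_reflect: "card {b \<in> B. x - b \<in> A} = card {a \<in> A. x - a \<in> B}" for x
    by (rule bij_betw_same_card[of "\<lambda>b. x - b"], rule bij_betw_byWitness[of _ "\<lambda>b. x - b"]) auto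
  have symB: "- x \<in> B \<longleftrightarrow> x \<in> B" for x using B(2)[of x] B(2)[of "- x"] by auto
  have split: "(\<Sum>b\<in>B. F b * F (g b)) = real (card {a \<in> A. g a \<in> A}) - \<alpha> * real (card {a \<in> A. g a \<in> B})
      - \<alpha> * real (card {b \<in> B. g b \<in> A}) + \<alpha>\<^sup>2 * real (card {b \<in> B. g b \<in> B})" for g
  proof -
    have "(\<Sum>b\<in>B. F b * F (g b)) = (\<Sum>b\<in>B. of_bool (b \<in> A \<and> g b \<in> A) - \<alpha> * of_bool (b \<in> A \<and> g b \<in> B)
       - \<alpha> * of_bool (g b \<in> A) + \<alpha>\<^sup>2 * of_bool (g b \<in> B))"
      by (intro sum.cong refl) (simp add: F_def power2_eq_square algebra_simps)
    also have "\<dots> = real (card {b \<in> B. b \<in> A \<and> g b \<in> A}) - \<alpha> * real (card {b \<in> B. b \<in> A \<and> g b \<in> B})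
      - \<alpha> * real (card {b \<in> B. g b \<in> A}) + \<alpha>\<^sup>2 * real (card {b \<in> B. g b \<in> B})"
      using B by (simp add: sum.distrib sum_subtractf sum_distrib_left[symmetric] sum_of_bool_eq Int_def)
    also have "{b \<in> B. b \<in> A \<and> g b \<in> A} = {a \<in> A. g a \<in> A}" using A by auto
    also have "{b \<in> B. b \<in> A \<and> g b \<in> B} = {a \<in> A. g a \<in> B}" using A by auto
    finally show ?thesis .
  qed
  \<comment> \<open>Without sums in \<open>A\<close> there remain two cross terms of about
    \<open>- c\<close> each and a last term of at most \<open>c\<close>. The total is close to
    \<open>- c\<close>, and asking only for \<open>- (c / 2)\<close> absorbs the boundary
    losses.\<close>
  have cnv_le: "cnv (e - d + y) \<le> - (c / 2)" if "e \<in> E" "d \<in> E" "w - e + d \<in> A" for e d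
  proof -
    let ?x = "e - d + y"
    have none: "{a \<in> A. ?x - a \<in> A} = {}"
      using missing[OF that] by (metis (no_types, lifting) add_diff_cancel_left' add_diff_eq empty_Collect_eq)
    have "{a \<in> A. ?x - a \<in> B} = {a \<in> A. a + - ?x \<in> B}"
      using symB by (metis add.commute diff_conv_add_uminus minus_diff_eq)
    then have 1: "real (card {a \<in> A. ?x - a \<in> B}) \<ge> real (card A) - \<alpha> / 1000 * n"
      using card_translate_stable[OF B(1) A(1) stable(2)[OF that(1,2)]] by (simp add: n_def)
    have "card {b \<in> B. ?x - b \<in> B} \<le> card B" using B by (intro card_mono) auto
    then have 2: "\<alpha>\<^sup>2 * real (card {b \<in> B. ?x - b \<in> B}) \<le> c" using \<alpha>0 by (simp add: c_def n_def)
    have 3: "\<alpha> * real (card {a \<in> A. ?x - a \<in> B}) \<ge> \<alpha> * (\<alpha> * n - \<alpha> / 1000 * n)"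
      using 1 \<alpha> \<alpha>0 by (intro mult_left_mono) (auto simp: n_def)
    have "\<alpha> * (\<alpha> * n - \<alpha> / 1000 * n) = c * (999/1000)" by (simp add: c_def power2_eq_square algebra_simps)
    moreover have "cnv ?x = - (2 * (\<alpha> * real (card {a \<in> A. ?x - a \<in> B}))) + \<alpha>\<^sup>2 * real (card {b \<in> B. ?x - b \<in> B})"
      unfolding cnv_def split card_reflect none by simp
    ultimately show ?thesis using 2 3 c0 by linarith
  qed
  \<comment> \<open>Since \<open>(1/2) ^ p \<le> \<alpha> / 2\<close>, keeping only a proportion
    \<alpha> / 2 of the pairs costs one more factor 2 in the base. That \<open>p\<close> is even
    removes the sign of \<open>cnv\<close>.\<close>
  have "U p \<ge> (1/4) ^ p * c ^ p * real (card E) ^ 2"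
  proof -
    have "(1/4) ^ p * c ^ p * real (card E) ^ 2 \<le> (c / 2) ^ p * (\<alpha> / 2 * real (card E) ^ 2)"
    proof -
      have "(1/4 :: real) ^ p * c ^ p * real (card E) ^ 2 = (c / 2) ^ p * ((1/2) ^ p * real (card E) ^ 2)"
        by (simp add: power_divide flip: power_mult_distrib)
      also have "\<dots> \<le> (c / 2) ^ p * (\<alpha> / 2 * real (card E) ^ 2)"
        using p(3) c0 by (intro mult_left_mono mult_right_mono) auto
      finally show ?thesis .
    qed
    also have "\<dots> \<le> (c / 2) ^ p * real (card {(e, d) \<in> E \<times> E. w - e + d \<in> A})"
      using pairs c0 by (intro mult_left_mono) auto
    also have "\<dots> = (\<Sum>(e, d)\<in>{(e, d) \<in> E \<times> E. w - e + d \<in> A}. (c / 2) ^ p)" by simp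
    also have "\<dots> \<le> (\<Sum>(e, d)\<in>{(e, d) \<in> E \<times> E. w - e + d \<in> A}. cnv (e - d + y) ^ p)"
    proof (rule sum_mono, clarify)
      fix e d assume "e \<in> E" "d \<in> E" "w - e + d \<in> A"
      from cnv_le[OF this] have "(c / 2) ^ p \<le> (- cnv (e - d + y)) ^ p" using c0 by (intro power_mono) auto
      then show "(c / 2) ^ p \<le> cnv (e - d + y) ^ p" using p(1) by simp
    qed
    also have "\<dots> \<le> (\<Sum>(e, d)\<in>E \<times> E. cnv (e - d + y) ^ p)"
      using E p(1) by (intro sum_mono2) (auto simp: zero_le_even_power)
    also have "\<dots> = (\<Sum>e\<in>E. \<Sum>d\<in>E. cnv (e - d + y) ^ p)" by (rule sum.cartesian_product[symmetric])
    also note cnvU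
    finally show ?thesis .
  qed
  \<comment> \<open>The binomial coefficient of \<open>8 * p\<close> over \<open>p\<close> is at
    least \<open>8 ^ p\<close>, which outweighs \<open>(1/4) ^ p\<close> and leaves
    \<open>2 ^ p\<close>.\<close>
  define q where "q = 8 * p"
  define T where "T x = real (diff_count A x) / c" for x
  have T0: "T x \<ge> 0" for x using c0 by (simp add: T_def)
  \<comment> \<open>Up to boundary terms \<open>corr + c\<close> is the autocorrelation of
    \<open>A\<close> itself; stability bounds the discrepancy by \<open>c / 500\<close>.\<close>
  have close: "\<bar>1 + corr (e - d) / c\<bar> \<le> T (e - d) + 1/500" if "e \<in> E" "d \<in> E" for e d
  proof -
    let ?x = "e - d"
    have r: "card {a \<in> A. a - ?x \<in> A} = diff_count A ?x"
      unfolding diff_count_def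
      by (rule bij_betw_same_card[of "\<lambda>a. a - ?x"], rule bij_betw_byWitness[of _ "\<lambda>a. a + ?x"]) auto
    have s: "card {b \<in> B. b - ?x \<in> A} = card {a \<in> A. a + ?x \<in> B}"
      by (rule bij_betw_same_card[of "\<lambda>a. a - ?x"], rule bij_betw_byWitness[of _ "\<lambda>a. a + ?x"]) auto
    have st1: "real (card {b \<in> B. b + ?x \<notin> B}) \<le> \<alpha> / 1000 * real (card B)" using stable(1) that by blast
    have st2: "real (card {b \<in> B. b + - ?x \<notin> B}) \<le> \<alpha> / 1000 * real (card B)"
      using stable(1)[of d e] that by simp
    have seq: "{a \<in> C. a - ?x \<in> B} = {a \<in> C. a + - ?x \<in> B}" for C
      by (simp only: diff_conv_add_uminus)
    have X1: "real (card {a \<in> A. a + ?x \<in> B}) \<ge> real (card A) - \<alpha> / 1000 * n"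
      using card_translate_stable[OF B(1) A(1) st1] by (simp add: n_def)
    have X2: "real (card {a \<in> A. a - ?x \<in> B}) \<ge> real (card A) - \<alpha> / 1000 * n"
      using card_translate_stable[OF B(1) A(1) st2] unfolding n_def seq .
    have X3: "real (card {b \<in> B. b - ?x \<in> B}) \<ge> n - \<alpha> / 1000 * n"
      using card_translate_stable[OF B(1) order_refl st2] unfolding n_def seq .
    have Y1: "card {a \<in> A. a + ?x \<in> B} \<le> card A" "card {a \<in> A. a - ?x \<in> B} \<le> card A" "card {b \<in> B. b - ?x \<in> B} \<le> card B"
      using finA B by (auto intro: card_mono)
    have eq: "corr ?x = real (diff_count A ?x) - \<alpha> * real (card {a \<in> A. a - ?x \<in> B}) - \<alpha> * real (card {a \<in> A. a + ?x \<in> B}) + \<alpha>\<^sup>2 * real (card {b \<in> B. b - ?x \<in> B})"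
      unfolding corr_def split r s ..
    have cA': "real (card A) = \<alpha> * n" using \<alpha> by (simp add: n_def)
    have c': "\<alpha> * (\<alpha> * n) = c" by (simp add: c_def power2_eq_square)
    have L1: "\<alpha> * real (card {a \<in> A. a - ?x \<in> B}) \<ge> \<alpha> * (\<alpha> * n - \<alpha> / 1000 * n)" using X2 \<alpha>0 cA' by (intro mult_left_mono) auto
    have L2: "\<alpha> * real (card {a \<in> A. a + ?x \<in> B}) \<ge> \<alpha> * (\<alpha> * n - \<alpha> / 1000 * n)" using X1 \<alpha>0 cA' by (intro mult_left_mono) auto
    have L3: "\<alpha>\<^sup>2 * real (card {b \<in> B. b - ?x \<in> B}) \<ge> \<alpha>\<^sup>2 * (n - \<alpha> / 1000 * n)" using X3 by (intro mult_left_mono) auto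
    have M1: "\<alpha> * real (card {a \<in> A. a - ?x \<in> B}) \<le> \<alpha> * (\<alpha> * n)" using Y1 \<alpha>0 cA' by (intro mult_left_mono) auto
    have M2: "\<alpha> * real (card {a \<in> A. a + ?x \<in> B}) \<le> \<alpha> * (\<alpha> * n)" using Y1 \<alpha>0 cA' by (intro mult_left_mono) auto
    have M3: "\<alpha>\<^sup>2 * real (card {b \<in> B. b - ?x \<in> B}) \<le> \<alpha>\<^sup>2 * n" using Y1 by (intro mult_left_mono) (auto simp: n_def)
    have e1: "\<alpha> * (\<alpha> * n - \<alpha> / 1000 * n) = 999/1000 * c" by (simp add: c_def power2_eq_square algebra_simps)
    have e3: "\<alpha>\<^sup>2 * (n - \<alpha> / 1000 * n) \<ge> 999/1000 * c"
    proof -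
      have "\<alpha>\<^sup>2 * (n - \<alpha> / 1000 * n) = c * (1 - \<alpha> / 1000)" by (simp add: c_def algebra_simps)
      also have "\<dots> \<ge> c * (999/1000)" using \<alpha>1 c0 by (intro mult_left_mono) auto
      finally show ?thesis by simp
    qed
    have up: "corr ?x + c \<le> real (diff_count A ?x) + c / 500"
      using eq L1 L2 M3 e1 c_def by linarith
    have lo: "corr ?x + c \<ge> real (diff_count A ?x) - c / 500"
      using eq L3 M1 M2 e3 c' c0 by linarith
    have "1 + corr ?x / c = (corr ?x + c) / c" using c0 by (simp add: field_simps)
    moreover have "(corr ?x + c) / c \<le> (real (diff_count A ?x) + c / 500) / c" using up c0 by (intro divide_right_mono) auto
    moreover have "(corr ?x + c) / c \<ge> (real (diff_count A ?x) - c / 500) / c" using lo c0 by (intro divide_right_mono) auto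
    ultimately have "1 + corr ?x / c \<le> T ?x + 1/500" "1 + corr ?x / c \<ge> T ?x - 1/500"
      using c0 by (auto simp: T_def add_divide_distrib diff_divide_distrib)
    then show ?thesis using T0[of ?x] by linarith
  qed
  have expand: "(\<Sum>e\<in>E. \<Sum>d\<in>E. (1 + corr (e - d) / c) ^ q) = (\<Sum>k\<le>q. real (q choose k) * (U k / c ^ k))"
  proof -
    have "(1 + x) ^ q = (\<Sum>k\<le>q. real (q choose k) * x ^ k)" for x :: real
      using binomial_ring[of x 1 q] by (simp add: add.commute)
    then have "(\<Sum>e\<in>E. \<Sum>d\<in>E. (1 + corr (e - d) / c) ^ q) = (\<Sum>e\<in>E. \<Sum>d\<in>E. \<Sum>k\<le>q. real (q choose k) * (corr (e - d) / c) ^ k)"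
      by simp
    also have "\<dots> = (\<Sum>e\<in>E. \<Sum>k\<le>q. \<Sum>d\<in>E. real (q choose k) * (corr (e - d) / c) ^ k)"
      by (intro sum.cong refl sum.swap)
    also have "\<dots> = (\<Sum>k\<le>q. \<Sum>e\<in>E. \<Sum>d\<in>E. real (q choose k) * (corr (e - d) / c) ^ k)" by (rule sum.swap)
    also have "\<dots> = (\<Sum>k\<le>q. real (q choose k) * (U k / c ^ k))"
      by (simp add: U_def sum_distrib_left sum_divide_distrib power_divide)
    finally show ?thesis .
  qed
  have lower: "2 ^ p * real (card E) ^ 2 \<le> (\<Sum>e\<in>E. \<Sum>d\<in>E. (1 + corr (e - d) / c) ^ q)"
  proof -
    have "8 ^ p = (real q / real p) ^ p" using p by (simp add: q_def)
    also have "\<dots> \<le> real (q choose p)" unfolding q_def by (rule binomial_ge_n_over_k_pow_k) simp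
    finally have b: "8 ^ p \<le> real (q choose p)" .
    have "2 ^ p * real (card E) ^ 2 = 8 ^ p * ((1/4) ^ p * real (card E) ^ 2)"
      by (simp flip: power_mult_distrib mult.assoc)
    also have "\<dots> \<le> real (q choose p) * (U p / c ^ p)"
    proof (rule mult_mono[OF b])
      show "(1/4) ^ p * real (card E) ^ 2 \<le> U p / c ^ p"
        using \<open>U p \<ge> (1/4) ^ p * c ^ p * real (card E) ^ 2\<close> c0 by (simp add: pos_le_divide_eq mult.commute mult.left_commute)
    qed auto
    also have "\<dots> \<le> (\<Sum>k\<le>q. real (q choose k) * (U k / c ^ k))"
      using U0 c0 by (intro member_le_sum) (auto simp: q_def)
    finally show ?thesis unfolding expand .
  qed
  have upper: "(\<Sum>e\<in>E. \<Sum>d\<in>E. (1 + corr (e - d) / c) ^ q) \<le> (501/500) ^ q * (real (card E) ^ 2 + (\<Sum>e\<in>E. \<Sum>d\<in>E. T (e - d) ^ q))"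
  proof -
    \<comment> \<open>Comparing with \<open>max 1 T\<close> turns the additive error into the factor
      \<open>501/500\<close>, at the price of the summand 1.\<close>
    have "(1 + corr (e - d) / c) ^ q \<le> (501/500) ^ q * (1 + T (e - d) ^ q)" if "e \<in> E" "d \<in> E" for e d
    proof -
      let ?t = "T (e - d)"
      have "(1 + corr (e - d) / c) ^ q \<le> \<bar>1 + corr (e - d) / c\<bar> ^ q" by (metis abs_ge_self power_abs)
      also have "\<dots> \<le> (?t + 1/500) ^ q" using close[OF that] by (intro power_mono) auto
      also have "\<dots> \<le> ((501/500) * max 1 ?t) ^ q" using T0[of "e - d"] by (intro power_mono) auto
      also have "\<dots> \<le> (501/500) ^ q * (1 + ?t ^ q)"
        using T0[of "e - d"] unfolding power_mult_distrib by (intro mult_left_mono) (auto simp: max_def)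
      finally show ?thesis .
    qed
    then have "(\<Sum>e\<in>E. \<Sum>d\<in>E. (1 + corr (e - d) / c) ^ q) \<le> (\<Sum>e\<in>E. \<Sum>d\<in>E. (501/500) ^ q * (1 + T (e - d) ^ q))"
      by (intro sum_mono)
    also have "\<dots> = (501/500) ^ q * (real (card E) ^ 2 + (\<Sum>e\<in>E. \<Sum>d\<in>E. T (e - d) ^ q))"
      by (simp add: sum_distrib_left[symmetric] sum.distrib power2_eq_square)
    finally show ?thesis .
  qed
  define Z where "Z = (\<Sum>e\<in>E. \<Sum>d\<in>E. T (e - d) ^ q)"
  have Z0: "Z \<ge> 0" unfolding Z_def by (intro sum_nonneg zero_le_power T0)
  have "2 ^ p * real (card E) ^ 2 \<le> (501/500) ^ q * (real (card E) ^ 2 + Z)"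
    using lower upper by (simp add: Z_def)
  also have "\<dots> \<le> (1017/1000) ^ p * (real (card E) ^ 2 + Z)"
  proof (rule mult_right_mono)
    have "((501/500 :: real) ^ 8) ^ p \<le> (1017/1000) ^ p" by (intro power_mono) (simp_all add: power_divide)
    then show "(501/500 :: real) ^ q \<le> (1017/1000) ^ p" by (simp add: q_def power_mult)
  qed (use Z0 in simp)
  finally have key: "2 ^ p * real (card E) ^ 2 \<le> (1017/1000) ^ p * (real (card E) ^ 2 + Z)" .
  \<comment> \<open>Numerically \<open>1017/1000 * 37/20 * 21/20\<close> is below 2, and
    \<open>(21/20) ^ p\<close> is at least 2, which pays for the summand 1.\<close>
  have num: "(1017/1000) ^ p * ((37/20) ^ p + 1) \<le> (2 :: real) ^ p"
  proof -
    have "1 + real p * (1/20) \<le> (1 + 1/20) ^ p" by (rule Bernoulli_inequality) simp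
    then have b: "(21/20 :: real) ^ p \<ge> 2" using p(2) by simp
    have "(37/20) ^ p + 1 \<le> (37/20) ^ p * (2 :: real)" using one_le_power[of "37/20 :: real" p] by simp
    also have "\<dots> \<le> (37/20) ^ p * (21/20) ^ p" using b by (intro mult_left_mono) auto
    finally have "(1017/1000) ^ p * ((37/20) ^ p + 1) \<le> (1017/1000) ^ p * ((37/20) ^ p * (21/20 :: real) ^ p)"
      by (intro mult_left_mono) auto
    also have "\<dots> = (1017/1000 * (37/20 * (21/20))) ^ p" by (simp only: power_mult_distrib)
    also have "\<dots> \<le> 2 ^ p" by (intro power_mono) auto
    finally show ?thesis .
  qed
  have "(1017/1000) ^ p * (((37/20) ^ p + 1) * real (card E) ^ 2) \<le> 2 ^ p * real (card E) ^ 2"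
    using num unfolding mult.assoc[symmetric] by (intro mult_right_mono) auto
  also note key
  finally have "((37/20) ^ p + 1) * real (card E) ^ 2 \<le> real (card E) ^ 2 + Z"
    by simp
  then have "(37/20) ^ p * real (card E) ^ 2 \<le> Z" by (simp add: algebra_simps)
  then show ?thesis unfolding ca Z_def T_def q_def .
qed

text \<open>Sifting for the bipartite graph joining \<open>e\<close> to \<open>s\<close> when
  \<open>e - s\<close> lies in \<open>A\<close>: every \<open>e\<close> has \<open>card A\<close>
  neighbours, and \<open>e\<close>, \<open>d\<close> have \<open>diff_count A (e - d)\<close> common
  ones. Bad pairs contribute little to the moment because \<open>(53/50) ^ 8 \<le> 8/5\<close>,
  below \<open>37/20\<close>.\<close>

lemma sifted_set:
  fixes A E :: "int set" and \<alpha> :: real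
  assumes A: "finite A" "A \<noteq> {}" and E: "finite E" "E \<noteq> {}" and \<alpha>: "\<alpha> > 0" and p: "p \<ge> 100"
    and moment: "(\<Sum>e\<in>E. \<Sum>d\<in>E. (real (diff_count A (e - d)) / (\<alpha> * real (card A))) ^ (8 * p)) \<ge> (37/20) ^ p * real (card E) ^ 2"
  shows "\<exists>D\<subseteq>E. real (card D) \<ge> \<alpha> ^ (8 * p) * real (card E) \<and>
    1000 * real (card {(a, b) \<in> D \<times> D. \<not> 53/50 * (\<alpha> * real (card A)) \<le> real (diff_count A (a - b))}) \<le> real (card D) ^ 2"
proof -
  define c where "c = \<alpha> * real (card A)"
  have cA: "card A > 0" using A by (simp add: card_gt_0_iff)
  have c0: "c > 0" using \<alpha> cA by (simp add: c_def)
  define q where "q = 8 * p"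
  define R where "R = (\<lambda>(e, a). e - a) ` (E \<times> A)"
  have finR: "finite R" using A E by (auto simp: R_def)
  have r: "card {s \<in> R. e - s \<in> A \<and> d - s \<in> A} = diff_count A (e - d)" if "e \<in> E" "d \<in> E" for e d
    unfolding diff_count_def
    by (rule bij_betw_same_card[of "\<lambda>s. d - s"], rule bij_betw_byWitness[of _ "\<lambda>s. d - s"])
      (use that in \<open>force simp: R_def algebra_simps\<close>)+
  have K: "card {s \<in> R. e - s \<in> A} = card A" if "e \<in> E" for e
    by (rule bij_betw_same_card[of "\<lambda>s. e - s"], rule bij_betw_byWitness[of _ "\<lambda>s. e - s"])
      (use that in \<open>force simp: R_def algebra_simps\<close>)+
  define W where "W = (\<Sum>e\<in>E. \<Sum>d\<in>E. real (diff_count A (e - d)) ^ q)"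
  have cE: "card E > 0" using E by (simp add: card_gt_0_iff)
  have Wlow: "W \<ge> c ^ q * ((37/20) ^ p * real (card E) ^ 2)"
  proof -
    have "W = c ^ q * (\<Sum>e\<in>E. \<Sum>d\<in>E. (real (diff_count A (e - d)) / c) ^ q)"
      using c0 by (simp add: W_def sum_distrib_left power_divide)
    moreover have "\<dots> \<ge> c ^ q * ((37/20) ^ p * real (card E) ^ 2)"
      using moment c0 by (intro mult_left_mono) (auto simp: c_def q_def)
    ultimately show ?thesis by simp
  qed
  have W0: "W > 0" using c0 cE by (intro less_le_trans[OF _ Wlow]) simp
  \<comment> \<open>Here \<open>p \<ge> 100\<close> matters: \<open>8/5 * 23/20\<close> is still
    below \<open>37/20\<close>, and \<open>(23/20) ^ 100\<close> exceeds 4000.\<close>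
  have num: "4000 * (8/5) ^ p \<le> (37/20 :: real) ^ p"
  proof -
    have "(4000 :: real) \<le> (23/20) ^ 100" by (simp add: power_divide)
    also have "\<dots> \<le> (23/20) ^ p" using p by (intro power_increasing) auto
    finally have "4000 * (8/5) ^ p \<le> (23/20) ^ p * (8/5 :: real) ^ p" by (intro mult_right_mono) auto
    also have "\<dots> = (46/25) ^ p" unfolding power_mult_distrib[symmetric] by simp
    also have "\<dots> \<le> (37/20) ^ p" by (intro power_mono) auto
    finally show ?thesis .
  qed
  have "\<exists>D\<subseteq>E. real (card D) \<ge> \<alpha> ^ q * real (card E) \<and>
    1000 * real (card {(a, b) \<in> D \<times> D. \<not> 53/50 * c \<le> real (diff_count A (a - b))}) \<le> real (card D) ^ 2"
  proof (rule sifting[where P="\<lambda>e s. e - s \<in> A" and R=R and K="real (card A)" and q=q and W=W])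
    show "W = (\<Sum>e\<in>E. \<Sum>d\<in>E. real (card {s \<in> R. e - s \<in> A \<and> d - s \<in> A}) ^ q)"
      unfolding W_def by (intro sum.cong refl) (simp add: r)
    have "4000 * (\<Sum>e\<in>E. \<Sum>d\<in>E. of_bool (\<not> 53/50 * c \<le> real (diff_count A (e - d))) * real (card {s \<in> R. e - s \<in> A \<and> d - s \<in> A}) ^ q)
      \<le> 4000 * (\<Sum>e\<in>E. \<Sum>d\<in>E. (53/50 * c) ^ q)"
    proof (intro mult_left_mono sum_mono)
      fix e d assume "e \<in> E" "d \<in> E"
      have "of_bool (\<not> 53/50 * c \<le> z) * z ^ q \<le> (53/50 * c) ^ q" if "z \<ge> 0" for z :: real
        using that c0 by (cases "53/50 * c \<le> z") (auto intro: power_mono)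
      then show "of_bool (\<not> 53/50 * c \<le> real (diff_count A (e - d))) * real (card {s \<in> R. e - s \<in> A \<and> d - s \<in> A}) ^ q \<le> (53/50 * c) ^ q"
        unfolding r[OF \<open>e \<in> E\<close> \<open>d \<in> E\<close>] by simp
    qed simp
    also have "\<dots> = 4000 * (53/50) ^ q * (c ^ q * real (card E) ^ 2)"
      unfolding power_mult_distrib by (simp add: power2_eq_square)
    also have "\<dots> \<le> (37/20) ^ p * (c ^ q * real (card E) ^ 2)"
    proof (rule mult_right_mono)
      have "((53/50 :: real) ^ 8) ^ p \<le> (8/5) ^ p" by (intro power_mono) (simp_all add: power_divide)
      then show "4000 * (53/50) ^ q \<le> (37/20 :: real) ^ p" using num by (simp add: q_def power_mult)
    qed (use c0 in simp)
    also have "\<dots> \<le> W" using Wlow by (simp add: mult_ac)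
    finally show "4000 * (\<Sum>e\<in>E. \<Sum>d\<in>E. of_bool (\<not> 53/50 * c \<le> real (diff_count A (e - d))) * real (card {s \<in> R. e - s \<in> A \<and> d - s \<in> A}) ^ q) \<le> W" .
    \<comment> \<open>For \<open>\<tau> = \<alpha> ^ q\<close> this term is four times the moment of
      an autocorrelation constantly equal to its expected value \<open>c\<close>.\<close>
    have "4 * (\<alpha> ^ q * real (card E) ^ 2 * real (card A) ^ q) = 4 * (c ^ q * real (card E) ^ 2)"
      by (simp add: c_def power_mult_distrib)
    also have "\<dots> \<le> (37/20) ^ p * (c ^ q * real (card E) ^ 2)"
    proof (rule mult_right_mono)
      have "1 \<le> (8/5 :: real) ^ p" by (rule one_le_power) simp
      then have "(4 :: real) \<le> 4000 * (8/5) ^ p" by linarith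
      then show "4 \<le> (37/20 :: real) ^ p" using num by linarith
    qed (use c0 in simp)
    also have "\<dots> \<le> W" using Wlow by (simp add: mult_ac)
    finally show "4 * (\<alpha> ^ q * real (card E) ^ 2 * real (card A) ^ q) \<le> W" .
  qed (use E finR K W0 \<alpha> in auto)
  then show ?thesis unfolding q_def c_def .
qed

text \<open>The autocorrelation of \<open>A\<close> is averaged over \<open>D - D\<close> plus
  \<open>k\<close> differences from \<open>X\<close>; almost periodicity keeps this average large.
  The transform of the averaging measure is tiny off the half-spectrum of \<open>X\<close>, while on
  it Chang's theorem makes the characters almost constant along \<open>V\<close>. So shifting by
  \<open>z\<close> in \<open>V\<close> hardly changes the average, and averaging over
  \<open>V\<close> yields a dense translate. \<open>V\<close> is quantified after \<Lambda> because
  it will be a Bohr set built from \<Lambda>.\<close>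

lemma density_increment_of_sifted:
  fixes A D T Wd Y G H :: "int set" and \<alpha> \<sigma> :: real
  assumes A: "finite A" "A \<noteq> {}" and \<alpha>: "\<alpha> > 0"
    and D: "finite D" "D \<noteq> {}"
    and sifted: "1000 * real (card {(a, b) \<in> D \<times> D. \<not> 53/50 * (\<alpha> * real (card A)) \<le> real (diff_count A (a - b))}) \<le> real (card D) ^ 2"
    and T: "finite T" "T \<noteq> {}"
    and Wd: "finite Wd" "\<And>b t. b \<in> D \<Longrightarrow> t \<in> T \<Longrightarrow> b - t \<in> Wd"
    and \<sigma>: "\<sigma> > 0" "\<sigma> * real (card Wd) \<le> 2 * real (card D)" "\<sigma> * real (card Y) \<le> 2 * real (card D)"
    and Y: "finite Y" "\<And>a t t' j. a \<in> D \<Longrightarrow> j \<le> k \<Longrightarrow> (\<And>i. i < k \<Longrightarrow> t i \<in> T \<and> t' i \<in> T) \<Longrightarrow> a + (\<Sum>i<j. t i - t' i) \<in> Y"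
    and k: "k > 0" "2 * (1/4) ^ k \<le> \<alpha> / 100"
    and m: "16 * exp (- (real m / (16000000 * real k ^ 2))) * real k / \<sigma> \<le> 1/1000" "m > 0"
    and GH: "finite G" "finite H" "H \<noteq> {}" "real (card G) \<le> 2 * real (card T)"
       "\<And>x h. x \<in> T \<Longrightarrow> h \<in> {..<M} \<rightarrow>\<^sub>E H \<Longrightarrow> x - (\<Sum>i<M. h i) \<in> G"
    and M: "16 * ln (8 * (2 / \<sigma>) ^ m) < real M"
  shows "\<exists>\<Lambda>. finite \<Lambda> \<and> card \<Lambda> \<le> M \<and>
    (\<forall>V. finite V \<and> V \<noteq> {} \<and> (\<forall>z\<in>V. (\<forall>\<phi>. norm (ft H \<phi>) > real (card H) / 2 \<longrightarrow> norm (1 - cis (\<phi> * of_int z)) \<le> \<alpha> / 200) \<and>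
       (\<forall>l\<in>\<Lambda>. norm (1 - cis (l * of_int z)) \<le> \<alpha> / (200 * real M))) \<longrightarrow>
      (\<exists>v. real (card {z \<in> V. v + z \<in> A}) \<ge> 26/25 * \<alpha> * real (card V)))"
proof -
  define c where "c = \<alpha> * real (card A)"
  have cA: "card A > 0" using A by (simp add: card_gt_0_iff)
  have c0: "c > 0" using \<alpha> cA by (simp add: c_def)
  have cD: "card D > 0" using D by (simp add: card_gt_0_iff)
  define S where "S = {x. 53/50 * c \<le> real (diff_count A x)}"
  \<comment> \<open>Then \<open>2 * k * \<epsilon> = 1/1000\<close>. The exceptional points cost as
    much again, so the proportion falls from \<open>999/1000\<close> to \<open>997/1000\<close>, and
    \<open>53/50 * 997/1000\<close> is still at least \<open>21/20\<close>.\<close>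
  define \<epsilon> where "\<epsilon> = 1 / (2000 * real k)"
  have \<epsilon>: "0 < \<epsilon>" "\<epsilon> \<le> 1" using k by (auto simp: \<epsilon>_def field_simps)
  from croot_sisask[OF D T Y(1) Wd \<epsilon> m(2), where S=S]
  obtain X g where X: "X \<subseteq> T" "real (card X) \<ge> (real (card D) / real (card Wd)) ^ m * real (card T) / 2"
    "\<And>t. t \<in> X \<Longrightarrow> real (card {x \<in> Y. \<bar>density_of D S x - g (x - t)\<bar> > \<epsilon>}) \<le> 4 * exp (- (real m * \<epsilon>\<^sup>2 / 4)) * real (card Y)"
    by blast
  have finX: "finite X" using X T finite_subset by blast
  have "Wd \<noteq> {}" using Wd D T by blast
  then have cW: "card Wd > 0" using Wd by (simp add: card_gt_0_iff)
  have cT: "card T > 0" using T by (simp add: card_gt_0_iff)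
  have Xlow: "real (card X) \<ge> (\<sigma> / 2) ^ m * real (card T) / 2"
  proof -
    have "\<sigma> / 2 \<le> real (card D) / real (card Wd)" using \<sigma>(2) cW by (simp add: field_simps)
    then have "(\<sigma> / 2) ^ m \<le> (real (card D) / real (card Wd)) ^ m" using \<sigma>(1) by (intro power_mono) auto
    then have "(\<sigma> / 2) ^ m * real (card T) / 2 \<le> (real (card D) / real (card Wd)) ^ m * real (card T) / 2"
      by (intro divide_right_mono mult_right_mono) auto
    then show ?thesis using X(2) by linarith
  qed
  have cX: "real (card X) > 0" using \<sigma>(1) cT by (intro less_le_trans[OF _ Xlow]) simp
  then have neX: "X \<noteq> {}" by auto
  define \<beta> where "\<beta> = 4 * exp (- (real m * \<epsilon>\<^sup>2 / 4)) * real (card Y)"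
  have \<beta>: "2 * real k * \<beta> \<le> real (card D) / 1000"
  proof -
    have "real m * \<epsilon>\<^sup>2 / 4 = real m / (16000000 * real k ^ 2)" by (simp add: \<epsilon>_def power_divide power_mult_distrib)
    then have "2 * real k * \<beta> = 8 * exp (- (real m / (16000000 * real k ^ 2))) * real k * real (card Y)"
      by (simp add: \<beta>_def)
    also have "\<dots> \<le> 8 * exp (- (real m / (16000000 * real k ^ 2))) * real k * (2 * real (card D) / \<sigma>)"
      using \<sigma> by (intro mult_left_mono) (auto simp: field_simps)
    also have "\<dots> = (16 * exp (- (real m / (16000000 * real k ^ 2))) * real k / \<sigma>) * real (card D)" by simp
    also have "\<dots> \<le> 1/1000 * real (card D)" using m(1) by (intro mult_right_mono) auto
    finally show ?thesis by simp
  qed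
  have f_sum: "(\<Sum>a\<in>D. density_of D S (a + u)) * real (card D) = (\<Sum>a\<in>D. \<Sum>b\<in>D. of_bool (a - b + u \<in> S))" for u
  proof -
    have "density_of D S (a + u) * real (card D) = (\<Sum>b\<in>D. of_bool (a - b + u \<in> S))" for a
    proof -
      have "{b \<in> D. a + u - b \<in> S} = {b \<in> D. a - b + u \<in> S}" by (simp add: algebra_simps)
      then show ?thesis using cD D by (simp add: density_of_def sum_of_bool_eq Int_def)
    qed
    then show ?thesis by (simp add: sum_distrib_right)
  qed
  have f0: "(\<Sum>a\<in>D. density_of D S a) \<ge> 999/1000 * real (card D)"
  proof -
    have "(\<Sum>a\<in>D. \<Sum>b\<in>D. of_bool (a - b \<in> S)) = (\<Sum>(a, b)\<in>D \<times> D. of_bool (a - b \<in> S) :: real)" by (rule sum.cartesian_product)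
    also have "\<dots> = (\<Sum>p\<in>D \<times> D. 1 - of_bool (fst p - snd p \<notin> S))" by (intro sum.cong refl) auto
    also have "\<dots> = real (card D) ^ 2 - real (card {p \<in> D \<times> D. fst p - snd p \<notin> S})"
      using D by (simp add: sum_subtractf sum_of_bool_eq Int_def power2_eq_square)
    also have "{p \<in> D \<times> D. fst p - snd p \<notin> S} = {(a, b) \<in> D \<times> D. \<not> 53/50 * (\<alpha> * real (card A)) \<le> real (diff_count A (a - b))}"
      by (auto simp: S_def c_def)
    finally have "(\<Sum>a\<in>D. density_of D S a) * real (card D) \<ge> (999/1000 * real (card D)) * real (card D)"
      using sifted f_sum[of 0] by (simp add: power2_eq_square)
    then show ?thesis using cD by simp
  qed
  define F where "F = {..<k} \<rightarrow>\<^sub>E X \<times> X"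
  have finF: "finite F" unfolding F_def using finX by (intro finite_PiE) auto
  have neF: "F \<noteq> {}" using neX by (auto simp: F_def PiE_eq_empty_iff)
  define us where "us t = (\<Sum>i<k. fst (t i) - snd (t i))" for t :: "nat \<Rightarrow> int \<times> int"
  \<comment> \<open>Representations are indexed with multiplicity, so that sums over
    \<open>I\<close> are convolutions and the transform factors in \<open>S_ft\<close>.\<close>
  define I where "I = (D \<times> D) \<times> F"
  define u where "u = (\<lambda>((a, b), t). a - b + us t)"
  have finI: "finite I" using D finF by (simp add: I_def)
  have cI: "real (card I) = real (card D) ^ 2 * real (card F)" by (simp add: I_def card_cartesian_product power2_eq_square)
  have cF: "card F = (card X * card X) ^ k" by (simp add: F_def card_PiE card_cartesian_product)
  have cI0: "real (card I) > 0" using cD cX by (simp add: cI cF)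
  have shift: "(\<Sum>a\<in>D. \<Sum>b\<in>D. real (diff_count A (a - b + us t))) \<ge> 21/20 * c * real (card D) ^ 2" if t: "t \<in> F" for t
  proof -
    have tX: "fst (t i) \<in> X \<and> snd (t i) \<in> X" if "i < k" for i
      using t that by (auto simp: F_def PiE_def Pi_def mem_Times_iff)
    have "(\<Sum>a\<in>D. density_of D S (a + us t)) \<ge> (\<Sum>a\<in>D. density_of D S a) - 2 * real k * \<epsilon> * real (card D) - 2 * real k * \<beta>"
      unfolding us_def
    proof (rule almost_period_sum[OF D(1) Y(1) less_imp_le[OF \<epsilon>(1)], where X=X and g=g])
      show "real (card {x \<in> Y. \<epsilon> < \<bar>density_of D S x - g (x - t)\<bar>}) \<le> \<beta>" if "t \<in> X" for t
        using X(3)[OF that] by (simp add: \<beta>_def)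
      show "fst (t i) \<in> X \<and> snd (t i) \<in> X" if "i < k" for i by (rule tX[OF that])
      show "a + (\<Sum>i<j. fst (t i) - snd (t i)) \<in> Y" if "a \<in> D" "j \<le> k" for a j
        using Y(2)[OF that, of "\<lambda>i. fst (t i)" "\<lambda>i. snd (t i)"] tX X(1) by blast
    qed
    moreover have "2 * real k * \<epsilon> = 1/1000" using k by (simp add: \<epsilon>_def)
    ultimately have "(\<Sum>a\<in>D. density_of D S (a + us t)) \<ge> 997/1000 * real (card D)"
      using f0 \<beta> by simp
    then have "997/1000 * real (card D) * real (card D) \<le> (\<Sum>a\<in>D. density_of D S (a + us t)) * real (card D)"
      by (intro mult_right_mono) auto
    then have "53/50 * c * (997/1000 * real (card D) * real (card D)) \<le> 53/50 * c * (\<Sum>a\<in>D. \<Sum>b\<in>D. of_bool (a - b + us t \<in> S))"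
      unfolding f_sum using c0 by (intro mult_left_mono) auto
    also have "\<dots> \<le> (\<Sum>a\<in>D. \<Sum>b\<in>D. real (diff_count A (a - b + us t)))"
      unfolding sum_distrib_left by (intro sum_mono) (auto simp: S_def of_bool_def)
    finally have "53/50 * c * (997/1000 * real (card D) * real (card D)) \<le> (\<Sum>a\<in>D. \<Sum>b\<in>D. real (diff_count A (a - b + us t)))" .
    moreover have "21/20 * c * real (card D) ^ 2 \<le> 53/50 * c * (997/1000 * real (card D) * real (card D))"
      using c0 by (simp add: power2_eq_square)
    ultimately show ?thesis by linarith
  qed
  have Q0: "(\<Sum>i\<in>I. real (diff_count A (u i))) \<ge> 21/20 * c * real (card I)"
  proof -
    have "(\<Sum>i\<in>I. real (diff_count A (u i))) = (\<Sum>p\<in>D \<times> D. \<Sum>t\<in>F. real (diff_count A (fst p - snd p + us t)))"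
      by (simp add: I_def u_def sum.cartesian_product case_prod_unfold)
    also have "\<dots> = (\<Sum>t\<in>F. \<Sum>p\<in>D \<times> D. real (diff_count A (fst p - snd p + us t)))"
      by (rule sum.swap)
    also have "\<dots> = (\<Sum>t\<in>F. \<Sum>a\<in>D. \<Sum>b\<in>D. real (diff_count A (a - b + us t)))"
      by (simp add: sum.cartesian_product case_prod_unfold)
    also have "\<dots> \<ge> (\<Sum>t\<in>F. 21/20 * c * real (card D) ^ 2)" by (intro sum_mono shift)
    finally show ?thesis by (simp add: cI mult_ac)
  qed
  have S_ft: "(\<Sum>i\<in>I. cis (\<theta> * of_int (u i))) = (ft D \<theta> * cnj (ft D \<theta>)) * (ft X \<theta> * cnj (ft X \<theta>)) ^ k" for \<theta>
  proof -
    have DD: "(\<Sum>p\<in>P \<times> P. cis (\<theta> * of_int (fst p - snd p))) = ft P \<theta> * cnj (ft P \<theta>)" for P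
      unfolding ft_uminus[symmetric]
      unfolding ft_def sum_product sum.cartesian_product
      by (intro sum.cong refl) (auto simp: cis_mult algebra_simps)
    have "(\<Sum>i\<in>I. cis (\<theta> * of_int (u i))) = (\<Sum>p\<in>D \<times> D. \<Sum>t\<in>F. cis (\<theta> * of_int (fst p - snd p + us t)))"
      by (simp add: I_def u_def sum.cartesian_product case_prod_unfold)
    also have "\<dots> = (\<Sum>p\<in>D \<times> D. cis (\<theta> * of_int (fst p - snd p))) * (\<Sum>t\<in>F. cis (\<theta> * of_int (us t)))"
      unfolding sum_product by (intro sum.cong refl) (simp add: cis_mult algebra_simps)
    also have "(\<Sum>t\<in>F. cis (\<theta> * of_int (us t))) = (\<Sum>t\<in>F. \<Prod>i<k. cis (\<theta> * of_int (fst (t i) - snd (t i))))"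
      unfolding us_def cis_of_int_sum ..
    also have "\<dots> = (\<Sum>p\<in>X \<times> X. cis (\<theta> * of_int (fst p - snd p))) ^ k"
      unfolding F_def using finX by (subst sum_power_PiE) auto
    finally show ?thesis unfolding DD .
  qed
  have norm_S: "norm (\<Sum>i\<in>I. cis (\<theta> * of_int (u i))) = norm (ft D \<theta>) ^ 2 * (norm (ft X \<theta>) ^ 2) ^ k" for \<theta>
    unfolding S_ft norm_mult norm_power complex_mod_cnj by (simp add: power2_eq_square)
  have "\<exists>\<Lambda>. finite \<Lambda> \<and> card \<Lambda> \<le> M \<and>
    (\<forall>\<theta>. norm (ft X \<theta>) \<ge> real (card X) / 2 \<longrightarrow> (\<exists>\<phi>. norm (ft H \<phi>) > real (card H) / 2 \<and>
       (\<forall>x. norm (1 - cis (\<theta> * of_int x)) \<le> norm (1 - cis (\<phi> * of_int x)) + (\<Sum>l\<in>\<Lambda>. norm (1 - cis (l * of_int x))))))"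
  proof (rule chang[OF finX GH(1,2) neX GH(3)])
    show "x - (\<Sum>i<M. h i) \<in> G" if "x \<in> X" "h \<in> {..<M} \<rightarrow>\<^sub>E H" for x h
      using GH(5) X(1) that by blast
    \<comment> \<open>The argument of the logarithm in \<open>M\<close> arises from
      \<open>Xlow\<close> and \<open>card G \<le> 2 * card T\<close>.\<close>
    have "2 * real (card G) / real (card X) \<le> 2 * (2 * real (card T)) / ((\<sigma> / 2) ^ m * real (card T) / 2)"
      using GH(4) Xlow \<sigma>(1) cT by (intro frac_le) auto
    also have "\<dots> = 8 * (2 / \<sigma>) ^ m" using cT \<sigma>(1) by (simp add: power_divide field_simps)
    finally have le: "2 * real (card G) / real (card X) \<le> 8 * (2 / \<sigma>) ^ m" .
    have "card G > 0"
    proof -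
      obtain x where "x \<in> X" using neX by blast
      obtain h0 where "h0 \<in> H" using GH(3) by blast
      then have "(\<lambda>i\<in>{..<M}. h0) \<in> {..<M} \<rightarrow>\<^sub>E H" by auto
      then have "G \<noteq> {}" using GH(5) X(1) \<open>x \<in> X\<close> by blast
      then show ?thesis using GH(1) by (simp add: card_gt_0_iff)
    qed
    then have "ln (2 * real (card G) / real (card X)) \<le> ln (8 * (2 / \<sigma>) ^ m)"
      using le cX by (intro ln_mono) auto
    then show "16 * ln (2 * real (card G) / real (card X)) < real M" using M by linarith
  qed
  then obtain \<Lambda> where \<Lambda>: "finite \<Lambda>" "card \<Lambda> \<le> M"
    "\<And>\<theta>. norm (ft X \<theta>) \<ge> real (card X) / 2 \<Longrightarrow> (\<exists>\<phi>. norm (ft H \<phi>) > real (card H) / 2 \<and>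
       (\<forall>x. norm (1 - cis (\<theta> * of_int x)) \<le> norm (1 - cis (\<phi> * of_int x)) + (\<Sum>l\<in>\<Lambda>. norm (1 - cis (l * of_int x)))))"
    by blast
  have "\<exists>v. real (card {z \<in> V. v + z \<in> A}) \<ge> 26/25 * \<alpha> * real (card V)"
    if V: "finite V" "V \<noteq> {}" and
      V1: "\<And>z \<phi>. z \<in> V \<Longrightarrow> norm (ft H \<phi>) > real (card H) / 2 \<Longrightarrow> norm (1 - cis (\<phi> * of_int z)) \<le> \<alpha> / 200" and
      V2: "\<And>z l. z \<in> V \<Longrightarrow> l \<in> \<Lambda> \<Longrightarrow> norm (1 - cis (l * of_int z)) \<le> \<alpha> / (200 * real M)" for V
  proof -
    \<comment> \<open>The allowed relative loss of \<open>1/100\<close> lowers the factor from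
      \<open>21/20\<close> to \<open>26/25\<close>.\<close>
    have Qz: "(\<Sum>i\<in>I. real (diff_count A (u i + z))) \<ge> 26/25 * c * real (card I)" if z: "z \<in> V" for z
    proof -
      have "(\<Sum>i\<in>I. real (diff_count A (u i + z))) \<ge> (\<Sum>i\<in>I. real (diff_count A (u i))) - (\<alpha> / 100 * real (card I)) * real (card A)"
      proof (rule diff_count_shift[OF A(1) finI])
        fix \<theta>
        have Dn: "norm (ft D \<theta>) ^ 2 \<le> real (card D) ^ 2" by (intro power_mono norm_ft_le) auto
        show "norm (\<Sum>i\<in>I. cis (\<theta> * of_int (u i))) * norm (1 - cis (\<theta> * of_int z)) \<le> \<alpha> / 100 * real (card I)"
        proof (cases "norm (ft X \<theta>) \<ge> real (card X) / 2")
          case True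
          from \<Lambda>(3)[OF True] obtain \<phi> where \<phi>: "norm (ft H \<phi>) > real (card H) / 2"
            "norm (1 - cis (\<theta> * of_int z)) \<le> norm (1 - cis (\<phi> * of_int z)) + (\<Sum>l\<in>\<Lambda>. norm (1 - cis (l * of_int z)))" by blast
          have "(\<Sum>l\<in>\<Lambda>. norm (1 - cis (l * of_int z))) \<le> (\<Sum>l\<in>\<Lambda>. \<alpha> / (200 * real M))"
            using V2 z by (intro sum_mono) auto
          also have "\<dots> = real (card \<Lambda>) * (\<alpha> / (200 * real M))" by simp
          also have "\<dots> \<le> real M * (\<alpha> / (200 * real M))" using \<Lambda>(2) \<alpha> by (intro mult_right_mono) auto
          also have "\<dots> \<le> \<alpha> / 200" using \<alpha> by simp
          finally have 1: "norm (1 - cis (\<theta> * of_int z)) \<le> \<alpha> / 100" using \<phi> V1[OF z \<phi>(1)] by linarith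
          have "norm (\<Sum>i\<in>I. cis (\<theta> * of_int (u i))) \<le> real (card I)" by (rule order_trans[OF norm_sum]) simp
          then have "norm (\<Sum>i\<in>I. cis (\<theta> * of_int (u i))) * norm (1 - cis (\<theta> * of_int z)) \<le> real (card I) * (\<alpha> / 100)"
            using 1 by (intro mult_mono) auto
          then show ?thesis by (simp add: mult.commute)
        next
          case False
          \<comment> \<open>Each of the \<open>k\<close> differences saves a factor 4 here, and the
            total saving has to beat \<open>\<alpha> / 100\<close>.\<close>
          have "(norm (ft X \<theta>) ^ 2) ^ k \<le> ((real (card X) / 2) ^ 2) ^ k"
            using False by (intro power_mono) auto
          also have "\<dots> = (1/4) ^ k * real (card F)" by (simp add: cF power_divide power_mult_distrib power2_eq_square)
          finally have "norm (\<Sum>i\<in>I. cis (\<theta> * of_int (u i))) \<le> real (card D) ^ 2 * ((1/4) ^ k * real (card F))"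
            unfolding norm_S using Dn by (intro mult_mono) auto
          moreover have "norm (1 - cis (\<theta> * of_int z)) \<le> 2"
            using norm_triangle_ineq4[of 1 "cis (\<theta> * of_int z)"] by simp
          ultimately have "norm (\<Sum>i\<in>I. cis (\<theta> * of_int (u i))) * norm (1 - cis (\<theta> * of_int z)) \<le> (real (card D) ^ 2 * ((1/4) ^ k * real (card F))) * 2"
            by (intro mult_mono) auto
          also have "\<dots> = (2 * (1/4) ^ k) * real (card I)" by (simp add: cI)
          also have "\<dots> \<le> \<alpha> / 100 * real (card I)" using k by (intro mult_right_mono) auto
          finally show ?thesis .
        qed
      qed
      then show ?thesis using Q0 by (simp add: c_def algebra_simps)
    qed
    \<comment> \<open>Two pigeonhole choices, of \<open>i\<close> in \<open>I\<close> and then of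
      \<open>a\<close> in \<open>A\<close>, give the translate \<open>a + u i\<close>.\<close>
    have "26/25 * c * real (card V) * real (card I) = (\<Sum>z\<in>V. 26/25 * c * real (card I))" by simp
    also have "\<dots> \<le> (\<Sum>z\<in>V. \<Sum>i\<in>I. real (diff_count A (u i + z)))" by (intro sum_mono Qz)
    also have "\<dots> = (\<Sum>i\<in>I. \<Sum>z\<in>V. real (diff_count A (u i + z)))" by (rule sum.swap)
    finally have "26/25 * c * real (card V) * real (card I) \<le> (\<Sum>i\<in>I. \<Sum>z\<in>V. real (diff_count A (u i + z)))" .
    moreover have "I \<noteq> {}" using cI0 by auto
    ultimately obtain i where i: "i \<in> I" "26/25 * c * real (card V) * real (card I) / real (card I) \<le> (\<Sum>z\<in>V. real (diff_count A (u i + z)))"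
      using exists_ge_average[OF finI, of "26/25 * c * real (card V) * real (card I)" "\<lambda>i. \<Sum>z\<in>V. real (diff_count A (u i + z))"] by blast
    have "(\<Sum>z\<in>V. real (diff_count A (u i + z))) = (\<Sum>z\<in>V. \<Sum>a\<in>A. of_bool (a + (u i + z) \<in> A))"
      unfolding diff_count_def using A by (simp add: sum_of_bool_eq Int_def)
    also have "\<dots> = (\<Sum>a\<in>A. \<Sum>z\<in>V. of_bool (a + (u i + z) \<in> A))" by (rule sum.swap)
    also have "\<dots> = (\<Sum>a\<in>A. real (card {z \<in> V. (a + u i) + z \<in> A}))"
      using V by (simp add: sum_of_bool_eq Int_def add.assoc)
    finally have "26/25 * c * real (card V) \<le> (\<Sum>a\<in>A. real (card {z \<in> V. (a + u i) + z \<in> A}))"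
      using i(2) cI0 by simp
    from exists_ge_average[OF A this] obtain a where "26/25 * c * real (card V) / real (card A) \<le> real (card {z \<in> V. (a + u i) + z \<in> A})" by blast
    moreover have "26/25 * c * real (card V) / real (card A) = 26/25 * \<alpha> * real (card V)" using cA by (simp add: c_def)
    ultimately show ?thesis by (intro exI[of _ "a + u i"]) simp
  qed
  then show ?thesis using \<Lambda>(1,2) by (intro exI[of _ \<Lambda>]) blast
qed

section \<open>Bourgain systems\<close>

text \<open>An abstract form of the family of dilates of a Bohr set of rank \<open>d\<close>.  Doubling is stated as
  a covering property, since in this form it is inherited by intersections.\<close>

definition bourgain_system :: "(real \<Rightarrow> int set) \<Rightarrow> nat \<Rightarrow> bool" where
  "bourgain_system B d \<longleftrightarrow>
     (\<forall>s>0. finite (B s) \<and> 0 \<in> B s \<and> (\<forall>x\<in>B s. - x \<in> B s)) \<and>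
     (\<forall>s>0. \<forall>t>0. \<forall>x\<in>B s. \<forall>y\<in>B t. x + y \<in> B (s + t)) \<and>
     (\<forall>s>0. \<exists>F. finite F \<and> card F \<le> 81 ^ d \<and> B (2 * s) \<subseteq> \<Union>F \<and> (\<forall>U\<in>F. \<forall>x\<in>U. \<forall>y\<in>U. x - y \<in> B s))"

lemma bourgain_systemD:
  assumes "bourgain_system B d"
  shows "s > 0 \<Longrightarrow> finite (B s)" "s > 0 \<Longrightarrow> 0 \<in> B s" "s > 0 \<Longrightarrow> x \<in> B s \<Longrightarrow> - x \<in> B s"
    "s > 0 \<Longrightarrow> t > 0 \<Longrightarrow> x \<in> B s \<Longrightarrow> y \<in> B t \<Longrightarrow> x + y \<in> B (s + t)"
    "s > 0 \<Longrightarrow> \<exists>F. finite F \<and> card F \<le> 81 ^ d \<and> B (2 * s) \<subseteq> \<Union>F \<and> (\<forall>U\<in>F. \<forall>x\<in>U. \<forall>y\<in>U. x - y \<in> B s)"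
  using assms unfolding bourgain_system_def by blast+

lemma bourgain_system_mono:
  assumes "bourgain_system B d" "0 < s" "s \<le> t"
  shows "B s \<subseteq> B t"
proof (cases "s = t")
  case False
  then have "0 \<in> B (t - s)" using assms bourgain_systemD(2)[OF assms(1), of "t - s"] by simp
  then show ?thesis using bourgain_systemD(4)[OF assms(1), of s "t - s" _ 0] assms False by fastforce
qed simp

lemma bourgain_system_add:
  assumes "bourgain_system B d" "x \<in> B s" "y \<in> B t" "s > 0" "t > 0" "s + t \<le> r"
  shows "x + y \<in> B r"
  using bourgain_systemD(4)[OF assms(1,4,5,2,3)] bourgain_system_mono[OF assms(1), of "s + t" r] assms by auto

lemma bourgain_system_diff:
  assumes "bourgain_system B d" "x \<in> B s" "y \<in> B t" "s > 0" "t > 0" "s + t \<le> r"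
  shows "x - y \<in> B r"
  using bourgain_system_add[OF assms(1,2) bourgain_systemD(3)[OF assms(1,5,3)] assms(4,5,6)] by simp

lemma bourgain_system_sum:
  assumes B: "bourgain_system B d" and s: "s > 0" and h: "\<And>i. i < j \<Longrightarrow> h i \<in> B s"
    and c: "c > 0" "real j * s \<le> c"
  shows "(\<Sum>i<j. h i) \<in> B c"
  using h c
proof (induction j arbitrary: c)
  case 0
  then show ?case using bourgain_systemD(2)[OF B] by simp
next
  case (Suc j)
  show ?case
  proof (cases "j = 0")
    case True
    then show ?thesis using Suc.prems bourgain_system_mono[OF B s, of c] by auto
  next
    case False
    have "(\<Sum>i<j. h i) \<in> B (real j * s)" using Suc.prems False s by (intro Suc.IH) auto
    moreover have "h j \<in> B s" using Suc.prems by simp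
    ultimately have "(\<Sum>i<j. h i) + h j \<in> B c"
      using Suc.prems False s by (intro bourgain_system_add[OF B, of _ "real j * s" _ s]) (auto simp: distrib_right)
    then show ?thesis by simp
  qed
qed

lemma bourgain_system_weaken:
  assumes "bourgain_system B d" "d \<le> d'"
  shows "bourgain_system B d'"
proof -
  have "(81 :: nat) ^ d \<le> 81 ^ d'" using assms(2) by (intro power_increasing) auto
  then show ?thesis using assms(1) unfolding bourgain_system_def by (meson order_trans)
qed

lemma bourgain_system_scale:
  assumes "bourgain_system B d" "h > 0"
  shows "bourgain_system (\<lambda>s. B (h * s)) d"
  using assms unfolding bourgain_system_def
  by (auto simp: distrib_left mult.left_commute[of h 2])

lemma bourgain_system_interval:
  assumes "N \<ge> 1"
  shows "bourgain_system (\<lambda>s. {x. \<bar>real_of_int x\<bar> \<le> s * N}) 1"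
  unfolding bourgain_system_def
proof (intro conjI allI impI)
  fix s :: real assume s: "s > 0"
  have "{x. \<bar>real_of_int x\<bar> \<le> s * N} \<subseteq> {- \<lceil>s * N\<rceil>..\<lceil>s * N\<rceil>}" by (auto simp: abs_le_iff) linarith+
  then show "finite {x. \<bar>real_of_int x\<bar> \<le> s * N}" using finite_subset by blast
  show "0 \<in> {x. \<bar>real_of_int x\<bar> \<le> s * N}" using s assms by simp
next
  fix s t :: real
  show "\<forall>x\<in>{x. \<bar>real_of_int x\<bar> \<le> s * N}. \<forall>y\<in>{x. \<bar>real_of_int x\<bar> \<le> t * N}. x + y \<in> {x. \<bar>real_of_int x\<bar> \<le> (s + t) * N}"
    by (auto simp: distrib_right)
next
  fix s :: real assume s: "s > 0"
  define r where "r = s * N"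
  have r: "r > 0" using s assms by (simp add: r_def)
  define c where "c j = {x :: int. \<lfloor>real_of_int x / r\<rfloor> = j}" for j
  have "card (c ` {-2..2}) \<le> 81 ^ 1"
    using card_image_le[of "{-2..2}" c] by simp
  moreover have "{x. \<bar>real_of_int x\<bar> \<le> 2 * s * N} \<subseteq> \<Union>(c ` {-2..2})"
  proof
    fix x assume "x \<in> {x. \<bar>real_of_int x\<bar> \<le> 2 * s * N}"
    then have "\<bar>real_of_int x\<bar> \<le> 2 * r" by (simp add: r_def)
    then have "-2 \<le> real_of_int x / r" "real_of_int x / r \<le> 2" using r by (auto simp: field_simps)
    then have "\<lfloor>real_of_int x / r\<rfloor> \<in> {-2..2}" by (auto simp: le_floor_iff floor_le_iff)
    then show "x \<in> \<Union>(c ` {-2..2})" by (auto simp: c_def)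
  qed
  moreover have "x - y \<in> {x. \<bar>real_of_int x\<bar> \<le> s * N}" if "x \<in> c j" "y \<in> c j" for x y j
  proof -
    have "\<bar>real_of_int x / r - real_of_int y / r\<bar> \<le> 1" using that unfolding c_def by (simp, linarith)
    then have "\<bar>real_of_int (x - y) / r\<bar> \<le> 1" by (simp add: diff_divide_distrib)
    then show ?thesis using r by (simp add: r_def[symmetric] abs_div_pos[symmetric] del: of_int_diff)
  qed
  ultimately show "\<exists>F. finite F \<and> card F \<le> 81 ^ 1 \<and> {x. \<bar>real_of_int x\<bar> \<le> 2 * s * N} \<subseteq> \<Union>F \<and>
     (\<forall>U\<in>F. \<forall>x\<in>U. \<forall>y\<in>U. x - y \<in> {x. \<bar>real_of_int x\<bar> \<le> s * N})"
    by (intro exI[of _ "c ` {-2..2}"]) blast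
qed auto

lemma bourgain_system_add_frequency:
  assumes B: "bourgain_system B d" and w: "w > 0"
  shows "bourgain_system (\<lambda>s. {x \<in> B s. norm (1 - cis (l * of_int x)) \<le> w * s}) (Suc d)"
  unfolding bourgain_system_def
proof (intro conjI allI impI ballI)
  fix s :: real assume s: "s > 0"
  show "finite {x \<in> B s. norm (1 - cis (l * of_int x)) \<le> w * s}" using bourgain_systemD(1)[OF B s] by simp
  show "0 \<in> {x \<in> B s. norm (1 - cis (l * of_int x)) \<le> w * s}" using bourgain_systemD(2)[OF B s] w s by simp
  fix x assume "x \<in> {x \<in> B s. norm (1 - cis (l * of_int x)) \<le> w * s}"
  then show "- x \<in> {x \<in> B s. norm (1 - cis (l * of_int x)) \<le> w * s}"
    using bourgain_systemD(3)[OF B s] by (simp add: norm_one_minus_cis_uminus)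
next
  fix s t :: real and x y assume st: "s > 0" "t > 0"
    and x: "x \<in> {x \<in> B s. norm (1 - cis (l * of_int x)) \<le> w * s}"
    and y: "y \<in> {x \<in> B t. norm (1 - cis (l * of_int x)) \<le> w * t}"
  have "norm (1 - cis (l * of_int (x + y))) \<le> w * (s + t)"
    using norm_one_minus_cis_add[of "l * of_int x" "l * of_int y"] x y by (simp add: distrib_left)
  then show "x + y \<in> {x \<in> B (s + t). norm (1 - cis (l * of_int x)) \<le> w * (s + t)}"
    using bourgain_systemD(4)[OF B st] x y by simp
next
  fix s :: real assume s: "s > 0"
  obtain F where F: "finite F" "card F \<le> 81 ^ d" "B (2 * s) \<subseteq> \<Union>F"
    "\<forall>U\<in>F. \<forall>x\<in>U. \<forall>y\<in>U. x - y \<in> B s"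
    using bourgain_systemD(5)[OF B s] by (elim exE conjE) (rule that)
  define r where "r = w * s"
  have r: "r > 0" using s w by (simp add: r_def)
  define z where "z x = 1 - cis (l * of_int x)" for x :: int
  define c where "c = (\<lambda>(i, j). {x :: int. \<lfloor>2 * Re (z x) / r\<rfloor> = i \<and> \<lfloor>2 * Im (z x) / r\<rfloor> = j})"
  \<comment> \<open>This grid is the origin of \<open>81 = 9 ^ 2\<close> in the doubling axiom:
    squares of side \<open>r / 2\<close>, nine in each direction, cover the disc of radius
    \<open>2 * r\<close>, and two points of one square are at distance at most
    \<open>r\<close>.\<close>
  define P where "P = ({-4..4} :: int set) \<times> ({-4..4} :: int set)"
  define F' where "F' = (\<lambda>(U, p). U \<inter> c p) ` (F \<times> P)"
  have fin: "finite F'" using F by (simp add: F'_def P_def)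
  have "card F' \<le> card (F \<times> P)" unfolding F'_def using F by (intro card_image_le) (simp add: P_def)
  also have "\<dots> = card F * 81" by (simp add: P_def card_cartesian_product)
  also have "\<dots> \<le> 81 ^ Suc d" using F by simp
  finally have cF: "card F' \<le> 81 ^ Suc d" .
  have cov: "{x \<in> B (2 * s). norm (1 - cis (l * of_int x)) \<le> w * (2 * s)} \<subseteq> \<Union>F'"
  proof
    fix x assume x: "x \<in> {x \<in> B (2 * s). norm (1 - cis (l * of_int x)) \<le> w * (2 * s)}"
    then obtain U where U: "U \<in> F" "x \<in> U" using F by blast
    have n: "norm (z x) \<le> 2 * r" using x by (simp add: z_def r_def)
    have fl: "\<lfloor>2 * v / r\<rfloor> \<in> {-4..4}" if "\<bar>v\<bar> \<le> 2 * r" for v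
    proof -
      have "-4 \<le> 2 * v / r" "2 * v / r \<le> 4" using that r by (auto simp: field_simps)
      then show ?thesis by (auto simp: le_floor_iff floor_le_iff)
    qed
    have "(\<lfloor>2 * Re (z x) / r\<rfloor>, \<lfloor>2 * Im (z x) / r\<rfloor>) \<in> P"
      using fl[of "Re (z x)"] fl[of "Im (z x)"] n abs_Re_le_cmod[of "z x"] abs_Im_le_cmod[of "z x"]
      unfolding P_def by auto
    moreover have "x \<in> c (\<lfloor>2 * Re (z x) / r\<rfloor>, \<lfloor>2 * Im (z x) / r\<rfloor>)" by (simp add: c_def)
    ultimately show "x \<in> \<Union>F'" using U unfolding F'_def by blast
  qed
  have "x - y \<in> {x \<in> B s. norm (1 - cis (l * of_int x)) \<le> w * s}" if V: "V \<in> F'" "x \<in> V" "y \<in> V" for V x y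
  proof -
    obtain pr where pr: "pr \<in> F \<times> P" "V = fst pr \<inter> c (snd pr)"
      using V(1) unfolding F'_def image_iff case_prod_unfold by (elim bexE) (rule that)
    obtain i j where "snd pr = (i, j)" by (cases "snd pr")
    then obtain U where U: "U \<in> F" "x \<in> U" "y \<in> U" "x \<in> c (i, j)" "y \<in> c (i, j)"
      using V(2,3) pr by (metis IntD1 IntD2 mem_Times_iff)
    have "\<bar>2 * Re (z x) / r - 2 * Re (z y) / r\<bar> \<le> 1" "\<bar>2 * Im (z x) / r - 2 * Im (z y) / r\<bar> \<le> 1"
      using U unfolding c_def by (simp, linarith)+
    then have "\<bar>2 * Re (z x - z y) / r\<bar> \<le> 1" "\<bar>2 * Im (z x - z y) / r\<bar> \<le> 1"
      by (simp_all add: diff_divide_distrib right_diff_distrib)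
    then have "\<bar>Re (z x - z y)\<bar> \<le> r / 2" "\<bar>Im (z x - z y)\<bar> \<le> r / 2"
      using r by (simp_all only: abs_mult abs_divide) (simp_all add: field_simps)
    then have "norm (z x - z y) \<le> r" using cmod_le[of "z x - z y"] by linarith
    moreover have "norm (1 - cis (l * of_int (x - y))) = norm (z x - z y)"
    proof -
      have "z x - z y = - (cis (l * of_int x) - cis (l * of_int y))" by (simp add: z_def)
      moreover have "cis (l * of_int x) = cis (l * of_int y) * cis (l * of_int (x - y))" by (simp add: cis_mult algebra_simps)
      ultimately have "z x - z y = cis (l * of_int y) * (1 - cis (l * of_int (x - y)))" by (simp add: algebra_simps)
      then show ?thesis by (simp add: norm_mult)
    qed
    ultimately show ?thesis using F(4) U by (simp add: r_def)
  qed
  then show "\<exists>F. finite F \<and> card F \<le> 81 ^ Suc d \<and>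
     {x \<in> B (2 * s). norm (1 - cis (l * of_int x)) \<le> w * (2 * s)} \<subseteq> \<Union>F \<and>
     (\<forall>U\<in>F. \<forall>x\<in>U. \<forall>y\<in>U. x - y \<in> {x \<in> B s. norm (1 - cis (l * of_int x)) \<le> w * s})"
    using fin cF cov by (intro exI[of _ F']) blast
qed

lemma bourgain_system_add_frequencies:
  assumes B: "bourgain_system B d" and w: "w > 0" and "finite \<Lambda>"
  shows "bourgain_system (\<lambda>s. {x \<in> B s. \<forall>l\<in>\<Lambda>. norm (1 - cis (l * of_int x)) \<le> w * s}) (d + card \<Lambda>)"
  using assms(3)
proof (induction \<Lambda> rule: finite_induct)
  case empty
  then show ?case using B by simp
next
  case (insert l \<Lambda>)
  have "(\<lambda>s. {x \<in> B s. \<forall>l\<in>insert l \<Lambda>. norm (1 - cis (l * of_int x)) \<le> w * s}) =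
    (\<lambda>s. {x \<in> {x \<in> B s. \<forall>l\<in>\<Lambda>. norm (1 - cis (l * of_int x)) \<le> w * s}. norm (1 - cis (l * of_int x)) \<le> w * s})"
    by auto
  then show ?case using bourgain_system_add_frequency[OF insert.IH w, of l] insert.hyps by simp
qed

lemma bourgain_system_doubling:
  assumes B: "bourgain_system B d" and s: "s > 0"
  shows "card (B (2 * s)) \<le> 81 ^ d * card (B s)"
proof -
  obtain F where F: "finite F" "card F \<le> 81 ^ d" "B (2 * s) \<subseteq> \<Union>F"
    "\<forall>U\<in>F. \<forall>x\<in>U. \<forall>y\<in>U. x - y \<in> B s"
    using bourgain_systemD(5)[OF B s] by (elim exE conjE) (rule that)
  have finB: "finite (B s)" "finite (B (2 * s))" using bourgain_systemD(1)[OF B] s by auto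
  have U: "card (U \<inter> B (2 * s)) \<le> card (B s)" if "U \<in> F" for U
  proof (cases "U \<inter> B (2 * s) = {}")
    case False
    then obtain x0 where "x0 \<in> U" by blast
    then show ?thesis using finB F(4) that
      by (intro card_inj_on_le[of "\<lambda>x. x - x0"]) (auto intro!: inj_onI)
  qed simp
  have "B (2 * s) = (\<Union>U\<in>F. U \<inter> B (2 * s))" using F by auto
  then have "card (B (2 * s)) \<le> (\<Sum>U\<in>F. card (U \<inter> B (2 * s)))" using card_UN_le[OF F(1)] by metis
  also have "\<dots> \<le> card F * card (B s)" using U sum_bounded_above[of F "\<lambda>U. card (U \<inter> B (2 * s))" "card (B s)"] by simp
  also have "\<dots> \<le> 81 ^ d * card (B s)" using F by simp
  finally show ?thesis .
qed

lemma bourgain_system_doubling_pow: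
  assumes B: "bourgain_system B d" and s: "s > 0"
  shows "card (B s) \<le> 81 ^ (d * j) * card (B (s / 2 ^ j))"
proof (induction j)
  case (Suc j)
  have "card (B (s / 2 ^ j)) \<le> 81 ^ d * card (B (s / 2 ^ Suc j))"
    using bourgain_system_doubling[OF B, of "s / 2 ^ Suc j"] s by simp
  then have "81 ^ (d * j) * card (B (s / 2 ^ j)) \<le> 81 ^ (d * j) * (81 ^ d * card (B (s / 2 ^ Suc j)))"
    by (intro mult_left_mono) auto
  also have "\<dots> = 81 ^ (d * Suc j) * card (B (s / 2 ^ Suc j))" by (simp add: power_add mult_ac)
  finally show ?case using Suc by linarith
qed simp

lemma bourgain_system_card_pos:
  assumes "bourgain_system B d" "s > 0"
  shows "card (B s) > 0"
  using bourgain_systemD(1,2)[OF assms] by (auto simp: card_gt_0_iff)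

section \<open>Regular scales and the large spectrum at such a scale\<close>

text \<open>If every scale between \<open>s\<close> and \<open>2 * s\<close> failed, each of
  \<open>J\<close> equal steps would multiply the size by \<open>1 + \<kappa>\<close>. With
  \<open>n\<close> about \<open>1 / \<kappa>\<close> one has
  \<open>(1 + \<kappa>) ^ n \<ge> 2\<close>, so \<open>J = 7 * d * n\<close> steps give at least
  \<open>2 ^ (7 * d)\<close>, beyond the doubling constant \<open>81 ^ d\<close>. The 14 is
  \<open>7 * 2\<close>, from \<open>n \<le> 2 / \<kappa>\<close>.\<close>

lemma bourgain_system_regular_scale:
  assumes B: "bourgain_system B d" and d: "d \<ge> 1" and s: "s > 0" and \<kappa>: "0 < \<kappa>" "\<kappa> \<le> 1"
  shows "\<exists>t. s \<le> t \<and> t \<le> 2 * s \<and> real (card (B (t + s * \<kappa> / (14 * real d)))) \<le> (1 + \<kappa>) * real (card (B t))"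
proof (rule ccontr)
  assume neg: "\<not> ?thesis"
  define n where "n = nat \<lceil>1 / \<kappa>\<rceil>"
  define J where "J = 7 * d * n"
  have n1: "real n \<ge> 1 / \<kappa>" unfolding n_def by linarith
  have n2: "real n \<le> 2 / \<kappa>"
  proof -
    have "1 \<le> 1 / \<kappa>" using \<kappa> by simp
    moreover have "real n \<le> 1 / \<kappa> + 1" unfolding n_def using \<open>1 \<le> 1 / \<kappa>\<close> by linarith
    ultimately show ?thesis by (simp add: add_divide_distrib[symmetric])
  qed
  have "1 / \<kappa> > 0" using \<kappa> by simp
  then have "real n > 0" using n1 by linarith
  then have n0: "n > 0" by simp
  have J0: "J > 0" using d n0 by (simp add: J_def)
  define h where "h = s / real J"
  have h: "h > 0" using s J0 by (simp add: h_def)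
  have hle: "s * \<kappa> / (14 * real d) \<le> h"
  proof -
    have "real J \<le> 7 * real d * (2 / \<kappa>)"
      unfolding J_def of_nat_mult of_nat_numeral using n2 by (intro mult_left_mono) auto
    then have "\<kappa> * real J \<le> \<kappa> * (7 * real d * (2 / \<kappa>))" using \<kappa> by (intro mult_left_mono) auto
    also have "\<dots> = 14 * real d" using \<kappa> by simp
    finally have "s * (\<kappa> * real J) \<le> s * (14 * real d)" using s by (intro mult_left_mono) auto
    then show ?thesis using J0 d by (simp add: h_def field_simps)
  qed
  have step: "real (card (B (t + h))) \<ge> (1 + \<kappa>) * real (card (B t))" if "s \<le> t" "t \<le> 2 * s" for t
  proof -
    have "B (t + s * \<kappa> / (14 * real d)) \<subseteq> B (t + h)"
      using hle that s \<kappa> d by (intro bourgain_system_mono[OF B]) (auto intro: add_pos_nonneg)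
    then have "card (B (t + s * \<kappa> / (14 * real d))) \<le> card (B (t + h))"
      using that s h by (intro card_mono bourgain_systemD(1)[OF B]) auto
    moreover have "real (card (B (t + s * \<kappa> / (14 * real d)))) > (1 + \<kappa>) * real (card (B t))"
      using neg that by (meson not_le)
    ultimately show ?thesis by linarith
  qed
  \<comment> \<open>The strict growth of the first step is what makes the final comparison with the
    doubling bound contradictory.\<close>
  have strict: "real (card (B (s + h))) > (1 + \<kappa>) * real (card (B s))"
  proof -
    have "B (s + s * \<kappa> / (14 * real d)) \<subseteq> B (s + h)"
      using hle s \<kappa> d by (intro bourgain_system_mono[OF B]) (auto intro: add_pos_nonneg)
    then have "card (B (s + s * \<kappa> / (14 * real d))) \<le> card (B (s + h))"
      using s h by (intro card_mono bourgain_systemD(1)[OF B]) auto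
    moreover have "real (card (B (s + s * \<kappa> / (14 * real d)))) > (1 + \<kappa>) * real (card (B s))"
    proof -
      have "s \<le> s" "s \<le> 2 * s" using s by auto
      then show ?thesis using neg by (meson not_le)
    qed
    ultimately show ?thesis by linarith
  qed
  have "(1 + \<kappa>) ^ Suc j * real (card (B s)) < real (card (B (s + real (Suc j) * h)))" if "Suc j \<le> J" for j
    using that
  proof (induction j)
    case 0
    then show ?case using strict by simp
  next
    case (Suc j)
    let ?t = "s + real (Suc j) * h"
    have "real (Suc j) * h \<le> real J * h" using Suc.prems h by (intro mult_right_mono) auto
    then have "?t \<le> 2 * s" using J0 by (simp add: h_def)
    then have "(1 + \<kappa>) * real (card (B ?t)) \<le> real (card (B (?t + h)))" using h by (intro step) auto
    moreover have "(1 + \<kappa>) * ((1 + \<kappa>) ^ Suc j * real (card (B s))) < (1 + \<kappa>) * real (card (B ?t))"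
      using Suc \<kappa> by (intro mult_strict_left_mono) auto
    moreover have "?t + h = s + real (Suc (Suc j)) * h" by (simp add: algebra_simps)
    moreover have "(1 + \<kappa>) ^ Suc (Suc j) * real (card (B s)) = (1 + \<kappa>) * ((1 + \<kappa>) ^ Suc j * real (card (B s)))"
      by simp
    ultimately show ?case by (metis less_le_trans)
  qed
  moreover obtain j where "J = Suc j" using J0 by (cases J) auto
  ultimately have "(1 + \<kappa>) ^ J * real (card (B s)) < real (card (B (s + real J * h)))" by (metis order_refl)
  also have "s + real J * h = 2 * s" using J0 by (simp add: h_def)
  also have "real (card (B (2 * s))) \<le> 81 ^ d * real (card (B s))"
    using bourgain_system_doubling[OF B s] by (metis of_nat_le_iff of_nat_mult of_nat_numeral of_nat_power)
  also have "(81 :: real) ^ d \<le> (1 + \<kappa>) ^ J"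
  proof -
    have "1 + real n * \<kappa> \<le> (1 + \<kappa>) ^ n" using \<kappa> by (intro Bernoulli_inequality) simp
    moreover have "1 \<le> real n * \<kappa>" using n1 \<kappa> by (simp add: field_simps)
    ultimately have "2 ^ (7 * d) \<le> ((1 + \<kappa>) ^ n) ^ (7 * d)" by (intro power_mono) auto
    also have "\<dots> = (1 + \<kappa>) ^ J" by (simp add: J_def power_mult[symmetric] mult_ac)
    finally have "(2 ^ 7) ^ d \<le> (1 + \<kappa>) ^ J" by (simp only: power_mult)
    moreover have "(81 :: real) ^ d \<le> (2 ^ 7) ^ d" by (intro power_mono) auto
    ultimately show ?thesis by linarith
  qed
  finally show False by (simp add: mult_right_mono)
qed

text \<open>The points that leave \<open>C\<close> are carried injectively into
  \<open>C' - C\<close>; hence controlling growth outwards is enough for stability under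
  translation.\<close>

lemma card_translate_boundary:
  fixes C C' :: "int set"
  assumes "finite C'" "C \<subseteq> C'" "\<And>x. x \<in> C \<Longrightarrow> x + z \<in> C'" "real (card C') \<le> (1 + \<kappa>) * real (card C)"
  shows "real (card {x \<in> C. x + z \<notin> C}) \<le> \<kappa> * real (card C)"
proof -
  have "card {x \<in> C. x + z \<notin> C} \<le> card (C' - C)"
    using assms by (intro card_inj_on_le[of "\<lambda>x. x + z"]) (auto intro!: inj_onI)
  moreover have "real (card (C' - C)) = real (card C') - real (card C)"
    using assms finite_subset[OF assms(2,1)] by (subst card_Diff_subset) (auto intro!: of_nat_diff card_mono)
  ultimately show ?thesis using assms(4) by (simp add: algebra_simps)
qed

text \<open>Translating \<open>H\<close> by \<open>z\<close> multiplies \<open>ft H \<phi>\<close>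
  by a character value, yet alters at most \<open>2 * \<kappa> * card H\<close> points. Dividing by
  \<open>norm (ft H \<phi>)\<close> gives the bound.\<close>

lemma large_spectrum_near_one:
  fixes H :: "int set"
  assumes H: "finite H" and spec: "norm (ft H \<phi>) > real (card H) / 2"
    and z: "real (card {x \<in> H. x + z \<notin> H}) \<le> \<kappa> * real (card H)"
      "real (card {x \<in> H. x + - z \<notin> H}) \<le> \<kappa> * real (card H)"
  shows "norm (1 - cis (\<phi> * of_int z)) \<le> 4 * \<kappa>"
proof -
  let ?c = "\<lambda>x :: int. cis (\<phi> * of_int x)"
  let ?H' = "(\<lambda>x. x + z) ` H"
  have "(1 - cis (\<phi> * of_int z)) * ft H \<phi> = (\<Sum>x\<in>H. ?c x) - (\<Sum>x\<in>H. ?c (x + z))"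
    unfolding ft_def by (simp add: algebra_simps sum_distrib_left sum_subtractf cis_mult)
  also have "(\<Sum>x\<in>H. ?c (x + z)) = (\<Sum>x\<in>?H'. ?c x)" by (subst sum.reindex) (auto simp: inj_on_def)
  also have "(\<Sum>x\<in>H. ?c x) - (\<Sum>x\<in>?H'. ?c x) = (\<Sum>x\<in>H - ?H'. ?c x) - (\<Sum>x\<in>?H' - H. ?c x)"
  proof -
    have "(\<Sum>x\<in>H. ?c x) = (\<Sum>x\<in>H - ?H'. ?c x) + (\<Sum>x\<in>H \<inter> ?H'. ?c x)"
      using sum.Int_Diff[OF H, of ?c ?H'] by (simp add: add.commute)
    moreover have "(\<Sum>x\<in>?H'. ?c x) = (\<Sum>x\<in>?H' - H. ?c x) + (\<Sum>x\<in>H \<inter> ?H'. ?c x)"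
      using sum.Int_Diff[OF finite_imageI[OF H], of ?c "\<lambda>x. x + z" H] by (simp add: add.commute Int_commute)
    ultimately show ?thesis by simp
  qed
  finally have "norm ((1 - cis (\<phi> * of_int z)) * ft H \<phi>) \<le> norm (\<Sum>x\<in>H - ?H'. ?c x) + norm (\<Sum>x\<in>?H' - H. ?c x)"
    by (metis norm_triangle_ineq4)
  also have "\<dots> \<le> real (card (H - ?H')) + real (card (?H' - H))"
    by (intro add_mono order_trans[OF norm_sum]) auto
  also have "H - ?H' = {x \<in> H. x + - z \<notin> H}" by (force simp: image_iff)
  also have "card (?H' - H) = card {x \<in> H. x + z \<notin> H}"
  proof -
    have "?H' - H = (\<lambda>x. x + z) ` {x \<in> H. x + z \<notin> H}" by auto
    then show ?thesis by (simp add: card_image inj_on_def)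
  qed
  finally have "norm (1 - cis (\<phi> * of_int z)) * norm (ft H \<phi>) \<le> 2 * \<kappa> * real (card H)"
    using z by (simp add: norm_mult)
  moreover have "norm (1 - cis (\<phi> * of_int z)) * (real (card H) / 2) \<le> norm (1 - cis (\<phi> * of_int z)) * norm (ft H \<phi>)"
    using spec by (intro mult_left_mono) auto
  ultimately have "norm (1 - cis (\<phi> * of_int z)) * real (card H) \<le> (4 * \<kappa>) * real (card H)" by simp
  moreover have "card H > 0"
    using spec norm_ft_le[of H \<phi>] by (cases "card H = 0") auto
  ultimately show ?thesis by simp
qed

section \<open>Iteration\<close>

text \<open>A chain of regular scales supplies the sets of the preceding section: \<open>E\<close>
  has differences within the stability width \<open>h\<close> of \<open>B t\<close>;
  \<open>T = B t2\<close> is so narrow that \<open>k\<close> differences barely enlarge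
  \<open>E\<close>; \<open>H = B t3\<close> so narrow that \<open>M\<close> summands barely enlarge
  \<open>T\<close>; and \<open>H\<close> is almost invariant under \<open>B h4\<close>. Widths and
  parameters depend on the lower bound \<open>a\<close>, not on \<alpha>, so they can be kept during
  the iteration.\<close>

lemma density_increment_step:
  fixes A :: "int set" and a \<alpha> \<sigma> h t :: real
  assumes B: "bourgain_system B d" and d: "d \<ge> 1"
    and t: "t > 0" and h: "h > 0" "real (card (B (t + h))) \<le> (1 + a / 1000) * real (card (B t))"
    and A: "finite A" and a: "0 < a" "a \<le> \<alpha>"
    and \<alpha>: "real (card {x \<in> B t. u + x \<in> A}) = \<alpha> * real (card (B t))"
    and p: "even p" "p \<ge> 100" "(1/2) ^ p \<le> a / 2"
    and k: "k > 0" "2 * (1/4) ^ k \<le> a / 100"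
    and \<sigma>: "\<sigma> = a ^ (8 * p)"
    and m: "16 * exp (- (real m / (16000000 * real k ^ 2))) * real k / \<sigma> \<le> 1/1000" "m > 0"
    and M: "16 * ln (8 * (2 / \<sigma>) ^ m) < real M" "M > 0"
    and no_translate: "\<And>w. \<exists>y\<in>B (h / 6). w + y \<notin> A + A + A"
  shows "\<exists>\<Lambda>. finite \<Lambda> \<and> card \<Lambda> \<le> M \<and>
    (\<forall>V. finite V \<and> V \<noteq> {} \<and> V \<subseteq> {x \<in> B (a * h / (105369600 * real d ^ 3 * real k * real M)). \<forall>l\<in>\<Lambda>. norm (1 - cis (l * of_int x)) \<le> a / (200 * real M)} \<longrightarrow>
      (\<exists>v. real (card {z \<in> V. v + z \<in> A}) \<ge> 26/25 * \<alpha> * real (card V)))"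
proof -
  note mono = bourgain_system_mono[OF B] and add = bourgain_system_add[OF B] and diff = bourgain_system_diff[OF B]
  note fin = bourgain_systemD(1)[OF B]
  define A' where "A' = {x \<in> B t. u + x \<in> A}"
  have cBt: "real (card (B t)) > 0" using bourgain_system_card_pos[OF B t] by simp
  have A'B: "A' \<subseteq> B t" by (auto simp: A'_def)
  then have finA': "finite A'" using fin[OF t] finite_subset by blast
  have cA': "real (card A') = \<alpha> * real (card (B t))" using \<alpha> by (simp add: A'_def)
  have \<alpha>0: "\<alpha> > 0" using a by simp
  have neA': "A' \<noteq> {}" using cA' \<alpha>0 cBt by force
  have \<alpha>1: "\<alpha> \<le> 1"
  proof -
    have "\<alpha> * real (card (B t)) \<le> 1 * real (card (B t))" using cA' card_mono[OF fin[OF t] A'B] by simp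
    then show ?thesis using cBt by (simp only: mult_le_cancel_right_pos)
  qed
  have stable: "real (card {b \<in> B t. b + x \<notin> B t}) \<le> \<alpha> / 1000 * real (card (B t))" if "x \<in> B h" for x
  proof -
    have "real (card {b \<in> B t. b + x \<notin> B t}) \<le> a / 1000 * real (card (B t))"
      using h t that by (intro card_translate_boundary[of "B (t + h)"] fin mono add[of _ t _ h]) auto
    also have "\<dots> \<le> \<alpha> / 1000 * real (card (B t))" using a by (intro mult_right_mono) auto
    finally show ?thesis .
  qed
  \<comment> \<open>With \<open>tE\<close> at most \<open>h / 3\<close>, differences from
    \<open>E\<close> lie in \<open>B (4 * (h / 6))\<close>, which leaves room for adding
    \<open>y\<close> from \<open>B (h / 6)\<close> within \<open>B h\<close>.\<close>
  obtain tE where tE: "h / 6 \<le> tE" "tE \<le> 2 * (h / 6)" "real (card (B (tE + h / 6 * 1 / (14 * real d)))) \<le> (1 + 1) * real (card (B tE))"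
    using bourgain_system_regular_scale[OF B d, of "h / 6" 1] h by auto
  define E where "E = B tE"
  define h2 where "h2 = h / (84 * real d)"
  have h2: "h2 > 0" "real (card (B (tE + h2))) \<le> 2 * real (card E)"
    using h d tE by (auto simp: h2_def E_def)
  have tE0: "tE > 0" using tE h by simp
  have finE: "finite E" unfolding E_def by (rule fin[OF tE0])
  have neE: "E \<noteq> {}" using bourgain_systemD(2)[OF B tE0] by (auto simp: E_def)
  have EE: "e - f \<in> B (4 * (h / 6))" if "e \<in> E" "f \<in> E" for e f
    using that tE tE0 by (intro diff[of _ tE _ tE]) (auto simp: E_def)
  have EEh: "e - f \<in> B h" if "e \<in> E" "f \<in> E" for e f
    using EE[OF that] mono[of "4 * (h/6)" h] h by auto
  have EEy: "- (e - f + y) \<in> B h" if "e \<in> E" "f \<in> E" "y \<in> B (h / 6)" for e f y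
    using add[OF EE[OF that(1,2)] that(3), of h] h by (intro bourgain_systemD(3)[OF B]) auto
  \<comment> \<open>Averaging over \<open>w\<close> in \<open>B (t + h)\<close>: for each pair
    exactly \<open>card A'\<close> values of \<open>w\<close> qualify, and this set is at most twice
    as large as \<open>B t\<close>.\<close>
  obtain w where w: "real (card {(e, f) \<in> E \<times> E. w - e + f \<in> A'}) \<ge> \<alpha> / 2 * real (card E) ^ 2"
  proof -
    define W where "W = B (t + h)"
    have finW: "finite W" using fin[of "t + h"] t h by (simp add: W_def)
    have "0 \<in> W" using bourgain_systemD(2)[OF B, of "t + h"] t h by (simp add: W_def)
    then have neW: "W \<noteq> {}" by blast
    have cW: "real (card W) > 0" using finW neW by (simp add: card_gt_0_iff)
    have cW2: "real (card W) \<le> 2 * real (card (B t))"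
    proof -
      have "(1 + a / 1000) * real (card (B t)) \<le> 2 * real (card (B t))" using a \<alpha>1 by (intro mult_right_mono) auto
      then show ?thesis using h by (simp add: W_def)
    qed
    have one: "(\<Sum>w\<in>W. of_bool (w - e + f \<in> A')) = real (card A')" if "e \<in> E" "f \<in> E" for e f
    proof -
      have "card {w \<in> W. w - e + f \<in> A'} = card A'"
      proof (rule bij_betw_same_card[of "\<lambda>w. w - e + f"], rule bij_betw_byWitness[of _ "\<lambda>x. x + (e - f)"])
        show "(\<lambda>x. x + (e - f)) ` A' \<subseteq> {w \<in> W. w - e + f \<in> A'}"
          using EEh[OF that] A'B add[of _ t _ h "t + h"] t h by (auto simp: W_def)
      qed auto
      then show ?thesis using finW by (simp add: sum_of_bool_eq Int_def)
    qed
    have "(\<Sum>w\<in>W. real (card {(e, f) \<in> E \<times> E. w - e + f \<in> A'})) = (\<Sum>w\<in>W. \<Sum>p\<in>E \<times> E. of_bool (w - fst p + snd p \<in> A'))"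
      using finE by (simp add: sum_of_bool_eq Int_def case_prod_unfold mem_Times_iff)
    also have "\<dots> = (\<Sum>p\<in>E \<times> E. \<Sum>w\<in>W. of_bool (w - fst p + snd p \<in> A'))" by (rule sum.swap)
    also have "\<dots> = (\<Sum>p\<in>E \<times> E. real (card A'))" by (intro sum.cong refl one) auto
    finally have "real (card E) ^ 2 * real (card A') \<le> (\<Sum>w\<in>W. real (card {(e, f) \<in> E \<times> E. w - e + f \<in> A'}))"
      by (simp add: card_cartesian_product power2_eq_square)
    from exists_ge_average[OF finW neW this] obtain w where
      w: "real (card E) ^ 2 * real (card A') / real (card W) \<le> real (card {(e, f) \<in> E \<times> E. w - e + f \<in> A'})" by blast
    have "\<alpha> / 2 \<le> real (card A') / real (card W)" using cW2 cW \<alpha>0 by (simp add: cA' field_simps)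
    then have "real (card E) ^ 2 * (\<alpha> / 2) \<le> real (card E) ^ 2 * (real (card A') / real (card W))" by (intro mult_left_mono) auto
    then show thesis using w by (intro that[of w]) (simp add: mult.commute)
  qed
  \<comment> \<open>The offset \<open>3 * u\<close> accounts for three elements of
    \<open>u + A'\<close>, the third of them being \<open>u + (w - e + f)\<close>.\<close>
  obtain y where y: "y \<in> B (h / 6)" "3 * u + w + y \<notin> A + A + A" using no_translate by blast
  have missing: "a1 + a2 \<noteq> e - f + y" if "e \<in> E" "f \<in> E" "w - e + f \<in> A'" "a1 \<in> A'" "a2 \<in> A'" for e f a1 a2
  proof
    assume eq: "a1 + a2 = e - f + y"
    have "(u + a1) + (u + a2) + (u + (w - e + f)) \<in> A + A + A"
      using that by (intro set_plus_intro) (auto simp: A'_def)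
    also have "(u + a1) + (u + a2) + (u + (w - e + f)) = 3 * u + w + y" using eq by (simp add: algebra_simps)
    finally show False using y by simp
  qed
  have moment: "(\<Sum>e\<in>E. \<Sum>f\<in>E. (real (diff_count A' (e - f)) / (\<alpha> * real (card A'))) ^ (8 * p)) \<ge> (37/20) ^ p * real (card E) ^ 2"
  proof (rule high_moment_of_missing_sums[OF fin[OF t] _ A'B neA' cA' finE _ _ p(1,2) _ w missing])
    show "(1/2) ^ p \<le> \<alpha> / 2" using p a by linarith
  qed (use bourgain_systemD(3)[OF B t] stable EEh EEy[OF _ _ y(1)] in auto)
  from sifted_set[OF finA' neA' finE neE \<alpha>0 p(2) moment]
  obtain D where D: "D \<subseteq> E" "real (card D) \<ge> \<alpha> ^ (8 * p) * real (card E)"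
    "1000 * real (card {(x, b) \<in> D \<times> D. \<not> 53/50 * (\<alpha> * real (card A')) \<le> real (diff_count A' (x - b))}) \<le> real (card D) ^ 2"
    by blast
  have \<sigma>0: "\<sigma> > 0" using a by (simp add: \<sigma>)
  have cE: "real (card E) > 0" using finE neE by (simp add: card_gt_0_iff)
  have D\<sigma>: "\<sigma> * real (card E) \<le> real (card D)"
  proof -
    have "\<sigma> \<le> \<alpha> ^ (8 * p)" unfolding \<sigma> using a by (intro power_mono) auto
    then have "\<sigma> * real (card E) \<le> \<alpha> ^ (8 * p) * real (card E)" by (intro mult_right_mono) auto
    then show ?thesis using D by linarith
  qed
  have finD: "finite D" using D finE finite_subset by blast
  have neD: "D \<noteq> {}"
  proof
    assume "D = {}"
    then show False using D\<sigma> mult_pos_pos[OF \<sigma>0 cE] by simp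
  qed
  define s2 where "s2 = h2 / (4 * real k)"
  have s2: "s2 > 0" using h2 k by (simp add: s2_def)
  obtain t2 where t2: "s2 \<le> t2" "t2 \<le> 2 * s2" "real (card (B (t2 + s2 * 1 / (14 * real d)))) \<le> (1 + 1) * real (card (B t2))"
    using bourgain_system_regular_scale[OF B d s2, of 1] by auto
  define h3 where "h3 = s2 / (14 * real d)"
  have h3: "h3 > 0" using s2 d by (simp add: h3_def)
  have t20: "t2 > 0" using t2 s2 by simp
  have kt2: "real k * (2 * t2) \<le> h2"
  proof -
    have "real k * (2 * t2) \<le> real k * (2 * (2 * s2))" using t2 by (intro mult_left_mono) auto
    then show ?thesis using k by (simp add: s2_def)
  qed
  have t2h2: "t2 \<le> h2"
  proof -
    have "1 * (2 * t2) \<le> real k * (2 * t2)" using k t20 by (intro mult_right_mono) auto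
    then show ?thesis using kt2 t20 by linarith
  qed
  define s3 where "s3 = h3 / (2 * real M)"
  have s3: "s3 > 0" using h3 M by (simp add: s3_def)
  \<comment> \<open>The tolerance \<open>a / 800\<close> becomes \<open>a / 200\<close> through the
    factor 4 of \<open>large_spectrum_near_one\<close>.\<close>
  obtain t3 where t3: "s3 \<le> t3" "t3 \<le> 2 * s3" "real (card (B (t3 + s3 * (a / 800) / (14 * real d)))) \<le> (1 + a / 800) * real (card (B t3))"
    using bourgain_system_regular_scale[OF B d s3, of "a / 800"] a \<alpha>1 by auto
  have t30: "t3 > 0" using t3 s3 by simp
  have Mt3: "real M * t3 \<le> h3"
  proof -
    have "real M * t3 \<le> real M * (2 * s3)" using t3 by (intro mult_left_mono) auto
    then show ?thesis using M by (simp add: s3_def)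
  qed
  \<comment> \<open>The constant is \<open>84 * 4 * 14 * 2 * 800 * 14\<close>, collected along
    \<open>h2\<close>, \<open>s2\<close>, \<open>h3\<close>, \<open>s3\<close> and the last regular
    scale.\<close>
  define h4 where "h4 = a * h / (105369600 * real d ^ 3 * real k * real M)"
  have h4: "h4 = s3 * (a / 800) / (14 * real d)"
    using d k M by (simp add: h4_def s3_def h3_def s2_def h2_def field_simps power3_eq_cube)
  have h40: "h4 > 0" unfolding h4 using s3 a d by simp
  define H where "H = B t3"
  have finH: "finite H" unfolding H_def by (rule fin[OF t30])
  have near_one: "norm (1 - cis (\<phi> * of_int z)) \<le> a / 200" if "z \<in> B h4" "norm (ft H \<phi>) > real (card H) / 2" for z \<phi>
  proof -
    have st: "real (card {x \<in> H. x + z \<notin> H}) \<le> a / 800 * real (card H)" if "z \<in> B h4" for z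
      unfolding H_def using t3 t30 h40 that
      by (intro card_translate_boundary[of "B (t3 + h4)"] fin mono add[of _ t3 _ h4]) (auto simp: h4)
    have "norm (1 - cis (\<phi> * of_int z)) \<le> 4 * (a / 800)"
      using that st[OF that(1)] st[OF bourgain_systemD(3)[OF B h40 that(1)]]
      by (intro large_spectrum_near_one[OF finH]) auto
    then show ?thesis by simp
  qed
  have "\<exists>\<Lambda>. finite \<Lambda> \<and> card \<Lambda> \<le> M \<and>
    (\<forall>V. finite V \<and> V \<noteq> {} \<and> (\<forall>z\<in>V. (\<forall>\<phi>. norm (ft H \<phi>) > real (card H) / 2 \<longrightarrow> norm (1 - cis (\<phi> * of_int z)) \<le> \<alpha> / 200) \<and>
       (\<forall>l\<in>\<Lambda>. norm (1 - cis (l * of_int z)) \<le> \<alpha> / (200 * real M))) \<longrightarrow>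
      (\<exists>v. real (card {z \<in> V. v + z \<in> A'}) \<ge> 26/25 * \<alpha> * real (card V)))"
  proof (rule density_increment_of_sifted[OF finA' neA' \<alpha>0 finD neD D(3), where T="B t2" and Wd="B (tE + h2)" and Y="B (tE + h2)" and G="B (t2 + h3)" and \<sigma>=\<sigma> and m=m and k=k])
    show "B t2 \<noteq> {}" using bourgain_systemD(2)[OF B t20] by blast
    show "b - z \<in> B (tE + h2)" if "b \<in> D" "z \<in> B t2" for b z
      using that D(1) t2h2 tE0 t20 by (intro diff[of _ tE _ t2]) (auto simp: E_def)
    have "\<sigma> * real (card (B (tE + h2))) \<le> \<sigma> * (2 * real (card E))" using h2 \<sigma>0 by (intro mult_left_mono) auto
    then show "\<sigma> * real (card (B (tE + h2))) \<le> 2 * real (card D)" using D\<sigma> by linarith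
    then show "\<sigma> * real (card (B (tE + h2))) \<le> 2 * real (card D)" .
    show "x + (\<Sum>i<j. z i - z' i) \<in> B (tE + h2)" if "x \<in> D" "j \<le> k" "\<And>i. i < k \<Longrightarrow> z i \<in> B t2 \<and> z' i \<in> B t2" for x z z' j
    proof -
      have "(\<Sum>i<j. z i - z' i) \<in> B h2"
      proof (rule bourgain_system_sum[OF B, of "2 * t2"])
        show "z i - z' i \<in> B (2 * t2)" if "i < j" for i
          using that \<open>j \<le> k\<close> \<open>\<And>i. i < k \<Longrightarrow> z i \<in> B t2 \<and> z' i \<in> B t2\<close>[of i] t20 by (intro diff[of _ t2 _ t2]) auto
        have "real j * (2 * t2) \<le> real k * (2 * t2)" using \<open>j \<le> k\<close> t20 by (intro mult_right_mono) auto
        then show "real j * (2 * t2) \<le> h2" using kt2 by linarith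
      qed (use t20 h2 in auto)
      then show ?thesis using \<open>x \<in> D\<close> D(1) tE0 h2 by (intro add[of _ tE _ h2]) (auto simp: E_def)
    qed
    show "H \<noteq> {}" using bourgain_systemD(2)[OF B t30] by (auto simp: H_def)
    show "real (card (B (t2 + h3))) \<le> 2 * real (card (B t2))" using t2(3) by (simp add: h3_def)
    show "x - (\<Sum>i<M. g i) \<in> B (t2 + h3)" if "x \<in> B t2" "g \<in> {..<M} \<rightarrow>\<^sub>E H" for x g
    proof -
      have "(\<Sum>i<M. g i) \<in> B h3"
        using that t30 Mt3 h3 by (intro bourgain_system_sum[OF B t30]) (auto simp: H_def PiE_def Pi_def)
      then show ?thesis using that t20 h3 by (intro diff[of _ t2 _ h3]) auto
    qed
    show "2 * (1/4) ^ k \<le> \<alpha> / 100" using k a by linarith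
  qed (use fin t20 tE0 h2 h3 finH k m M \<sigma>0 in auto)
  then obtain \<Lambda> where \<Lambda>: "finite \<Lambda>" "card \<Lambda> \<le> M" and
    inc: "\<forall>V. finite V \<and> V \<noteq> {} \<and> (\<forall>z\<in>V. (\<forall>\<phi>. norm (ft H \<phi>) > real (card H) / 2 \<longrightarrow> norm (1 - cis (\<phi> * of_int z)) \<le> \<alpha> / 200) \<and>
       (\<forall>l\<in>\<Lambda>. norm (1 - cis (l * of_int z)) \<le> \<alpha> / (200 * real M))) \<longrightarrow>
      (\<exists>v. real (card {z \<in> V. v + z \<in> A'}) \<ge> 26/25 * \<alpha> * real (card V))"
    by (elim exE conjE) (rule that)
  have step: "\<exists>v. real (card {z \<in> V. v + z \<in> A}) \<ge> 26/25 * \<alpha> * real (card V)"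
    if V: "finite V" "V \<noteq> {}" "V \<subseteq> {x \<in> B h4. \<forall>l\<in>\<Lambda>. norm (1 - cis (l * of_int x)) \<le> a / (200 * real M)}" for V
  proof -
    have le: "a / (200 * real M) \<le> \<alpha> / (200 * real M)" "a / 200 \<le> \<alpha> / 200" using a by (auto intro: divide_right_mono)
    have "\<exists>v. real (card {z \<in> V. v + z \<in> A'}) \<ge> 26/25 * \<alpha> * real (card V)"
    proof (rule inc[THEN spec, of V, THEN mp], intro conjI ballI allI impI V(1,2))
      fix z \<phi> assume "z \<in> V" "real (card H) / 2 < norm (ft H \<phi>)"
      then show "norm (1 - cis (\<phi> * of_int z)) \<le> \<alpha> / 200" using near_one[of z \<phi>] V(3) le(2) by auto
    next
      fix z l assume "z \<in> V" "l \<in> \<Lambda>"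
      then have "norm (1 - cis (l * of_int z)) \<le> a / (200 * real M)" using V(3) by auto
      then show "norm (1 - cis (l * of_int z)) \<le> \<alpha> / (200 * real M)" using le(1) by linarith
    qed
    then obtain v where v: "real (card {z \<in> V. v + z \<in> A'}) \<ge> 26/25 * \<alpha> * real (card V)" by blast
    have "card {z \<in> V. v + z \<in> A'} \<le> card {z \<in> V. (u + v) + z \<in> A}"
      using V(1) by (intro card_mono) (auto simp: A'_def add.assoc)
    then show ?thesis using v by (intro exI[of _ "u + v"]) linarith
  qed
  show ?thesis unfolding h4_def[symmetric]
    by (intro exI[of _ \<Lambda>] conjI \<Lambda> allI impI, elim conjE, rule step)
qed

text \<open>\<open>B S\<close> has more than \<open>N\<close> elements, so after \<open>j\<close>
  halvings of the scale there is still a nonzero \<open>x\<close>. Its multiples by at most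
  \<open>2 ^ j * s / S\<close> remain in \<open>B s\<close> by subadditivity.\<close>

lemma arithmetic_progression_in_translate:
  fixes A :: "int set" and N S s :: real
  assumes B: "bourgain_system B D" and S: "S > 0" "\<And>x. \<bar>real_of_int x\<bar> \<le> N \<Longrightarrow> x \<in> B S"
    and N: "N \<ge> 1" and s: "s > 0" and w: "\<And>y. y \<in> B s \<Longrightarrow> w + y \<in> A"
    and j: "81 ^ (D * j) \<le> N"
  shows "\<exists>P n. is_AP_of_length P n \<and> P \<subseteq> A \<and> real n \<ge> 2 ^ j * s / S"
proof -
  define r where "r = S / 2 ^ j"
  have r: "r > 0" using S by (simp add: r_def)
  have finr: "finite (B r)" by (rule bourgain_systemD(1)[OF B r])
  have "\<not> B r \<subseteq> {0}"
  proof
    assume "B r \<subseteq> {0}"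
    then have "card (B r) \<le> 1" using card_mono[of "{0}" "B r"] by simp
    define n where "n = \<lfloor>N\<rfloor>"
    have n: "n \<ge> 1" using N by (simp add: n_def le_floor_iff)
    have "{-n..n} \<subseteq> B S"
    proof
      fix x assume "x \<in> {-n..n}"
      then have "\<bar>x\<bar> \<le> n" by auto
      then have "real_of_int \<bar>x\<bar> \<le> N" unfolding n_def by (simp only: le_floor_iff)
      then show "x \<in> B S" using S(2) by simp
    qed
    then have "card {-n..n} \<le> card (B S)" by (rule card_mono[OF bourgain_systemD(1)[OF B S(1)]])
    then have "2 * real_of_int n + 1 \<le> real (card (B S))" using n by simp
    moreover have "N < 2 * real_of_int n + 1" using n unfolding n_def by linarith
    moreover have "card (B S) \<le> 81 ^ (D * j) * card (B r)" unfolding r_def by (rule bourgain_system_doubling_pow[OF B S(1)])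
    then have "card (B S) \<le> 81 ^ (D * j) * 1" using \<open>card (B r) \<le> 1\<close> by (meson mult_left_mono order_trans zero_le)
    then have "real (card (B S)) \<le> 81 ^ (D * j)" by (metis mult.right_neutral of_nat_le_iff of_nat_numeral of_nat_power)
    ultimately show False using j by linarith
  qed
  then obtain x where x: "x \<in> B r" "x \<noteq> 0" by blast
  define n where "n = nat \<lfloor>2 ^ j * s / S\<rfloor>"
  have pos: "0 \<le> 2 ^ j * s / S" using s S by simp
  have n: "real n \<le> 2 ^ j * s / S" "2 ^ j * s / S \<le> real (Suc n)" unfolding n_def using pos by linarith+
  \<comment> \<open>The multiple 0 counts too, so there are \<open>Suc n\<close> terms and rounding
    down costs nothing.\<close>
  define P where "P = (\<lambda>i. w + int i * x) ` {..<Suc n}"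
  have "P \<subseteq> A"
  proof
    fix y assume "y \<in> P"
    then obtain i where "i \<in> {..<Suc n}" and i: "y = w + int i * x" unfolding P_def by blast
    then have "i \<le> n" by simp
    have "real i * r \<le> real n * r" using \<open>i \<le> n\<close> r by (intro mult_right_mono) auto
    also have "\<dots> \<le> (2 ^ j * s / S) * r" using n r by (intro mult_right_mono) auto
    also have "\<dots> = s" using S by (simp add: r_def)
    finally have "(\<Sum>i'<i. x) \<in> B s" using x s by (intro bourgain_system_sum[OF B r]) auto
    then show "y \<in> A" using w i by simp
  qed
  moreover have "is_AP_of_length P (Suc n)" unfolding is_AP_of_length_def P_def using x by blast
  ultimately show ?thesis using n(2) by blast
qed

text \<open>If no translate of any admissible system lay in \<open>A + A + A\<close>, the density
  would grow by \<open>26/25\<close> at each of \<open>I\<close> steps and exceed 1. Each new system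
  is rescaled so that the working scale stays between 1 and 2; the price is the growth of
  \<open>S\<close>, the scale that contains all integers up to \<open>N\<close> in absolute value.
  That scale is what the final search for a progression needs.\<close>

lemma iterated_density_increment:
  fixes A :: "int set" and N :: int and a :: real
  assumes N: "N \<ge> 1" and A: "A \<subseteq> {1..N}" "real (card A) \<ge> 5 * a * real_of_int N" and a: "0 < a"
    and p: "even p" "p \<ge> 100" "(1/2) ^ p \<le> a / 2"
    and k: "k > 0" "2 * (1/4) ^ k \<le> a / 100"
    and \<sigma>: "\<sigma> = a ^ (8 * p)"
    and m: "16 * exp (- (real m / (16000000 * real k ^ 2))) * real k / \<sigma> \<le> 1/1000" "m > 0"
    and M: "16 * ln (8 * (2 / \<sigma>) ^ m) < real M" "M > 0"
    and I: "(26/25) ^ I * a > 1"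
    and D: "D = 1 + I * M" and h: "h = a / (14000 * real D)"
    and h4: "h4 = a * h / (105369600 * real D ^ 3 * real k * real M)"
    and w: "w = a / (400 * real M)"
  shows "\<exists>B S v. bourgain_system B D \<and> 0 < S \<and> S \<le> (2 / (h4 * w)) ^ I \<and>
    (\<forall>x. \<bar>real_of_int x\<bar> \<le> real_of_int N \<longrightarrow> x \<in> B S) \<and> (\<forall>y\<in>B (h / 6). v + y \<in> A + A + A)"
proof (rule ccontr)
  assume neg: "\<not> ?thesis"
  define G where "G = 2 / (h4 * w)"
  define N' where "N' = real_of_int N"
  have N': "N' \<ge> 1" using N by (simp add: N'_def)
  have finA: "finite A" using A finite_subset by blast
  have D1: "D \<ge> 1" using D by simp
  have a1: "a \<le> 1"
  proof -
    have "real (card A) \<le> N'" using card_mono[OF _ A(1)] N by (simp add: N'_def)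
    then have "5 * a * N' \<le> 1 * N'" using A(2) by (simp add: N'_def)
    then show ?thesis using N' a by simp
  qed
  have h0: "h > 0" using a D1 by (simp add: h)
  have h1: "h \<le> 1"
  proof -
    have "a / (14000 * real D) \<le> 1 / 1" using a a1 D1 by (intro frac_le) auto
    then show ?thesis by (simp add: h)
  qed
  have h40: "h4 > 0" using a h0 D1 k M by (simp add: h4)
  have h41: "h4 \<le> 1"
  proof -
    have "1 \<le> D ^ 3 * k * M" using D1 k M by (simp add: Suc_le_eq)
    then have "1 \<le> real D ^ 3 * real k * real M" by (metis of_nat_le_iff of_nat_1 of_nat_mult of_nat_power)
    then have "1 \<le> 105369600 * real D ^ 3 * real k * real M" by simp
    then have "a * h / (105369600 * real D ^ 3 * real k * real M) \<le> 1 / 1"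
      using a a1 h0 h1 by (intro frac_le mult_le_one) auto
    then show ?thesis by (simp add: h4)
  qed
  have w0: "w > 0" "w \<le> 1"
  proof -
    show "w > 0" using a M by (simp add: w)
    have "a / (400 * real M) \<le> 1 / 1" using a a1 M by (intro frac_le) auto
    then show "w \<le> 1" by (simp add: w)
  qed
  have G1: "G \<ge> 2"
  proof -
    have "2 / 1 \<le> 2 / (h4 * w)" using h40 h41 w0 by (intro divide_left_mono mult_le_one) auto
    then show ?thesis by (simp add: G_def)
  qed
  define Q where "Q i B d S t u \<longleftrightarrow> bourgain_system B d \<and> d \<le> 1 + i * M \<and> 1 \<le> S \<and> S \<le> G ^ i \<and>
     (\<forall>x. \<bar>real_of_int x\<bar> \<le> N' \<longrightarrow> x \<in> B S) \<and> 1 \<le> t \<and> t \<le> 2 \<and>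
     real (card (B (t + h))) \<le> (1 + a / 1000) * real (card (B t)) \<and>
     real (card {x \<in> B t. u + x \<in> A}) \<ge> (26/25) ^ i * a * real (card (B t))" for i B d S t u
  \<comment> \<open>The width \<open>h\<close> is what \<open>bourgain_system_regular_scale\<close>
    gives for tolerance \<open>a / 1000\<close> and rank \<open>D\<close>.\<close>
  have reg: "\<exists>t. 1 \<le> t \<and> t \<le> 2 \<and> real (card (B (t + h))) \<le> (1 + a / 1000) * real (card (B t))"
    if "bourgain_system B D" for B
    using bourgain_system_regular_scale[OF that D1, of 1 "a / 1000"] a a1 by (simp add: h)
  have "\<exists>B d S t u. Q i B d S t u" if "i \<le> I" for i
    using that
  proof (induction i)
    case 0
    define B where "B s = {x. \<bar>real_of_int x\<bar> \<le> s * N'}" for s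
    have B: "bourgain_system B 1" unfolding B_def by (rule bourgain_system_interval[OF N'])
    obtain t where t: "1 \<le> t" "t \<le> 2" "real (card (B (t + h))) \<le> (1 + a / 1000) * real (card (B t))"
      using reg[OF bourgain_system_weaken[OF B D1]] by blast
    have AB: "A \<subseteq> B t"
    proof
      fix x assume "x \<in> A"
      then have x: "1 \<le> x" "x \<le> N" using A by auto
      then have "\<bar>real_of_int x\<bar> \<le> 1 * N'" by (simp add: N'_def)
      also have "\<dots> \<le> t * N'" using t N' by (intro mult_right_mono) auto
      finally show "x \<in> B t" by (simp add: B_def)
    qed
    \<comment> \<open>The initial set has at most \<open>4 * N + 1 \<le> 5 * N\<close> elements,
      whence the factor 5 in the hypothesis on \<open>card A\<close>.\<close>
    have "B t \<subseteq> {- (2 * N)..2 * N}"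
    proof
      fix x assume "x \<in> B t"
      then have "\<bar>real_of_int x\<bar> \<le> t * N'" by (simp add: B_def)
      also have "\<dots> \<le> 2 * N'" using t N' by (intro mult_right_mono) auto
      finally have "\<bar>x\<bar> \<le> 2 * N" by (simp add: N'_def)
      then show "x \<in> {- (2 * N)..2 * N}" by auto
    qed
    then have "card (B t) \<le> card {- (2 * N)..2 * N}" by (intro card_mono) auto
    then have "real (card (B t)) \<le> 5 * N'" using N by (simp add: N'_def)
    then have "a * real (card (B t)) \<le> a * (5 * N')" using a by (intro mult_left_mono) auto
    then have "a * real (card (B t)) \<le> real (card A)" using A(2) by (simp add: N'_def)
    moreover have "{x \<in> B t. 0 + x \<in> A} = A" using AB by auto
    ultimately have "Q 0 B 1 1 t 0" using B t unfolding Q_def by (simp add: B_def)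
    then show ?case by blast
  next
    case (Suc i)
    then obtain B d S t u where Q: "Q i B d S t u" by auto
    then have B: "bourgain_system B d" "d \<le> 1 + i * M" and S: "1 \<le> S" "S \<le> G ^ i" "\<And>x. \<bar>real_of_int x\<bar> \<le> N' \<Longrightarrow> x \<in> B S"
      and t: "1 \<le> t" "t \<le> 2" "real (card (B (t + h))) \<le> (1 + a / 1000) * real (card (B t))"
      and dens: "real (card {x \<in> B t. u + x \<in> A}) \<ge> (26/25) ^ i * a * real (card (B t))"
      unfolding Q_def by auto
    have iM: "1 + Suc i * M \<le> D" unfolding D using Suc.prems mult_le_mono1[of "Suc i" I M] by simp
    have BD: "bourgain_system B D" using B iM by (intro bourgain_system_weaken[OF B(1)]) simp
    have cB: "real (card (B t)) > 0" using bourgain_system_card_pos[OF BD, of t] t by simp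
    define \<alpha> where "\<alpha> = real (card {x \<in> B t. u + x \<in> A}) / real (card (B t))"
    have \<alpha>: "real (card {x \<in> B t. u + x \<in> A}) = \<alpha> * real (card (B t))" using cB by (simp add: \<alpha>_def)
    have \<alpha>i: "\<alpha> \<ge> (26/25) ^ i * a" using dens cB by (simp add: \<alpha>_def pos_le_divide_eq)
    have \<alpha>a: "a \<le> \<alpha>"
    proof -
      have "1 * a \<le> (26/25) ^ i * a" using a by (intro mult_right_mono one_le_power) auto
      then show ?thesis using \<alpha>i by linarith
    qed
    have no: "\<exists>y\<in>B (h / 6). v + y \<notin> A + A + A" for v
    proof (rule ccontr)
      assume "\<not> ?thesis"
      moreover have "S \<le> (2 / (h4 * w)) ^ I"
      proof -
        have "G ^ i \<le> G ^ I" using G1 Suc.prems by (intro power_increasing) auto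
        then show ?thesis using S by (simp add: G_def)
      qed
      ultimately show False using neg BD S unfolding N'_def by (metis less_le_trans zero_less_one)
    qed
    have t0: "t > 0" using t by simp
    obtain \<Lambda> where \<Lambda>: "finite \<Lambda>" "card \<Lambda> \<le> M" and
      inc: "\<forall>V. finite V \<and> V \<noteq> {} \<and> V \<subseteq> {x \<in> B (a * h / (105369600 * real D ^ 3 * real k * real M)). \<forall>l\<in>\<Lambda>. norm (1 - cis (l * of_int x)) \<le> a / (200 * real M)} \<longrightarrow>
        (\<exists>v. real (card {z \<in> V. v + z \<in> A}) \<ge> 26/25 * \<alpha> * real (card V))"
      using density_increment_step[OF BD D1 t0 h0 t(3) finA a \<alpha>a \<alpha> p k \<sigma> m M no] by (elim exE conjE) (rule that)
    \<comment> \<open>The factors \<open>h4 / 2\<close> and \<open>w\<close> are half of what the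
      increment step requires, since the scale \<open>t'\<close> may be as large as 2.\<close>
    define B' where "B' s = {x \<in> B (h4 / 2 * s). \<forall>l\<in>\<Lambda>. norm (1 - cis (l * of_int x)) \<le> w * s}" for s
    have "bourgain_system B' (d + card \<Lambda>)"
      unfolding B'_def using h40 by (intro bourgain_system_add_frequencies[OF bourgain_system_scale[OF B(1)] w0(1) \<Lambda>(1)]) auto
    moreover have dim: "d + card \<Lambda> \<le> 1 + Suc i * M" using B \<Lambda> by simp
    ultimately have B': "bourgain_system B' (d + card \<Lambda>)" "bourgain_system B' D"
      using bourgain_system_weaken iM order_trans by blast+
    obtain t' where t': "1 \<le> t'" "t' \<le> 2" "real (card (B' (t' + h))) \<le> (1 + a / 1000) * real (card (B' t'))"
      using reg[OF B'(2)] by blast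
    have t'0: "t' > 0" using t' by simp
    have "\<exists>v. real (card {z \<in> B' t'. v + z \<in> A}) \<ge> 26/25 * \<alpha> * real (card (B' t'))"
    proof (rule inc[THEN spec, THEN mp], intro conjI)
      show "finite (B' t')" by (rule bourgain_systemD(1)[OF B'(2) t'0])
      show "B' t' \<noteq> {}" using bourgain_systemD(2)[OF B'(2) t'0] by blast
      have "B (h4 / 2 * t') \<subseteq> B h4" using t' h40 by (intro bourgain_system_mono[OF BD]) auto
      moreover have "w * t' \<le> a / (200 * real M)"
      proof -
        have "w * t' \<le> w * 2" using t' w0 by (intro mult_left_mono) auto
        then show ?thesis by (simp add: w)
      qed
      ultimately show "B' t' \<subseteq> {x \<in> B (a * h / (105369600 * real D ^ 3 * real k * real M)). \<forall>l\<in>\<Lambda>. norm (1 - cis (l * of_int x)) \<le> a / (200 * real M)}"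
        unfolding h4[symmetric] B'_def by fastforce
    qed
    then obtain v where v: "real (card {z \<in> B' t'. v + z \<in> A}) \<ge> 26/25 * \<alpha> * real (card (B' t'))" by blast
    have dens': "real (card {z \<in> B' t'. v + z \<in> A}) \<ge> (26/25) ^ Suc i * a * real (card (B' t'))"
    proof -
      have "(26/25) ^ Suc i * a * real (card (B' t')) \<le> 26/25 * \<alpha> * real (card (B' t'))"
        using mult_left_mono[OF \<alpha>i, of "26/25"] by (intro mult_right_mono) (auto simp: mult_ac)
      then show ?thesis using v by linarith
    qed
    have big: "x \<in> B' (S * G)" if "\<bar>real_of_int x\<bar> \<le> N'" for x
    proof -
      \<comment> \<open>At scale \<open>S * G\<close> both conditions of \<open>B'\<close> hold: the
        first because \<open>w \<le> 1\<close>, the second because its bound is at least 2, the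
        trivial bound for \<open>norm (1 - cis _)\<close>.\<close>
      have e1: "h4 / 2 * (S * G) = S * (1 / w)" using h40 by (simp add: G_def)
      have e2: "w * (S * G) = S * (2 / h4)" using w0 by (simp add: G_def)
      have "S * 1 \<le> S * (1 / w)" using S w0 by (intro mult_left_mono) auto
      then have "B S \<subseteq> B (h4 / 2 * (S * G))" unfolding e1 using S by (intro bourgain_system_mono[OF BD]) auto
      moreover have "norm (1 - cis (l * of_int x)) \<le> w * (S * G)" for l
      proof -
        have "norm (1 - cis (l * of_int x)) \<le> 1 * 2" using norm_triangle_ineq4[of 1 "cis (l * of_int x)"] by simp
        also have "\<dots> \<le> S * (2 / h4)" using S h40 h41 by (intro mult_mono) (auto simp: field_simps)
        finally show ?thesis unfolding e2 .
      qed
      ultimately show ?thesis using S(3)[OF that] by (auto simp: B'_def)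
    qed
    have "Q (Suc i) B' (d + card \<Lambda>) (S * G) t' v"
      unfolding Q_def
    proof (intro conjI allI impI B'(1) dim t' dens' big)
      show "1 \<le> S * G" using S G1 mult_mono[of 1 S 1 G] by simp
      show "S * G \<le> G ^ Suc i" using S G1 by (simp add: mult.commute mult_left_mono)
    qed
    then show ?case by blast
  qed
  from this[of I] obtain B d S t u where "Q I B d S t u" by auto
  then have B: "bourgain_system B d" "1 \<le> t" "real (card {x \<in> B t. u + x \<in> A}) \<ge> (26/25) ^ I * a * real (card (B t))"
    unfolding Q_def by auto
  have "card {x \<in> B t. u + x \<in> A} \<le> card (B t)" using bourgain_systemD(1)[OF B(1), of t] B(2) by (intro card_mono) auto
  moreover have "1 * real (card (B t)) < (26/25) ^ I * a * real (card (B t))"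
    using I bourgain_system_card_pos[OF B(1), of t] B(2) by (intro mult_strict_right_mono) auto
  ultimately show False using B(3) by linarith
qed

section \<open>Choice of parameters\<close>

lemma two_power_le_exp: "2 ^ n \<le> exp (real n)"
proof -
  have "(2 :: real) ^ n \<le> exp 1 ^ n" using exp_ge_add_one_self[of "1 :: real"] by (intro power_mono) auto
  then show ?thesis by (simp add: exp_of_nat_mult[symmetric])
qed

lemma exp_le_four_power: "exp (real n) \<le> 4 ^ n"
proof -
  have "exp 1 ^ n \<le> (4 :: real) ^ n" using exp_le by (intro power_mono) auto
  then show ?thesis by (simp add: exp_of_nat_mult[symmetric])
qed

lemma power_le_exp: "0 \<le> x \<Longrightarrow> x ^ n \<le> exp (real n * x)" for x :: real
proof -
  assume "0 \<le> x"
  moreover have "x \<le> exp x" using exp_ge_add_one_self[of x] by linarith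
  ultimately have "x ^ n \<le> exp x ^ n" by (intro power_mono)
  then show ?thesis by (simp add: exp_of_nat_mult[symmetric])
qed

lemma real_nat_ceiling_bounds:
  assumes "x \<ge> 0"
  shows "x \<le> real (nat \<lceil>x\<rceil>)" "real (nat \<lceil>x\<rceil>) \<le> x + 1"
  using assms by linarith+

lemma iteration_parameters:
  fixes a r :: real
  assumes a: "0 < a" and r: "exp r = 2 / a" "r \<ge> 2"
  shows "\<exists>p k m M I. even p \<and> p \<ge> 100 \<and> (1/2) ^ p \<le> a / 2 \<and> k > 0 \<and> 2 * (1/4) ^ k \<le> a / 100 \<and>
    16 * exp (- (real m / (16000000 * real k ^ 2))) * real k / a ^ (8 * p) \<le> 1/1000 \<and> m > 0 \<and>
    16 * ln (8 * (2 / a ^ (8 * p)) ^ m) < real M \<and> M > 0 \<and> (26/25) ^ I * a > 1 \<and>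
    real k \<le> 6 * r \<and> real M \<le> 1800000000000000 * r ^ 6 \<and> real I \<le> 75 * r"
proof -
  define p where "p = 2 * nat \<lceil>25 * r\<rceil>"
  define k where "k = nat \<lceil>5 * r\<rceil>"
  \<comment> \<open>\<open>415 * 16000000 * 36\<close> is \<open>239040000000\<close>: with
    \<open>k \<le> 6 * r\<close> the Hoeffding exponent is at least \<open>415 * r ^ 2\<close>,
    against \<open>408 * r ^ 2\<close> from \<open>1 / a ^ (8 * p)\<close> and \<open>13 * r\<close>
    from the remaining factors.\<close>
  define m where "m = nat \<lceil>240000000000 * r ^ 4\<rceil>"
  \<comment> \<open>The bound on the logarithm is about \<open>250000000000 * 409 * r ^ 6\<close>,
    and 16 times this is \<open>1636000000000000 * r ^ 6\<close>.\<close>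
  define M where "M = nat \<lceil>1700000000000000 * r ^ 6\<rceil>"
  \<comment> \<open>Fifty steps multiply the density by at least 4, hence by more than
    \<open>exp 1\<close>.\<close>
  define I where "I = 50 * nat \<lceil>r\<rceil>"
  have r0: "r > 0" using r by simp
  have a_inv: "1 / a \<le> exp r" using r a by (simp add: divide_right_mono)
  have p: "50 * r \<le> real p" "real p \<le> 51 * r"
    using real_nat_ceiling_bounds[of "25 * r"] r unfolding p_def of_nat_mult of_nat_numeral by linarith+
  have k: "5 * r \<le> real k" "real k \<le> 6 * r"
    using real_nat_ceiling_bounds[of "5 * r"] r unfolding k_def by linarith+
  have r4: "r ^ 4 \<ge> 1" using r by (intro one_le_power) simp
  have r6: "r ^ 6 \<ge> 1" using r by (intro one_le_power) simp
  have r2: "2 * r \<le> r ^ 2" unfolding power2_eq_square using r by (intro mult_right_mono) auto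
  have m: "240000000000 * r ^ 4 \<le> real m" "real m \<le> 250000000000 * r ^ 4"
    using real_nat_ceiling_bounds[of "240000000000 * r ^ 4"] r4 unfolding m_def by linarith+
  have M: "1700000000000000 * r ^ 6 \<le> real M" "real M \<le> 1800000000000000 * r ^ 6"
    using real_nat_ceiling_bounds[of "1700000000000000 * r ^ 6"] r6 unfolding M_def by linarith+
  have I: "real I \<le> 75 * r"
    using real_nat_ceiling_bounds[of r] r unfolding I_def of_nat_mult of_nat_numeral by linarith
  have p100: "p \<ge> 100"
  proof -
    have "100 \<le> real p" using p r by linarith
    then show ?thesis by simp
  qed
  have half: "(1/2) ^ p \<le> a / 2"
  proof -
    have "2 / a \<le> exp (real (nat \<lceil>25 * r\<rceil>))" unfolding r(1)[symmetric]
      using r by (intro iffD2[OF exp_le_cancel_iff]) linarith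
    also have "\<dots> \<le> 4 ^ nat \<lceil>25 * r\<rceil>" by (rule exp_le_four_power)
    also have "\<dots> = 2 ^ p" by (simp add: p_def power_mult)
    finally show ?thesis using a by (simp add: power_divide field_simps)
  qed
  have quarter: "2 * (1/4) ^ k \<le> a / 100"
  proof -
    have "512 / a \<le> exp (4 * r) * exp r"
    proof -
      have "(256 :: real) = 2 ^ 8" by simp
      also have "\<dots> \<le> exp (real 8)" by (rule two_power_le_exp)
      also have "\<dots> \<le> exp (4 * r)" using r by simp
      finally have "256 * (2 / a) \<le> exp (4 * r) * exp r" unfolding r(1) using a by (intro mult_right_mono) auto
      then show ?thesis by simp
    qed
    also have "\<dots> = exp (5 * r)" by (simp add: exp_add[symmetric])
    also have "\<dots> \<le> exp (real k)" using k by simp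
    also have "\<dots> \<le> 4 ^ k" by (rule exp_le_four_power)
    finally have "512 / a \<le> 4 ^ k" .
    then have "512 \<le> a * 4 ^ k" using a by (simp add: field_simps)
    then show ?thesis using a by (simp add: power_divide field_simps)
  qed
  have \<sigma>_inv: "1 / a ^ (8 * p) \<le> exp (408 * r ^ 2)"
  proof -
    have "1 / a ^ (8 * p) = (1 / a) ^ (8 * p)" by (simp add: power_divide)
    also have "\<dots> \<le> exp r ^ (8 * p)" using a a_inv by (intro power_mono) auto
    also have "\<dots> = exp (8 * real p * r)" by (simp add: exp_of_nat_mult[symmetric])
    also have "\<dots> \<le> exp (408 * r ^ 2)"
    proof -
      have "8 * real p * r \<le> 8 * (51 * r) * r" using p r0 by (intro mult_right_mono) auto
      then show ?thesis by (simp add: power2_eq_square)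
    qed
    finally show ?thesis .
  qed
  have k0: "k > 0" using k r by (cases k) auto
  have hoeffding: "16 * exp (- (real m / (16000000 * real k ^ 2))) * real k / a ^ (8 * p) \<le> 1/1000"
  proof -
    define x where "x = real m / (16000000 * real k ^ 2)"
    have "(415 * r ^ 2) * (16000000 * real k ^ 2) \<le> (415 * r ^ 2) * (16000000 * (6 * r) ^ 2)"
      using k by (intro mult_left_mono power_mono) auto
    also have "\<dots> = 239040000000 * r ^ 4" by (simp add: power2_eq_square power4_eq_xxxx)
    also have "\<dots> \<le> real m" using m r4 by linarith
    finally have x: "415 * r ^ 2 \<le> x" using k0 by (simp add: x_def pos_le_divide_eq)
    have "16000 * (real k * (1 / a ^ (8 * p))) \<le> exp (7 * r) * (exp (6 * r) * exp (408 * r ^ 2))"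
    proof (intro mult_mono \<sigma>_inv)
      have "(16000 :: real) \<le> 2 ^ 14" by simp
      also have "\<dots> \<le> exp (real 14)" by (rule two_power_le_exp)
      also have "\<dots> \<le> exp (7 * r)" using r by simp
      finally show "16000 \<le> exp (7 * r)" .
      show "real k \<le> exp (6 * r)" using k exp_ge_add_one_self[of "6 * r"] by linarith
    qed (use a in auto)
    also have "\<dots> = exp (13 * r + 408 * r ^ 2)" by (simp add: exp_add[symmetric])
    also have "\<dots> \<le> exp x" using x r2 r0 by simp
    finally have "16000 * (real k * (1 / a ^ (8 * p))) \<le> exp x" .
    then have "16000 * (real k * (1 / a ^ (8 * p))) * exp (- x) \<le> exp x * exp (- x)" by (intro mult_right_mono) auto
    then have "16000 * (real k * (1 / a ^ (8 * p))) * exp (- x) \<le> 1" by (simp add: exp_add[symmetric])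
    then show ?thesis unfolding x_def[symmetric] by (simp add: mult_ac)
  qed
  have m0: "m > 0" using m r4 by (cases m) auto
  have chang: "16 * ln (8 * (2 / a ^ (8 * p)) ^ m) < real M"
  proof -
    have "2 / a ^ (8 * p) = 2 ^ 1 * (1 / a ^ (8 * p))" by simp
    also have "\<dots> \<le> exp (real 1) * exp (408 * r ^ 2)" using a by (intro mult_mono two_power_le_exp \<sigma>_inv) auto
    also have "\<dots> \<le> exp (409 * r ^ 2)" using r2 r by (simp add: exp_add[symmetric])
    finally have "(2 / a ^ (8 * p)) ^ m \<le> exp (409 * r ^ 2) ^ m" using a by (intro power_mono) auto
    then have "8 * (2 / a ^ (8 * p)) ^ m \<le> exp (real 3) * exp (real m * (409 * r ^ 2))"
      using two_power_le_exp[of 3] a by (intro mult_mono) (auto simp: exp_of_nat_mult[symmetric])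
    also have "\<dots> = exp (3 + real m * (409 * r ^ 2))" by (simp add: exp_add)
    finally have "ln (8 * (2 / a ^ (8 * p)) ^ m) \<le> ln (exp (3 + real m * (409 * r ^ 2)))"
      using a by (intro ln_mono) auto
    then have "ln (8 * (2 / a ^ (8 * p)) ^ m) \<le> 3 + real m * (409 * r ^ 2)" by simp
    also have "\<dots> \<le> 3 + (250000000000 * r ^ 4) * (409 * r ^ 2)"
      using m by (intro add_left_mono mult_right_mono) auto
    also have "(250000000000 * r ^ 4) * (409 * r ^ 2) = 102250000000000 * r ^ 6"
      by (simp add: power_add[symmetric])
    finally show ?thesis using M r6 by linarith
  qed
  have M0: "M > 0" using M r6 by (cases M) auto
  have steps: "(26/25) ^ I * a > 1"
  proof -
    have "1 + real 25 * (1/25) \<le> (1 + 1/25 :: real) ^ 25" by (rule Bernoulli_inequality) simp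
    then have "2 ^ 2 \<le> ((26/25 :: real) ^ 25) ^ 2" by (intro power_mono) auto
    then have four: "4 \<le> (26/25 :: real) ^ 50" by (simp add: power_mult[symmetric])
    have "2 / a \<le> exp (real (nat \<lceil>r\<rceil>))" unfolding r(1)[symmetric]
      by (intro iffD2[OF exp_le_cancel_iff]) linarith
    also have "\<dots> \<le> 4 ^ nat \<lceil>r\<rceil>" by (rule exp_le_four_power)
    also have "\<dots> \<le> ((26/25) ^ 50) ^ nat \<lceil>r\<rceil>" using four by (intro power_mono) auto
    also have "\<dots> = (26/25) ^ I" by (simp add: I_def power_mult)
    finally have "2 \<le> (26/25) ^ I * a" using a by (simp add: field_simps)
    then show ?thesis by linarith
  qed
  have "even p" by (simp add: p_def)
  then show ?thesis
    using p100 half k0 quarter hoeffding m0 chang M0 steps k(2) M(2) I by blast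
qed

theorem theorem3:
  "\<exists>C c :: real. C > 0 \<and> c > 0 \<and>
    (\<forall>(N :: int) (A :: int set) (\<alpha> :: real).
       N \<ge> 1 \<longrightarrow> A \<subseteq> {1..N} \<longrightarrow> \<alpha> > 0 \<longrightarrow> real (card A) = \<alpha> * real_of_int N \<longrightarrow>
       (\<exists>P k. is_AP_of_length P k \<and> P \<subseteq> A + A + A \<and>
          real k \<ge> exp (- C * (ln (2 / \<alpha>))\<^sup>2) * real_of_int N powr (c / (ln (2 / \<alpha>)) ^ 9)))"
proof (rule exI[of _ "300000 :: real"], rule exI[of _ "1 / 10 ^ 23 :: real"], intro conjI allI impI)
  fix N :: int and A :: "int set" and \<alpha> :: real
  assume N: "N \<ge> 1" and A: "A \<subseteq> {1..N}" and \<alpha>: "\<alpha> > 0" and cA: "real (card A) = \<alpha> * real_of_int N"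
  define N' where "N' = real_of_int N"
  have N': "N' \<ge> 1" using N by (simp add: N'_def)
  have \<alpha>1: "\<alpha> \<le> 1"
  proof -
    have "real (card A) \<le> N'" using card_mono[OF _ A] N by (simp add: N'_def)
    then have "\<alpha> * N' \<le> 1 * N'" using cA by (simp add: N'_def)
    then show ?thesis using N' by simp
  qed
  define L where "L = ln (2 / \<alpha>)"
  \<comment> \<open>The 5 is the one required by \<open>iterated_density_increment\<close>.\<close>
  define a where "a = \<alpha> / 5"
  define r where "r = ln (2 / a)"
  have a: "a > 0" using \<alpha> by (simp add: a_def)
  have ln2: "ln 2 \<ge> (1/2 :: real)"
  proof -
    have "1 \<le> ln (4 :: real)" using exp_le by (simp add: ln_ge_iff)
    also have "ln (4 :: real) = 2 * ln 2" using ln_realpow[of 2 2] by simp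
    finally show ?thesis by simp
  qed
  have Lln2: "L \<ge> ln 2" unfolding L_def using \<alpha> \<alpha>1 by (intro ln_mono) (auto simp: field_simps)
  then have L: "L \<ge> 1/2" using ln2 by linarith
  have expr: "exp r = 2 / a" using a by (simp add: r_def)
  have r2: "r \<ge> 2"
  proof -
    have "exp (2 :: real) = exp 1 ^ 2" by (simp add: exp_of_nat_mult[symmetric])
    also have "\<dots> \<le> 3 ^ 2" using exp_le by (intro power_mono) auto
    also have "\<dots> \<le> 2 / a" using \<alpha> \<alpha>1 by (simp add: a_def field_simps)
    finally show ?thesis using a by (simp add: r_def ln_ge_iff)
  qed
  have rL: "r \<le> 4 * L"
  proof -
    have "2 / a = 2 / \<alpha> * 5" by (simp add: a_def)
    then have "r = L + ln 5" unfolding r_def L_def using \<alpha> by (simp only: ln_mult_pos divide_pos_pos zero_less_numeral)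
    moreover have "ln 5 \<le> ln (2 ^ 3 :: real)" by (intro ln_mono) auto
    moreover have "ln (2 ^ 3 :: real) = 3 * ln 2" by (subst ln_realpow) auto
    ultimately show ?thesis using Lln2 by linarith
  qed
  obtain p k m M I where par: "even p" "p \<ge> 100" "(1/2) ^ p \<le> a / 2" "k > 0" "2 * (1/4) ^ k \<le> a / 100"
    "16 * exp (- (real m / (16000000 * real k ^ 2))) * real k / a ^ (8 * p) \<le> 1/1000" "m > 0"
    "16 * ln (8 * (2 / a ^ (8 * p)) ^ m) < real M" "M > 0" "(26/25) ^ I * a > 1"
    and kle: "real k \<le> 6 * r" and Mle: "real M \<le> 1800000000000000 * r ^ 6" and Ile: "real I \<le> 75 * r"
    using iteration_parameters[OF a expr r2] by (elim exE conjE) (rule that)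
  define D where "D = 1 + I * M"
  define h where "h = a / (14000 * real D)"
  define h4 where "h4 = a * h / (105369600 * real D ^ 3 * real k * real M)"
  define w where "w = a / (400 * real M)"
  define G where "G = 2 / (h4 * w)"
  have D0: "real D \<ge> 1" by (simp add: D_def)
  have "5 * a * real_of_int N \<le> real (card A)" using cA by (simp add: a_def)
  from iterated_density_increment[OF N A this a par(1-5) refl par(6-10) D_def h_def h4_def w_def]
  obtain B S v where B: "bourgain_system B D" "0 < S" "S \<le> G ^ I"
    "\<And>x. \<bar>real_of_int x\<bar> \<le> N' \<Longrightarrow> x \<in> B S" "\<And>y. y \<in> B (h / 6) \<Longrightarrow> v + y \<in> A + A + A"
    unfolding G_def N'_def by blast
  have h0: "h > 0" using a D0 by (simp add: h_def)
  \<comment> \<open>As \<open>81 \<le> 2 ^ 7\<close>, the number of halvings may be the integer part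
    of the solution of \<open>2 ^ (7 * D * x) = N'\<close>. Rounding costs a factor 2, which turns
    \<open>h / 6\<close> into \<open>h / 12\<close> in \<open>width\<close>.\<close>
  define x where "x = ln N' / (7 * real D * ln 2)"
  define j where "j = nat \<lfloor>x\<rfloor>"
  have x0: "x \<ge> 0" using N' D0 ln2 by (simp add: x_def)
  have j: "real j \<le> x" "x \<le> real j + 1" using x0 unfolding j_def by linarith+
  have "(81 :: real) ^ (D * j) \<le> N'"
  proof -
    have "(81 :: real) ^ (D * j) \<le> (2 ^ 7) ^ (D * j)" by (intro power_mono) auto
    also have "\<dots> = (2 :: real) ^ (7 * (D * j))" by (simp only: power_mult)
    also have "\<dots> = exp (real (7 * (D * j)) * ln 2)" by (simp only: exp_of_nat_mult exp_ln zero_less_numeral)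
    also have "\<dots> = exp ((7 * real D * real j) * ln 2)" by simp
    also have "\<dots> \<le> exp ((7 * real D * x) * ln 2)"
      using j ln2 D0 by (intro iffD2[OF exp_le_cancel_iff] mult_right_mono mult_left_mono) auto
    also have "(7 * real D * x) * ln 2 = ln N'" using D0 ln2 by (simp add: x_def)
    finally show ?thesis using N' by simp
  qed
  moreover have "h / 6 > 0" using h0 by simp
  ultimately obtain P n where P: "is_AP_of_length P n" "P \<subseteq> A + A + A" "2 ^ j * (h / 6) / S \<le> real n"
    using arithmetic_progression_in_translate[where s="h / 6", OF B(1,2,4) N' _ B(5)] by blast
  have r0: "r > 0" using r2 by simp
  have Dle: "real D \<le> 140000000000000000 * r ^ 7"
  proof -
    have "real I * real M \<le> (75 * r) * (1800000000000000 * r ^ 6)" using Ile Mle r0 by (intro mult_mono) auto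
    also have "\<dots> = 135000000000000000 * r ^ 7" by (simp add: power_Suc[symmetric] del: power_Suc)
    finally have "real D \<le> 1 + 135000000000000000 * r ^ 7" by (simp add: D_def)
    moreover have "r ^ 7 \<ge> 1" using r2 by (intro one_le_power) simp
    ultimately show ?thesis by linarith
  qed
  \<comment> \<open>Since \<open>r \<ge> 2\<close>, a numerical constant up to \<open>4 ^ e\<close>
    is at most \<open>exp (e * r)\<close>; all constants and powers of \<open>r\<close> are thus
    absorbed into exponentials linear in \<open>r\<close>.\<close>
  have scale: "real n' \<le> exp (real e * r)" if "real n' \<le> 2 ^ e * 2 ^ e" for n' e :: nat
  proof -
    have "2 ^ e * 2 ^ e = (2 :: real) ^ (2 * e)" by (simp add: power_add[symmetric] mult_2)
    also have "\<dots> \<le> exp (real (2 * e))" by (rule two_power_le_exp)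
    also have "\<dots> \<le> exp (real e * r)" using mult_left_mono[OF r2, of "real e"] by simp
    finally show ?thesis using that by linarith
  qed
  have Dexp: "real D \<le> exp (36 * r)"
  proof -
    have "140000000000000000 * r ^ 7 \<le> exp (real 29 * r) * exp (real 7 * r)"
      using scale[of 140000000000000000 29] r0 by (intro mult_mono power_le_exp) auto
    then show ?thesis using Dle by (simp add: exp_add[symmetric])
  qed
  have kexp: "real k \<le> exp (3 * r)"
  proof -
    have "6 * r ^ 1 \<le> exp (real 2 * r) * exp (real 1 * r)"
      using scale[of 6 2] r0 by (intro mult_mono power_le_exp) auto
    then show ?thesis using kle by (simp add: exp_add[symmetric])
  qed
  have Mexp: "real M \<le> exp (32 * r)"
  proof -
    have "1800000000000000 * r ^ 6 \<le> exp (real 26 * r) * exp (real 6 * r)"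
      using scale[of 1800000000000000 26] r0 by (intro mult_mono power_le_exp) auto
    then show ?thesis using Mle by (simp add: exp_add[symmetric])
  qed
  have a_inv: "1 / a \<le> exp r" unfolding expr using a by (simp add: divide_right_mono)
  have G: "G = 1180139520000000 * (real D ^ 4 * (real k * (real M ^ 2 * (1 / a) ^ 3)))"
    using a D0 par by (simp add: G_def h4_def w_def h_def field_simps power2_eq_square power3_eq_cube power4_eq_xxxx)
  \<comment> \<open>The exponent is \<open>26 + 4 * 36 + 3 + 2 * 32 + 3\<close>, read off from the
    formula \<open>G\<close>.\<close>
  have Gexp: "G \<le> exp (240 * r)"
  proof -
    have "G \<le> exp (real 26 * r) * (exp (36 * r) ^ 4 * (exp (3 * r) * (exp (32 * r) ^ 2 * exp r ^ 3)))"
      unfolding G using scale[of 1180139520000000 26] a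
      by (intro mult_mono power_mono Dexp kexp Mexp a_inv) auto
    also have "\<dots> = exp (240 * r)" by (simp add: exp_of_nat_mult[symmetric] exp_add[symmetric])
    finally show ?thesis .
  qed
  have Sexp: "S \<le> exp (18000 * r\<^sup>2)"
  proof -
    have "G \<ge> 0" unfolding G using a by simp
    then have "G ^ I \<le> exp (240 * r) ^ I" using Gexp by (intro power_mono) auto
    also have "\<dots> = exp (real I * (240 * r))" by (simp add: exp_of_nat_mult)
    also have "\<dots> \<le> exp ((75 * r) * (240 * r))" using Ile r0 by (intro iffD2[OF exp_le_cancel_iff] mult_right_mono) auto
    finally show ?thesis using B(3) by (simp add: power2_eq_square)
  qed
  \<comment> \<open>With \<open>2 * r \<le> r^2\<close> the exponent is at most
    \<open>18023 * r^2\<close>, and \<open>r \<le> 4 * L\<close> multiplies this by 16.\<close>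
  have width: "exp (- 300000 * L\<^sup>2) \<le> h / (12 * S)"
  proof -
    have "(168000 * real D) * S / a = 168000 * (real D * (S * (1 / a)))" by simp
    also have "\<dots> \<le> exp (real 9 * r) * (exp (36 * r) * (exp (18000 * r\<^sup>2) * exp r))"
      using scale[of 168000 9] a B(2) by (intro mult_mono Dexp Sexp a_inv) auto
    also have "\<dots> = exp (46 * r + 18000 * r\<^sup>2)" by (simp add: exp_add[symmetric] algebra_simps)
    also have "\<dots> \<le> exp (300000 * L\<^sup>2)"
    proof -
      have "2 * r \<le> r\<^sup>2" unfolding power2_eq_square using r2 by (intro mult_right_mono) auto
      moreover have "r\<^sup>2 \<le> (4 * L)\<^sup>2" using rL r0 by (intro power_mono) auto
      ultimately have "2 * r \<le> r\<^sup>2" "r\<^sup>2 \<le> 16 * L\<^sup>2" by (simp_all add: power_mult_distrib)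
      moreover have "L\<^sup>2 \<ge> 0" by simp
      ultimately have "46 * r + 18000 * r\<^sup>2 \<le> 300000 * L\<^sup>2" by linarith
      then show ?thesis by simp
    qed
    finally have "1 / exp (300000 * L\<^sup>2) \<le> 1 / ((168000 * real D) * S / a)"
      using a B(2) D0 by (intro divide_left_mono) auto
    then show ?thesis using a B(2) D0 by (simp add: h_def exp_minus field_simps)
  qed
  \<comment> \<open>The rank is of order \<open>L ^ 7\<close>; it is passed to \<open>L ^ 9\<close>
    by \<open>L \<ge> 1/2\<close>, at the cost of a factor 4.\<close>
  have long: "N' powr (1 / 10 ^ 23 / L ^ 9) \<le> 2 * 2 ^ j"
  proof -
    have "7 * real D \<le> 980000000000000000 * r ^ 7" using Dle by simp
    also have "\<dots> \<le> 980000000000000000 * (4 * L) ^ 7" using rL r0 by (intro mult_left_mono power_mono) auto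
    also have "\<dots> = 4014080000000000000000 * (4 * L ^ 7)" by (simp add: power_mult_distrib)
    also have "\<dots> \<le> 4014080000000000000000 * (16 * L ^ 9)"
    proof -
      have "L ^ 7 * (1/2)\<^sup>2 \<le> L ^ 7 * L\<^sup>2" using L by (intro mult_left_mono power_mono) auto
      then have "L ^ 7 \<le> 4 * L ^ 9" by (simp add: power_add[symmetric] power_divide)
      then show ?thesis by simp
    qed
    also have "\<dots> \<le> 10 ^ 23 * L ^ 9" using L by (simp add: mult_right_mono)
    finally have le: "7 * real D \<le> 10 ^ 23 * L ^ 9" .
    have "1 / 10 ^ 23 / L ^ 9 \<le> 1 / (7 * real D)"
      using divide_left_mono[OF le, of 1] D0 L by simp
    then have "N' powr (1 / 10 ^ 23 / L ^ 9) \<le> N' powr (1 / (7 * real D))" using N' by (intro powr_mono) auto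
    also have "\<dots> = exp (x * ln 2)" using N' D0 ln2 by (simp add: powr_def x_def)
    also have "\<dots> \<le> exp ((real j + 1) * ln 2)" using j ln2 by (intro iffD2[OF exp_le_cancel_iff] mult_right_mono) auto
    also have "\<dots> = 2 * 2 ^ j" by (simp add: distrib_right exp_add exp_of_nat_mult)
    finally show ?thesis .
  qed
  have "exp (- 300000 * L\<^sup>2) * N' powr (1 / 10 ^ 23 / L ^ 9) \<le> h / (12 * S) * (2 * 2 ^ j)"
    using h0 B(2) by (intro mult_mono width long) auto
  also have "\<dots> = 2 ^ j * (h / 6) / S" by simp
  also note P(3)
  finally have "exp (- 300000 * L\<^sup>2) * N' powr (1 / 10 ^ 23 / L ^ 9) \<le> real n" .
  then show "\<exists>P k. is_AP_of_length P k \<and> P \<subseteq> A + A + A \<and>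
      exp (- 300000 * (ln (2 / \<alpha>))\<^sup>2) * real_of_int N powr (1 / 10 ^ 23 / ln (2 / \<alpha>) ^ 9) \<le> real k"
    using P(1,2) unfolding L_def N'_def by blast
qed simp_all

end
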